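(* Let $\{\mathcal F,\mathcal G\}$ be a minimal Hilbert C*-system with fixed point algebra $\mathcal A$ satisfying Property B and with center $\mathcal Z=\mathcal A\cap\mathcal A'$, and assume that $\rho|_{\mathcal Z}=\mathrm{id}_{\mathcal Z}$ for every canonical endomorphism $\rho$ of $\mathcal A$ (triviality of the chain group homomorphism). Then the center of $\mathcal F$ coincides with $\mathcal Z$, i.e. $\mathcal F\cap\mathcal F'=\mathcal Z$.
   Context: C*-algebras are unital. An algebraic Hilbert space in $\mathcal F$ is a finite-dimensional subspace $\mathcal H\subset\mathcal F$ with $A^*B\in\mathbb C\mathbf 1$ for $A,B\in\mathcal H$, scalar product $\langle A,B\rangle\mathbf 1=A^*B$, always assumed to have support $\sum_j\Phi_j\Phi_j^*=\mathbf 1$ ($\{\Phi_j\}$ an orthonormal basis). For a compact group $\mathcal G$ acting on $\mathcal F$ by a pointwise norm-continuous homomorphism $\alpha:\mathcal G\to\mathrm{Aut}\,\mathcal F$ and $D\in\widehat{\mathcal G}$ (classes of irreducible unitary representations) put $\Pi_D(F)=\int_{\mathcal G}\overline{\chi_D(g)}\,\alpha_g(F)\,dg$, $\chi_D(g)=\dim D\cdot\mathrm{Tr}\,\pi(g)$, $\pi\in D$. The system is a Hilbert C*-system if for each $D$ there is an $\alpha_{\mathcal G}$-invariant algebraic Hilbert space $\mathcal H_D\subset\Pi_D\mathcal F$ carrying a representation of class $D$. One identifies $\mathcal G$ with $\alpha_{\mathcal G}$ and writes $\{\mathcal F,\mathcal G\}$. Minimal: $\mathcal A'\cap\mathcal F=\mathcal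 Z$. Property B: $\mathcal A$ contains isometries $V,W$ with $VV^*+WW^*=\mathbf 1$. Canonical endomorphisms: $\rho_{\mathcal H}(A)=\sum_j\Phi_jA\Phi_j^*$, $A\in\mathcal A$, for $\mathcal G$-invariant algebraic Hilbert spaces $\mathcal H\subset\mathcal F$. The chain group homomorphism is $[D]\mapsto\rho_{\mathcal H_D}|_{\mathcal Z}\in\mathrm{Aut}\,\mathcal Z$, where $[D]$ is the class of $D\in\widehat{\mathcal G}$ under the relation: $D\approx D'$ iff both occur in the decomposition of some tensor product $U_{D_1}\otimes\dots\otimes U_{D_n}$ of irreducible representations of $\mathcal G$. Its triviality is equivalent to the displayed assumption $\rho|_{\mathcal Z}=\mathrm{id}_{\mathcal Z}$ for all canonical $\rho$. *)

theory Defs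
  imports
    "HOL-Probability.Probability_Measure"
    "Jordan_Normal_Form.Schur_Decomposition"
begin

section \<open>Unital C*-algebras\<close>

text \<open>
  The superclass \<^class>\<open>real_normed_algebra_1\<close> already contains \<open>norm 1 = 1\<close>, so the algebra is nonzero; completeness is
  the superclass \<^class>\<open>banach\<close>.
\<close>

class cstar_algebra = real_normed_algebra_1 + banach +
  fixes scaleC :: "complex \<Rightarrow> 'a \<Rightarrow> 'a" (infixr "*\<^sub>C" 75)
    and star :: "'a \<Rightarrow> 'a"
  assumes scaleC_add_right: "c *\<^sub>C (x + y) = c *\<^sub>C x + c *\<^sub>C y"
    and scaleC_add_left: "(c + d) *\<^sub>C x = c *\<^sub>C x + d *\<^sub>C x"
    and scaleC_scaleC: "c *\<^sub>C (d *\<^sub>C x) = (c * d) *\<^sub>C x"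
    and scaleR_scaleC: "r *\<^sub>R x = complex_of_real r *\<^sub>C x"
    and mult_scaleC_left: "(c *\<^sub>C x) * y = c *\<^sub>C (x * y)"
    and mult_scaleC_right: "x * (c *\<^sub>C y) = c *\<^sub>C (x * y)"
    and norm_scaleC: "norm (c *\<^sub>C x) = cmod c * norm x"
    and star_star: "star (star x) = x"
    and star_add: "star (x + y) = star x + star y"
    and star_scaleC: "star (c *\<^sub>C x) = cnj c *\<^sub>C star x"
    and star_mult: "star (x * y) = star y * star x"
    and cstar_identity: "norm (star x * x) = (norm x)\<^sup>2"

interpretation cstar: vector_space "scaleC :: complex \<Rightarrow> 'a \<Rightarrow> 'a::cstar_algebra"
proof
  fix x :: 'a
  have "1 *\<^sub>R x = complex_of_real 1 *\<^sub>C x" by (rule scaleR_scaleC)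
  then show "1 *\<^sub>C x = x" by simp
qed (simp_all add: scaleC_add_right scaleC_add_left scaleC_scaleC)

definition commutant :: "'a::cstar_algebra set \<Rightarrow> 'a set"
  where "commutant S = {x. \<forall>y\<in>S. x * y = y * x}"

definition star_automorphism :: "('a::cstar_algebra \<Rightarrow> 'a) \<Rightarrow> bool"
  where "star_automorphism \<phi> \<longleftrightarrow> bij \<phi>
    \<and> (\<forall>x y. \<phi> (x + y) = \<phi> x + \<phi> y)
    \<and> (\<forall>c x. \<phi> (c *\<^sub>C x) = c *\<^sub>C \<phi> x)
    \<and> (\<forall>x y. \<phi> (x * y) = \<phi> x * \<phi> y)
    \<and> (\<forall>x. \<phi> (star x) = star (\<phi> x))"

definition isometry :: "'a::cstar_algebra \<Rightarrow> bool"
  where "isometry V \<longleftrightarrow> star V * V = 1"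

definition property_B :: "'a::cstar_algebra set \<Rightarrow> bool"
  where "property_B A \<longleftrightarrow>
    (\<exists>V\<in>A. \<exists>W\<in>A. isometry V \<and> isometry W \<and> V * star V + W * star W = 1)"


section \<open>Algebraic Hilbert spaces and canonical endomorphisms\<close>

text \<open>Meaningful if \<open>star A * B\<close> is a scalar, which holds within an algebraic Hilbert space.\<close>

definition alg_inner :: "'a::cstar_algebra \<Rightarrow> 'a \<Rightarrow> complex"
  where "alg_inner A B = (THE c. star A * B = c *\<^sub>C 1)"

definition orthonormal_basis :: "'a::cstar_algebra set \<Rightarrow> nat \<Rightarrow> (nat \<Rightarrow> 'a) \<Rightarrow> bool"
  where "orthonormal_basis H n \<Phi> \<longleftrightarrow>
    (\<forall>i<n. \<forall>j<n. alg_inner (\<Phi> i) (\<Phi> j) = (if i = j then 1 else 0))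
    \<and> cstar.span (\<Phi> ` {..<n}) = H"

text \<open>
  The sum in the support condition is the same for all orthonormal bases, and there is at least
  one of them.
\<close>

definition algebraic_hilbert_space :: "'a::cstar_algebra set \<Rightarrow> bool"
  where "algebraic_hilbert_space H \<longleftrightarrow>
    cstar.subspace H
    \<and> (\<exists>B. finite B \<and> cstar.span B = H)
    \<and> (\<forall>A\<in>H. \<forall>B\<in>H. \<exists>c. star A * B = c *\<^sub>C 1)
    \<and> (\<forall>n \<Phi>. orthonormal_basis H n \<Phi> \<longrightarrow> (\<Sum>j<n. \<Phi> j * star (\<Phi> j)) = 1)"

text \<open>
  \<open>\<rho>\<^sub>H\<close>; its value does not depend on the orthonormal basis that is chosen.
\<close>

definition canonical_endo :: "'a::cstar_algebra set \<Rightarrow> 'a \<Rightarrow> 'a"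
  where "canonical_endo H A =
    (let (n, \<Phi>) = (SOME (n, \<Phi>). orthonormal_basis H n \<Phi>) in \<Sum>j<n. \<Phi> j * A * star (\<Phi> j))"


section \<open>Irreducible unitary representations of a compact group\<close>

text \<open>
  Groups are written additively, but are not assumed to be commutative: this is the convention
  of \<^class>\<open>group_add\<close> and \<^class>\<open>topological_group_add\<close>. A class \<open>D\<close> of irreducible unitary
  representations is given by a representative \<open>\<pi>\<close> on \<open>\<complex>\<^sup>n\<close>; for a compact group all of them
  are finite-dimensional.
\<close>

definition unitary_rep :: "nat \<Rightarrow> ('g::topological_group_add \<Rightarrow> complex mat) \<Rightarrow> bool"
  where "unitary_rep n \<pi> \<longleftrightarrow>
    (\<forall>g. \<pi> g \<in> carrier_mat n n \<and> mat_adjoint (\<pi> g) * \<pi> g = 1\<^sub>m n)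
    \<and> (\<forall>g h. \<pi> (g + h) = \<pi> g * \<pi> h)
    \<and> (\<forall>i<n. \<forall>j<n. continuous_on UNIV (\<lambda>g. \<pi> g $$ (i, j)))"

definition vec_subspace :: "nat \<Rightarrow> complex Matrix.vec set \<Rightarrow> bool"
  where "vec_subspace n W \<longleftrightarrow> W \<subseteq> carrier_vec n \<and> 0\<^sub>v n \<in> W
    \<and> (\<forall>v\<in>W. \<forall>w\<in>W. v + w \<in> W) \<and> (\<forall>c. \<forall>v\<in>W. c \<cdot>\<^sub>v v \<in> W)"

definition irreducible_unitary_rep ::
    "nat \<Rightarrow> ('g::topological_group_add \<Rightarrow> complex mat) \<Rightarrow> bool"
  where "irreducible_unitary_rep n \<pi> \<longleftrightarrow> unitary_rep n \<pi> \<and> 0 < n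
    \<and> (\<forall>W. vec_subspace n W \<and> (\<forall>g. \<forall>w\<in>W. \<pi> g *\<^sub>v w \<in> W)
          \<longrightarrow> W = {0\<^sub>v n} \<or> W = carrier_vec n)"

text \<open>The character includes the factor \<open>dim D\<close>.\<close>

definition modified_character :: "nat \<Rightarrow> ('g \<Rightarrow> complex mat) \<Rightarrow> 'g \<Rightarrow> complex"
  where "modified_character n \<pi> g = of_nat n * (\<Sum>i<n. \<pi> g $$ (i, i))"

text \<open>
  Normalised Haar measure. Regularity is part of the definition because \<open>'g\<close> need not be
  second countable.
\<close>

definition haar_measure :: "'g::topological_group_add measure \<Rightarrow> bool"
  where "haar_measure \<mu> \<longleftrightarrow> prob_space \<mu> \<and> sets \<mu> = sets borel
    \<and> (\<forall>g. distr \<mu> borel (\<lambda>h. g + h) = \<mu>)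
    \<and> (\<forall>A\<in>sets borel. emeasure \<mu> A = (SUP K\<in>{K. compact K \<and> K \<subseteq> A}. emeasure \<mu> K))"

text \<open>
  The Bochner integral as in \<^const>\<open>has_bochner_integral\<close>, without requiring the codomain to be
  second countable, since the C*-algebra need not be separable.
\<close>

inductive has_strong_integral :: "'g measure \<Rightarrow> ('g \<Rightarrow> 'a::real_normed_vector) \<Rightarrow> 'a \<Rightarrow> bool"
  for M f x where
  "f \<in> borel_measurable M \<Longrightarrow>
    (\<And>i. simple_bochner_integrable M (s i)) \<Longrightarrow>
    (\<lambda>i. \<integral>\<^sup>+x. norm (f x - s i x) \<partial>M) \<longlonglongrightarrow> 0 \<Longrightarrow>
    (\<lambda>i. simple_bochner_integral M (s i)) \<longlonglongrightarrow> x \<Longrightarrow>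
    has_strong_integral M f x"

definition strong_integral :: "'g measure \<Rightarrow> ('g \<Rightarrow> 'a::real_normed_vector) \<Rightarrow> 'a"
  where "strong_integral M f = (THE x. has_strong_integral M f x)"


section \<open>Hilbert C*-systems\<close>

definition group_action :: "('g::topological_group_add \<Rightarrow> 'f::cstar_algebra \<Rightarrow> 'f) \<Rightarrow> bool"
  where "group_action \<alpha> \<longleftrightarrow>
    (\<forall>g. star_automorphism (\<alpha> g))
    \<and> (\<forall>g h. \<alpha> (g + h) = \<alpha> g \<circ> \<alpha> h)
    \<and> (\<forall>F. continuous_on UNIV (\<lambda>g. \<alpha> g F))"

text \<open>\<open>\<Pi>\<^sub>D\<close>\<close>

definition spectral_projection ::
    "'g measure \<Rightarrow> ('g \<Rightarrow> 'f \<Rightarrow> 'f) \<Rightarrow> nat \<Rightarrow> ('g \<Rightarrow> complex mat) \<Rightarrow> 'f::cstar_algebra \<Rightarrow> 'f"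
  where "spectral_projection \<mu> \<alpha> n \<pi> F =
    strong_integral \<mu> (\<lambda>g. cnj (modified_character n \<pi> g) *\<^sub>C \<alpha> g F)"

definition invariant_space :: "('g \<Rightarrow> 'f \<Rightarrow> 'f) \<Rightarrow> 'f set \<Rightarrow> bool"
  where "invariant_space \<alpha> H \<longleftrightarrow> (\<forall>g. \<alpha> g ` H \<subseteq> H)"

text \<open>
  The action on \<open>H\<close> is unitarily equivalent to \<open>\<pi>\<close>: in a suitable orthonormal basis of \<open>H\<close> its
  matrix is \<open>\<pi>\<close>.
\<close>

definition carries_rep ::
    "('g \<Rightarrow> 'f \<Rightarrow> 'f) \<Rightarrow> 'f::cstar_algebra set \<Rightarrow> nat \<Rightarrow> ('g \<Rightarrow> complex mat) \<Rightarrow> bool"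
  where "carries_rep \<alpha> H n \<pi> \<longleftrightarrow>
    (\<exists>\<Phi>. orthonormal_basis H n \<Phi>
      \<and> (\<forall>g. \<forall>j<n. \<alpha> g (\<Phi> j) = (\<Sum>i<n. (\<pi> g $$ (i, j)) *\<^sub>C \<Phi> i)))"

definition hilbert_cstar_system ::
    "'g::{topological_group_add, t2_space} measure \<Rightarrow> ('g \<Rightarrow> 'f::cstar_algebra \<Rightarrow> 'f) \<Rightarrow> bool"
  where "hilbert_cstar_system \<mu> \<alpha> \<longleftrightarrow>
    compact (UNIV :: 'g set) \<and> haar_measure \<mu> \<and> group_action \<alpha>
    \<and> (\<forall>n \<pi>. irreducible_unitary_rep n \<pi> \<longrightarrow>
          (\<exists>H. algebraic_hilbert_space H \<and> invariant_space \<alpha> H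
             \<and> H \<subseteq> range (spectral_projection \<mu> \<alpha> n \<pi>) \<and> carries_rep \<alpha> H n \<pi>))"

definition fixed_point_algebra :: "('g \<Rightarrow> 'f \<Rightarrow> 'f) \<Rightarrow> 'f set"
  where "fixed_point_algebra \<alpha> = {F. \<forall>g. \<alpha> g F = F}"

definition fixed_point_center :: "('g \<Rightarrow> 'f \<Rightarrow> 'f) \<Rightarrow> 'f::cstar_algebra set"
  where "fixed_point_center \<alpha> = fixed_point_algebra \<alpha> \<inter> commutant (fixed_point_algebra \<alpha>)"

definition minimal_system :: "('g \<Rightarrow> 'f \<Rightarrow> 'f::cstar_algebra) \<Rightarrow> bool"
  where "minimal_system \<alpha> \<longleftrightarrow> commutant (fixed_point_algebra \<alpha>) = fixed_point_center \<alpha>"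

end

theory Submission
  imports Defs
begin

text \<open>
  An element \<open>z\<close> of the center of \<open>\<A>\<close> that is fixed by \<open>\<rho>\<^sub>H\<close> commutes with \<open>H\<close>: multiply \<open>\<Sum>\<^sub>j \<Phi>\<^sub>j z \<Phi>\<^sub>j\<^sup>* = z\<close>
  by \<open>\<Phi>\<^sub>k\<close> from the right. For \<open>F\<close> in the big algebra, the Fourier components
  \<open>\<integral> cnj (\<pi>\<^sub>j\<^sub>k g) \<alpha>\<^sub>g(F) dg\<close> lie in \<open>\<A> \<Phi>\<^sub>j\<close>, so they commute with \<open>z\<close>, and therefore all Fourier components of the
  commutator \<open>X = z F - F z\<close> vanish. By the Peter--Weyl theorem \<open>\<integral> (u \<star> u)(g) \<alpha>\<^sub>g(X) dg = 0\<close> for all continuous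
  \<open>u\<close>, and an approximate identity gives \<open>X = 0\<close>. The reverse inclusion is minimality.

  Peter--Weyl rests on the following: a nonzero continuous function whose Fourier coefficients all
  vanish generates, by the power method in the convolution algebra, a nonzero self-adjoint idempotent \<open>p\<close> with
  the same property; the functions \<open>h = h \<star> p\<close> form a finite-dimensional left-invariant space, and the
  matrix coefficients of an irreducible part of it span that part, a contradiction.
\<close>

section \<open>Integration over a compact group\<close>

text \<open>Neither the group nor the algebra need be second countable, and this shapes the tools.
  All integrands are continuous on a compact group, hence uniform limits of simple functions, and
  the integral is built from such limits; iterated integrals are compared directly, with no product
  measure. Mean-square limits are never taken as elements of a completed space: convolution with a
  continuous function turns a mean-square Cauchy sequence into a uniformly convergent one. For this
  reason powers of a kernel take the place of the spectral theorem for compact operators, and the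
  approximate identity has the form \<open>u \<star> u\<close>, since only convolutions are shown to
  be uniform limits of matrix coefficients. Automorphisms are assumed to be algebraic only, so the
  bound on \<open>\<alpha> g\<close> that the last step needs has to be derived from the
  C*-identity.\<close>

locale compact_haar =
  fixes \<mu> :: "'g::{topological_group_add, t2_space} measure"
  assumes compact_UNIV: "compact (UNIV :: 'g set)"
    and haar: "haar_measure \<mu>"
begin

sublocale prob_space \<mu>
  using haar by (simp add: haar_measure_def)

lemma sets_haar: "sets \<mu> = sets borel"
  using haar by (simp add: haar_measure_def)

lemma space_haar [simp]: "space \<mu> = UNIV"
  using sets_eq_imp_space_eq[OF sets_haar] by simp

lemma haar_translate: "distr \<mu> borel (\<lambda>h. g + h) = \<mu>"
  using haar by (simp add: haar_measure_def)

section \<open>Simple functions and their integrals\<close>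

abbreviation simple_integral :: "('g \<Rightarrow> 'b::real_vector) \<Rightarrow> 'b"
  where "simple_integral \<equiv> Bochner_Integration.simple_bochner_integral \<mu>"

lemma simple_integrable: "simple_function \<mu> s \<Longrightarrow> Bochner_Integration.simple_bochner_integrable \<mu> s"
  by (simp add: simple_bochner_integrable.intros)

text \<open>\<open>Q x y\<close> reads: x is an admissible sample point for y. Finitely many of the
  open neighbourhoods cover the compact group, and sending each y to the centre of one that contains
  it is a finitely valued measurable choice. It is used twice, the second time with closeness
  uniform in a further variable.\<close>

lemma simple_selection:
  assumes "\<And>x::'g. \<exists>U. open U \<and> x \<in> U \<and> (\<forall>y\<in>U. Q x y)"
  shows "\<exists>r. simple_function \<mu> r \<and> (\<forall>y. Q (r y) y)"
proof -
  obtain U where U: "\<And>x. open (U x)" "\<And>x. x \<in> U x" "\<And>x y. y \<in> U x \<Longrightarrow> Q x y"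
    using assms by metis
  obtain C where C: "finite C" "UNIV \<subseteq> (\<Union>c\<in>C. U c)"
    by (rule compactE_image[OF compact_UNIV, of UNIV U]) (use U in auto)
  have "\<exists>r. simple_function \<mu> r \<and> (\<forall>y\<in>(\<Union>c\<in>C. U c). Q (r y) y)"
    using C(1)
  proof (induction C)
    case empty
    show ?case by (auto intro: exI[of _ "\<lambda>_. undefined"])
  next
    case (insert c C)
    then obtain r where r: "simple_function \<mu> r" "\<And>y. y \<in> (\<Union>c\<in>C. U c) \<Longrightarrow> Q (r y) y"
      by blast
    have "simple_function \<mu> (\<lambda>y. if y \<in> U c then c else r y)"
      by (rule simple_function_If_set) (use r U in \<open>auto simp: sets_haar\<close>)
    moreover have "Q (if y \<in> U c then c else r y) y" if "y \<in> (\<Union>c\<in>insert c C. U c)" for y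
      using that U(3)[of y c] r(2)[of y] by auto
    ultimately show ?case by blast
  qed
  then show ?thesis using C(2) by auto
qed

lemma simple_integral_const [simp]: "simple_integral (\<lambda>_. c) = c"
  using prob_space by (simp add: simple_bochner_integral_def image_constant_conv)

lemma simple_integral_norm:
  assumes s: "simple_function \<mu> s" and C: "\<And>y. norm (s y) \<le> C"
  shows "norm (simple_integral s) \<le> C"
proof -
  \<comment> \<open>The level sets of \<open>s\<close> have total mass 1: this is the integral of 1,
    computed along the partition that \<open>s\<close> induces.\<close>
  have one: "(1::real) = (\<Sum>y\<in>s ` space \<mu>. measure \<mu> {x \<in> space \<mu>. s x = y} *\<^sub>R 1)"
    using simple_bochner_integral_partition[OF simple_integrable[of "\<lambda>_. 1::real"] s, of "\<lambda>_. 1"]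
    by (simp del: space_haar)
  have "norm (simple_integral s) \<le> (\<Sum>y\<in>s ` space \<mu>. measure \<mu> {x \<in> space \<mu>. s x = y} * C)"
    unfolding simple_bochner_integral_def
    by (rule sum_norm_le) (use C in \<open>auto intro!: mult_left_mono\<close>)
  also have "\<dots> = C" using one by (simp add: sum_distrib_right[symmetric])
  finally show ?thesis .
qed

text \<open>Uniform approximation pins the value down because the total mass is 1: simple functions
  within d and e of \<open>f\<close> have integrals within d + e of each other
  (\<open>simple_integral_close\<close>). Only finitely valued functions are involved, so no
  separability of the codomain enters.\<close>

definition is_integral :: "('g \<Rightarrow> 'b::real_normed_vector) \<Rightarrow> 'b \<Rightarrow> bool"
  where "is_integral f x \<longleftrightarrow> (\<forall>e>0. \<exists>s. simple_function \<mu> s \<and> (\<forall>y. norm (f y - s y) \<le> e)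
    \<and> norm (x - simple_integral s) \<le> e)"

definition haar_integral :: "('g \<Rightarrow> 'b::real_normed_vector) \<Rightarrow> 'b"
  where "haar_integral f = (THE x. is_integral f x)"

lemma simple_integral_close:
  assumes "simple_function \<mu> s" "simple_function \<mu> t"
    and "\<And>y. norm (f y - s y) \<le> d" "\<And>y. norm (f y - t y) \<le> e"
  shows "norm (simple_integral s - simple_integral t) \<le> d + e"
proof -
  have st: "simple_function \<mu> (\<lambda>y. s y - t y)"
    using simple_function_compose2[OF assms(1,2), of "(-)"] by (simp add: comp_def)
  have "norm (s y - t y) \<le> d + e" for y
    using norm_triangle_ineq4[of "f y - t y" "f y - s y"] assms(3)[of y] assms(4)[of y] by simp
  from simple_integral_norm[OF st this] show ?thesis
    by (simp add: simple_bochner_integral_diff simple_integrable assms)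
qed

lemma is_integral_unique:
  assumes "is_integral f x" "is_integral f y"
  shows "x = y"
proof (rule ccontr)
  assume "x \<noteq> y"
  \<comment> \<open>The detour through both simple integrals costs e + 2 e + e = 4 e, so a fifth of
    the distance gives a contradiction.\<close>
  define e where "e = norm (x - y) / 5"
  have e: "e > 0" using \<open>x \<noteq> y\<close> by (simp add: e_def)
  obtain s where s: "simple_function \<mu> s" "\<And>y. norm (f y - s y) \<le> e"
      "norm (x - simple_integral s) \<le> e"
    using assms(1) e unfolding is_integral_def by blast
  obtain t where t: "simple_function \<mu> t" "\<And>y. norm (f y - t y) \<le> e"
      "norm (y - simple_integral t) \<le> e"
    using assms(2) e unfolding is_integral_def by blast
  let ?S = "simple_integral s" and ?T = "simple_integral t"
  have "norm (?S - ?T) \<le> e + e"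
    by (rule simple_integral_close) (use s t in auto)
  moreover have "norm (x - y) \<le> norm (x - ?S) + norm (?S - ?T) + norm (y - ?T)"
    by norm
  moreover have "norm (x - y) = 5 * e" by (simp add: e_def)
  ultimately have "5 * e \<le> 4 * e"
    using s(3) t(3) by linarith
  then show False using e by linarith
qed

lemma haar_integral_eqI: "is_integral f x \<Longrightarrow> haar_integral f = x"
  unfolding haar_integral_def using is_integral_unique by blast

lemma simple_approx:
  fixes f :: "'g \<Rightarrow> 'b::real_normed_vector"
  assumes "continuous_on UNIV f" "e > 0"
  shows "\<exists>s. simple_function \<mu> s \<and> (\<forall>y. norm (f y - s y) \<le> e)"
proof -
  have "\<exists>r. simple_function \<mu> r \<and> (\<forall>y. norm (f y - f (r y)) \<le> e)"
  proof (rule simple_selection)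
    fix x
    have "open (f -` ball (f x) e)" using assms by (simp add: open_vimage)
    then show "\<exists>U. open U \<and> x \<in> U \<and> (\<forall>y\<in>U. norm (f y - f x) \<le> e)"
      by (intro exI[of _ "f -` ball (f x) e"])
        (use assms in \<open>auto simp: dist_norm norm_minus_commute less_imp_le\<close>)
  qed
  then obtain r where "simple_function \<mu> r" "\<forall>y. norm (f y - f (r y)) \<le> e" by blast
  then show ?thesis
    using simple_function_compose[of \<mu> r f] by (auto simp: comp_def)
qed

lemma is_integral_exists:
  fixes f :: "'g \<Rightarrow> 'b::banach"
  assumes f: "continuous_on UNIV f"
  shows "\<exists>x. is_integral f x"
proof -
  have "\<exists>s. \<forall>n. simple_function \<mu> (s n) \<and> (\<forall>y. norm (f y - s n y) \<le> inverse (real (Suc n)))"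
    by (rule choice) (use simple_approx[OF f] in simp)
  then obtain s where s: "\<And>n. simple_function \<mu> (s n)"
      "\<And>n y. norm (f y - s n y) \<le> inverse (real (Suc n))"
    by blast
  let ?S = "\<lambda>n. simple_integral (s n)"
  have bound: "norm (?S m - ?S n) \<le> inverse (real (Suc m)) + inverse (real (Suc n))" for m n
    by (rule simple_integral_close) (use s in auto)
  have "Cauchy ?S"
  proof (rule CauchyI)
    fix e :: real assume "0 < e"
    then obtain N where N: "inverse (real (Suc N)) < e / 2"
      using reals_Archimedean[of "e/2"] by auto
    have "norm (?S m - ?S n) < e" if "m \<ge> N" "n \<ge> N" for m n
    proof -
      have "inverse (real (Suc m)) \<le> inverse (real (Suc N))"
        "inverse (real (Suc n)) \<le> inverse (real (Suc N))"
        using that by (auto intro!: le_imp_inverse_le)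
      then show ?thesis using bound[of m n] N by linarith
    qed
    then show "\<exists>M. \<forall>m\<ge>M. \<forall>n\<ge>M. norm (?S m - ?S n) < e" by blast
  qed
  then obtain x where x: "?S \<longlonglongrightarrow> x" using Cauchy_convergent_iff convergent_def by blast
  have "is_integral f x"
    unfolding is_integral_def
  proof (intro allI impI)
    fix e :: real assume "0 < e"
    then obtain N where N: "\<And>n. n \<ge> N \<Longrightarrow> norm (?S n - x) < e"
      using x unfolding LIMSEQ_iff by blast
    obtain M where M: "inverse (real (Suc M)) < e"
      using reals_Archimedean[OF \<open>0 < e\<close>] by auto
    let ?n = "max M N"
    have "inverse (real (Suc ?n)) \<le> inverse (real (Suc M))"
      by (auto intro!: le_imp_inverse_le)
    then have "norm (f y - s ?n y) \<le> e" for y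
      using s(2)[of y ?n] M by linarith
    moreover have "norm (x - ?S ?n) \<le> e"
      using N[of ?n] by (simp add: norm_minus_commute less_imp_le)
    ultimately show "\<exists>s. simple_function \<mu> s \<and> (\<forall>y. norm (f y - s y) \<le> e)
        \<and> norm (x - simple_integral s) \<le> e"
      using s(1) by blast
  qed
  then show ?thesis ..
qed

lemma haar_integral_is_integral:
  fixes f :: "'g \<Rightarrow> 'b::banach"
  shows "continuous_on UNIV f \<Longrightarrow> is_integral f (haar_integral f)"
  using is_integral_exists haar_integral_eqI by metis

text \<open>This turns one uniform approximant into an error bound, so that additivity, linearity
  and invariance need only be checked on simple functions.\<close>

lemma haar_integral_approx:
  fixes f :: "'g \<Rightarrow> 'b::banach"
  assumes "continuous_on UNIV f" "simple_function \<mu> s" "\<And>y. norm (f y - s y) \<le> d"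
  shows "norm (haar_integral f - simple_integral s) \<le> d"
proof (rule field_le_epsilon)
  fix e :: real assume "0 < e"
  then obtain t where t: "simple_function \<mu> t" "\<And>y. norm (f y - t y) \<le> e/2"
      "norm (haar_integral f - simple_integral t) \<le> e/2"
    using haar_integral_is_integral[OF assms(1)] unfolding is_integral_def by (meson half_gt_zero)
  have "norm (simple_integral t - simple_integral s) \<le> e/2 + d"
    by (rule simple_integral_close) (use t assms in auto)
  then show "norm (haar_integral f - simple_integral s) \<le> d + e"
    using t(3) norm_triangle_ineq[of "haar_integral f - simple_integral t"
        "simple_integral t - simple_integral s"] by simp
qed

section \<open>Linearity, positivity and norm bounds\<close>

lemma haar_integral_add:
  fixes f g :: "'g \<Rightarrow> 'b::banach"
  assumes "continuous_on UNIV f" "continuous_on UNIV g"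
  shows "haar_integral (\<lambda>x. f x + g x) = haar_integral f + haar_integral g"
proof (rule haar_integral_eqI, unfold is_integral_def, intro allI impI)
  fix e :: real assume "0 < e"
  then have e: "e/2 > 0" by simp
  obtain s where s: "simple_function \<mu> s" "\<And>y. norm (f y - s y) \<le> e/2"
    using simple_approx[OF assms(1) e] by blast
  obtain t where t: "simple_function \<mu> t" "\<And>y. norm (g y - t y) \<le> e/2"
    using simple_approx[OF assms(2) e] by blast
  have st: "simple_function \<mu> (\<lambda>y. s y + t y)"
    using simple_function_compose2[OF s(1) t(1), of "(+)"] by (simp add: comp_def)
  moreover have "norm (f y + g y - (s y + t y)) \<le> e" for y
    using norm_triangle_ineq[of "f y - s y" "g y - t y"] s(2)[of y] t(2)[of y]
    by (simp add: algebra_simps)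
  moreover have "norm (haar_integral f + haar_integral g - simple_integral (\<lambda>y. s y + t y)) \<le> e"
    using norm_triangle_ineq[of "haar_integral f - simple_integral s" "haar_integral g - simple_integral t"]
      haar_integral_approx[OF assms(1) s] haar_integral_approx[OF assms(2) t]
    by (simp add: simple_bochner_integral_add simple_integrable s t algebra_simps)
  ultimately show "\<exists>s. simple_function \<mu> s \<and> (\<forall>y. norm (f y + g y - s y) \<le> e)
      \<and> norm (haar_integral f + haar_integral g - simple_integral s) \<le> e"
    by blast
qed

lemma haar_integral_linear:
  fixes f :: "'g \<Rightarrow> 'b::banach" and T :: "'b \<Rightarrow> 'c::banach"
  assumes T: "bounded_linear T" and f: "continuous_on UNIV f"
  shows "haar_integral (\<lambda>x. T (f x)) = T (haar_integral f)"
proof (rule haar_integral_eqI, unfold is_integral_def, intro allI impI)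
  fix e :: real assume "0 < e"
  interpret T: bounded_linear T by fact
  obtain K where K: "K > 0" "\<And>x. norm (T x) \<le> norm x * K"
    using T.pos_bounded by blast
  obtain s where s: "simple_function \<mu> s" "\<And>y. norm (f y - s y) \<le> e/K"
    using simple_approx[OF f, of "e/K"] \<open>0 < e\<close> K by auto
  have TK: "norm (T x) \<le> e" if "norm x \<le> e/K" for x
    using K(2)[of x] that K(1) by (simp add: pos_le_divide_eq)
  have "simple_function \<mu> (\<lambda>y. T (s y))"
    using simple_function_compose[OF s(1), of T] by (simp add: comp_def)
  moreover have "norm (T (f y) - T (s y)) \<le> e" for y
    using TK[OF s(2)[of y]] by (simp add: T.diff)
  moreover have "norm (T (haar_integral f) - simple_integral (\<lambda>y. T (s y))) \<le> e"
    using TK[OF haar_integral_approx[OF f s]]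
    by (simp add: simple_bochner_integral_linear T.linear simple_integrable s T.diff)
  ultimately show "\<exists>s. simple_function \<mu> s \<and> (\<forall>y. norm (T (f y) - s y) \<le> e)
      \<and> norm (T (haar_integral f) - simple_integral s) \<le> e"
    by blast
qed

lemma haar_integral_const [simp]: "haar_integral (\<lambda>_. c) = c"
  by (rule haar_integral_eqI, unfold is_integral_def) (auto intro!: exI[of _ "\<lambda>_. c"])

lemma haar_integral_minus:
  fixes f :: "'g \<Rightarrow> 'b::banach"
  shows "continuous_on UNIV f \<Longrightarrow> haar_integral (\<lambda>x. - f x) = - haar_integral f"
  by (rule haar_integral_linear) (simp_all add: bounded_linear_minus bounded_linear_ident)

lemma haar_integral_diff:
  fixes f g :: "'g \<Rightarrow> 'b::banach"
  assumes "continuous_on UNIV f" "continuous_on UNIV g"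
  shows "haar_integral (\<lambda>x. f x - g x) = haar_integral f - haar_integral g"
  using haar_integral_add[OF assms(1), of "\<lambda>x. - g x"] assms by (simp add: haar_integral_minus continuous_on_minus)

lemma haar_integral_sum:
  fixes f :: "'i \<Rightarrow> 'g \<Rightarrow> 'b::banach"
  assumes "\<And>i. i \<in> I \<Longrightarrow> continuous_on UNIV (f i)"
  shows "haar_integral (\<lambda>x. \<Sum>i\<in>I. f i x) = (\<Sum>i\<in>I. haar_integral (f i))"
  using assms
  by (induction I rule: infinite_finite_induct) (simp_all add: haar_integral_add continuous_on_sum)

lemma haar_integral_norm_bound:
  fixes f :: "'g \<Rightarrow> 'b::banach"
  assumes "continuous_on UNIV f" "\<And>y. norm (f y) \<le> C"
  shows "norm (haar_integral f) \<le> C"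
  using haar_integral_approx[OF assms(1), of "\<lambda>_. 0" C] assms(2) by simp

lemma haar_integral_nonneg:
  fixes f :: "'g \<Rightarrow> real"
  assumes f: "continuous_on UNIV f" and nn: "\<And>y. 0 \<le> f y"
  shows "0 \<le> haar_integral f"
proof -
  have "bounded (range f)"
    using compact_continuous_image[OF f compact_UNIV] by (rule compact_imp_bounded)
  then obtain C where C: "\<And>y. norm (f y) \<le> C" unfolding bounded_iff by blast
  \<comment> \<open>From 0 \<le> f \<le> C follows |C - f| \<le> C, so the norm bound already says
    that C minus the integral is at most C.\<close>
  have "norm (haar_integral (\<lambda>y. C - f y)) \<le> C"
    by (rule haar_integral_norm_bound) (use f nn C in \<open>auto intro!: continuous_intros simp: abs_le_iff algebra_simps add_increasing2\<close>)
  moreover have "haar_integral (\<lambda>y. C - f y) = C - haar_integral f"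
    using haar_integral_diff[of "\<lambda>_. C" f] f by simp
  ultimately show ?thesis by simp
qed

lemma haar_integral_mono:
  fixes f g :: "'g \<Rightarrow> real"
  assumes "continuous_on UNIV f" "continuous_on UNIV g" "\<And>y. f y \<le> g y"
  shows "haar_integral f \<le> haar_integral g"
  using haar_integral_nonneg[of "\<lambda>y. g y - f y"] assms by (simp add: haar_integral_diff continuous_on_diff)

lemma haar_integral_norm_le:
  fixes f :: "'g \<Rightarrow> 'b::banach"
  assumes f: "continuous_on UNIV f"
  shows "norm (haar_integral f) \<le> haar_integral (\<lambda>x. norm (f x))"
proof (rule field_le_epsilon)
  fix e :: real assume "0 < e"
  then obtain s where s: "simple_function \<mu> s" "\<And>y. norm (f y - s y) \<le> e/2"
    using simple_approx[OF f, of "e/2"] by auto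
  have ns: "simple_function \<mu> (\<lambda>y. norm (s y))"
    using simple_function_compose[OF s(1), of norm] by (simp add: comp_def)
  have "norm (norm (f y) - norm (s y)) \<le> e/2" for y
    using norm_triangle_ineq3[of "f y" "s y"] s(2)[of y] by simp
  from haar_integral_approx[OF _ ns this] f
  have "norm (haar_integral (\<lambda>y. norm (f y)) - simple_integral (\<lambda>y. norm (s y))) \<le> e/2"
    by (simp add: continuous_on_norm)
  moreover have "norm (haar_integral f - simple_integral s) \<le> e/2"
    by (rule haar_integral_approx[OF f s])
  moreover have "norm (simple_integral s) \<le> simple_integral (\<lambda>y. norm (s y))"
    by (rule simple_bochner_integral_norm_bound) (simp add: simple_integrable s)
  moreover have "norm (haar_integral f) \<le> norm (haar_integral f - simple_integral s) + norm (simple_integral s)"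
    by norm
  ultimately show "norm (haar_integral f) \<le> haar_integral (\<lambda>x. norm (f x)) + e"
    unfolding real_norm_def by linarith
qed

section \<open>Translation invariance\<close>

lemma measure_translate:
  assumes "A \<in> sets \<mu>"
  shows "measure \<mu> {x. a + x \<in> A} = measure \<mu> A"
proof -
  have "(\<lambda>x. a + x) \<in> measurable \<mu> borel"
    by (simp add: measurable_cong_sets[OF sets_haar refl] borel_measurable_continuous_onI continuous_intros)
  from measure_distr[OF this, of A] assms show ?thesis
    by (simp add: haar_translate sets_haar vimage_def)
qed

lemma measurable_translate: "(\<lambda>x. a + x) \<in> measurable \<mu> \<mu>"
proof -
  have "(\<lambda>x. a + x) \<in> measurable borel borel"
    by (intro borel_measurable_continuous_onI continuous_intros)
  then show ?thesis by (simp add: measurable_cong_sets[OF sets_haar sets_haar])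
qed

lemma simple_translate:
  assumes s: "simple_function \<mu> s"
  shows "simple_function \<mu> (\<lambda>x. s (a + x))"
    and "simple_integral (\<lambda>x. s (a + x)) = simple_integral s"
proof -
  have ran: "range (\<lambda>x. s (a + x)) = range s"
  proof (rule equalityI)
    show "range s \<subseteq> range (\<lambda>x. s (a + x))"
    proof
      fix y assume "y \<in> range s"
      then obtain x where "y = s x" by blast
      then have "y = s (a + (- a + x))" by simp
      then show "y \<in> range (\<lambda>x. s (a + x))" by blast
    qed
  qed blast
  have ms: "{x. s x = y} \<in> sets \<mu>" for y
  proof (cases "y \<in> range s")
    case True
    have "s -` {y} \<inter> space \<mu> \<in> sets \<mu>"
      using s True by (auto simp: simple_function_def)
    then show ?thesis by (simp add: vimage_def)
  next
    case False
    then have "{x. s x = y} = {}" by auto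
    then show ?thesis by simp
  qed
  have "(\<lambda>x. a + x) -` {x. s x = y} \<inter> space \<mu> \<in> sets \<mu>" for y
    by (rule measurable_sets[OF measurable_translate ms])
  then show "simple_function \<mu> (\<lambda>x. s (a + x))"
    using s unfolding simple_function_def by (simp add: ran vimage_def)
  show "simple_integral (\<lambda>x. s (a + x)) = simple_integral s"
    unfolding simple_bochner_integral_def
    using measure_translate[OF ms, of a] ran by simp
qed

lemma continuous_translate:
  assumes "continuous_on UNIV f"
  shows "continuous_on UNIV (\<lambda>x::'g. f (a + x))" "continuous_on UNIV (\<lambda>x::'g. f (x + a))"
    "continuous_on UNIV (\<lambda>x::'g. f (- x))"
  by (rule continuous_on_compose2[OF assms]; auto intro!: continuous_intros)+

lemma haar_integral_left:
  fixes f :: "'g \<Rightarrow> 'b::banach"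
  assumes f: "continuous_on UNIV f"
  shows "haar_integral (\<lambda>x. f (a + x)) = haar_integral f"
proof (rule haar_integral_eqI, unfold is_integral_def, intro allI impI)
  fix e :: real assume "0 < e"
  then obtain s where s: "simple_function \<mu> s" "\<And>y. norm (f y - s y) \<le> e"
    using simple_approx[OF f] by blast
  then show "\<exists>s. simple_function \<mu> s \<and> (\<forall>y. norm (f (a + y) - s y) \<le> e)
      \<and> norm (haar_integral f - simple_integral s) \<le> e"
    using simple_translate[OF s(1), of a] haar_integral_approx[OF f s] by (intro exI[of _ "\<lambda>x. s (a + x)"]) auto
qed

section \<open>Parameter integrals and the order of integration\<close>

lemma two_variable_nbhd:
  fixes f :: "'g \<Rightarrow> 'g \<Rightarrow> 'b::banach"
  assumes f: "continuous_on UNIV (\<lambda>(x, y). f x y)" and "e > 0"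
  shows "\<exists>U. open U \<and> x \<in> U \<and> (\<forall>x'\<in>U. \<forall>y. norm (f x' y - f x y) \<le> e)"
proof -
  have "continuous_on (UNIV \<times> UNIV) (\<lambda>(x, y). f x y)" using f by simp
  then obtain U where "x \<in> U" "open U"
      "\<forall>x'\<in>U \<inter> UNIV. \<forall>y\<in>UNIV. dist (case (x', y) of (x, y) \<Rightarrow> f x y) (case (x, y) of (x, y) \<Rightarrow> f x y) \<le> e"
    by (rule continuous_on_prod_compactE[OF _ compact_UNIV UNIV_I \<open>e > 0\<close>])
  then show ?thesis by (intro exI[of _ U]) (simp add: dist_norm)
qed

lemma continuous_sections:
  assumes "continuous_on UNIV (\<lambda>(x, y). f x y)"
  shows "continuous_on UNIV (\<lambda>y. f x y)" "continuous_on UNIV (\<lambda>x. f x y)"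
  using continuous_on_compose2[OF assms, of UNIV "\<lambda>y. (x, y)"]
    continuous_on_compose2[OF assms, of UNIV "\<lambda>x. (x, y)"]
  by (simp_all add: continuous_on_Pair continuous_on_const continuous_on_id)

lemma continuous_haar_integral:
  fixes f :: "'g \<Rightarrow> 'g \<Rightarrow> 'b::banach"
  assumes f: "continuous_on UNIV (\<lambda>(x, y). f x y)"
  shows "continuous_on UNIV (\<lambda>x. haar_integral (f x))"
proof -
  have "\<forall>\<^sub>F x' in at x. dist (haar_integral (f x')) (haar_integral (f x)) < e" if "e > 0" for x e
  proof -
    obtain U where U: "open U" "x \<in> U" "\<And>x' y. x' \<in> U \<Longrightarrow> norm (f x' y - f x y) \<le> e/2"
      using two_variable_nbhd[OF f, of "e/2" x] \<open>e > 0\<close> half_gt_zero by metis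
    have "dist (haar_integral (f x')) (haar_integral (f x)) < e" if "x' \<in> U" for x'
    proof -
      have "norm (haar_integral (\<lambda>y. f x' y - f x y)) \<le> e/2"
        by (rule haar_integral_norm_bound) (use U that continuous_sections[OF f] in \<open>auto intro!: continuous_on_diff\<close>)
      then show ?thesis
        using \<open>e > 0\<close> continuous_sections(1)[OF f] by (simp add: haar_integral_diff dist_norm)
    qed
    then show ?thesis
      unfolding eventually_at_topological using U by blast
  qed
  then show ?thesis
    unfolding continuous_on_def by (auto intro!: tendstoI)
qed

text \<open>Replacing x by a simple sample point \<open>r x\<close> changes \<open>f x y\<close> by
  at most e/2, uniformly in y. Both iterated integrals are then within e/2 of the same finite
  sum.\<close>

lemma haar_integral_fubini:
  fixes f :: "'g \<Rightarrow> 'g \<Rightarrow> 'b::banach"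
  assumes f: "continuous_on UNIV (\<lambda>(x, y). f x y)"
  shows "haar_integral (\<lambda>x. haar_integral (\<lambda>y. f x y)) = haar_integral (\<lambda>y. haar_integral (\<lambda>x. f x y))"
proof -
  have f': "continuous_on UNIV (\<lambda>(y, x). f x y)"
    using continuous_on_compose2[OF f, of UNIV "\<lambda>p. (snd p, fst p)"]
    by (simp add: case_prod_unfold continuous_on_Pair continuous_on_fst continuous_on_snd continuous_on_id)
  let ?L = "haar_integral (\<lambda>x. haar_integral (\<lambda>y. f x y))" and ?R = "haar_integral (\<lambda>y. haar_integral (\<lambda>x. f x y))"
  have "norm (?L - ?R) \<le> 0"
  proof (rule field_le_epsilon)
    fix e :: real assume "0 < e"
    then have e2: "e/2 > 0" by simp
    have "\<exists>r. simple_function \<mu> r \<and> (\<forall>x. \<forall>y. norm (f x y - f (r x) y) \<le> e/2)"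
      by (rule simple_selection, rule two_variable_nbhd[OF f e2])
    then obtain r where r: "simple_function \<mu> r" "\<And>x y. norm (f x y - f (r x) y) \<le> e/2"
      by blast
    let ?m = "\<lambda>c. measure \<mu> {x \<in> space \<mu>. r x = c}"
    have part: "simple_integral (\<lambda>x. v (r x)) = (\<Sum>c\<in>r ` space \<mu>. ?m c *\<^sub>R v c)" for v :: "'g \<Rightarrow> 'b"
      by (rule simple_bochner_integral_partition)
        (use simple_function_compose[OF r(1), of v] r in \<open>auto simp: comp_def intro!: simple_integrable\<close>)
    have sr: "simple_function \<mu> (\<lambda>x. v (r x))" for v :: "'g \<Rightarrow> 'b"
      using simple_function_compose[OF r(1), of v] by (simp add: comp_def)
    have "norm (haar_integral (\<lambda>y. f x y) - haar_integral (\<lambda>y. f (r x) y)) \<le> e/2" for x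
      using haar_integral_norm_bound[of "\<lambda>y. f x y - f (r x) y" "e/2"] r(2) continuous_sections(1)[OF f]
      by (simp add: haar_integral_diff continuous_on_diff)
    from haar_integral_approx[OF continuous_haar_integral[OF f] sr this]
    have 1: "norm (?L - (\<Sum>c\<in>r ` space \<mu>. ?m c *\<^sub>R haar_integral (\<lambda>y. f c y))) \<le> e/2"
      by (simp only: part[of "\<lambda>c. haar_integral (f c)"])
    have 2: "norm (haar_integral (\<lambda>x. f x y) - (\<Sum>c\<in>r ` space \<mu>. ?m c *\<^sub>R f c y)) \<le> e/2" for y
      using haar_integral_approx[OF continuous_sections(2)[OF f] sr, of y "\<lambda>c. f c y" "e/2"] r(2)
      by (simp only: part[of "\<lambda>c. f c y"])
    have cs: "continuous_on UNIV (\<lambda>y. \<Sum>c\<in>r ` space \<mu>. ?m c *\<^sub>R f c y)"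
      by (intro continuous_intros continuous_sections(1)[OF f])
    have "haar_integral (\<lambda>y. \<Sum>c\<in>r ` space \<mu>. ?m c *\<^sub>R f c y) = (\<Sum>c\<in>r ` space \<mu>. haar_integral (\<lambda>y. ?m c *\<^sub>R f c y))"
      by (rule haar_integral_sum) (intro continuous_intros continuous_sections(1)[OF f])
    also have "\<dots> = (\<Sum>c\<in>r ` space \<mu>. ?m c *\<^sub>R haar_integral (\<lambda>y. f c y))"
      by (intro sum.cong refl haar_integral_linear bounded_linear_scaleR_right continuous_sections(1)[OF f])
    finally have 3: "norm (?R - (\<Sum>c\<in>r ` space \<mu>. ?m c *\<^sub>R haar_integral (\<lambda>y. f c y))) \<le> e/2"
      using haar_integral_norm_bound[of "\<lambda>y. haar_integral (\<lambda>x. f x y) - (\<Sum>c\<in>r ` space \<mu>. ?m c *\<^sub>R f c y)" "e/2"] 2 cs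
        continuous_haar_integral[OF f'] by (simp add: haar_integral_diff continuous_on_diff)
    show "norm (?L - ?R) \<le> 0 + e"
      using norm_triangle_ineq4[of "?L - (\<Sum>c\<in>r ` space \<mu>. ?m c *\<^sub>R haar_integral (\<lambda>y. f c y))"
          "?R - (\<Sum>c\<in>r ` space \<mu>. ?m c *\<^sub>R haar_integral (\<lambda>y. f c y))"] 1 3 by simp
  qed
  then show ?thesis by simp
qed

text \<open>A compact group is unimodular: the left translates of the left Haar integral, averaged with
  respect to its reflection, give the reflection.\<close>

lemma haar_integral_uminus:
  fixes f :: "'g \<Rightarrow> 'b::banach"
  assumes f: "continuous_on UNIV f"
  shows "haar_integral (\<lambda>x. f (- x)) = haar_integral f"
proof -
  have c: "continuous_on UNIV (\<lambda>(x, y). f (- x + y))"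
    unfolding case_prod_unfold by (rule continuous_on_compose2[OF f]) (auto intro!: continuous_intros)
  have "haar_integral f = haar_integral (\<lambda>x. haar_integral (\<lambda>y. f (- x + y)))"
    by (simp add: haar_integral_left f)
  also have "\<dots> = haar_integral (\<lambda>y. haar_integral (\<lambda>x. f (- (- y + x))))"
    using haar_integral_fubini[OF c] by (simp add: minus_add)
  also have "\<dots> = haar_integral (\<lambda>y. haar_integral (\<lambda>x. f (- x)))"
    using haar_integral_left[OF continuous_translate(3)[OF f]] by simp
  finally show ?thesis by simp
qed

lemma haar_integral_right:
  fixes f :: "'g \<Rightarrow> 'b::banach"
  assumes f: "continuous_on UNIV f"
  shows "haar_integral (\<lambda>x. f (x + a)) = haar_integral f"
proof -
  have "haar_integral (\<lambda>x. f (x + a)) = haar_integral (\<lambda>x. f (- x + a))"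
    using haar_integral_uminus[OF continuous_translate(2)[OF f], of a] by simp
  also have "\<dots> = haar_integral (\<lambda>x. f (- (- a + x)))" by (simp add: minus_add)
  also have "\<dots> = haar_integral f"
    using haar_integral_left[OF continuous_translate(3)[OF f], of "- a"] haar_integral_uminus[OF f] by simp
  finally show ?thesis .
qed

text \<open>By compactness finitely many translates of the open set where \<open>f\<close> exceeds
  \<open>f a / 2\<close> cover the group. The sum of the corresponding translates of
  \<open>f\<close> is at least \<open>f a / 2\<close>, and its integral is the number of translates
  times the integral of \<open>f\<close>.\<close>

lemma haar_integral_pos:
  fixes f :: "'g \<Rightarrow> real"
  assumes f: "continuous_on UNIV f" and nn: "\<And>y. 0 \<le> f y" and "f a > 0"
  shows "haar_integral f > 0"
proof -
  let ?U = "\<lambda>b. {x. f (b + x) > f a / 2}"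
  have "open (?U b)" for b
    by (rule open_Collect_less) (use continuous_translate(1)[OF f] in \<open>auto intro!: continuous_intros\<close>)
  moreover have "UNIV \<subseteq> (\<Union>b\<in>UNIV. ?U b)"
  proof
    fix x
    have "x \<in> ?U (a + - x)" using \<open>f a > 0\<close> by (simp add: add.assoc)
    then show "x \<in> (\<Union>b\<in>UNIV. ?U b)" by blast
  qed
  ultimately obtain C where C: "finite C" "UNIV \<subseteq> (\<Union>b\<in>C. ?U b)"
    by (rule compactE_image[OF compact_UNIV, of UNIV ?U])
  have "f a / 2 \<le> (\<Sum>b\<in>C. f (b + x))" for x
  proof -
    obtain b where b: "b \<in> C" "f (b + x) > f a / 2" using C(2) by blast
    have "f (b + x) \<le> (\<Sum>b\<in>C. f (b + x))" by (rule member_le_sum) (use b C nn in auto)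
    then show ?thesis using b by simp
  qed
  then have "haar_integral (\<lambda>x. f a / 2) \<le> haar_integral (\<lambda>x. \<Sum>b\<in>C. f (b + x))"
    by (intro haar_integral_mono) (use continuous_translate(1)[OF f] in \<open>auto intro!: continuous_intros\<close>)
  also have "\<dots> = real (card C) * haar_integral f"
    by (subst haar_integral_sum) (use continuous_translate(1)[OF f] haar_integral_left[OF f] in auto)
  finally have "0 < real (card C) * haar_integral f" using \<open>f a > 0\<close> by simp
  moreover have "0 \<le> haar_integral f" by (rule haar_integral_nonneg[OF f nn])
  ultimately show ?thesis by (cases "haar_integral f = 0") auto
qed

end

section \<open>The convolution algebra of continuous functions\<close>

context compact_haar
begin

abbreviation cont :: "('g \<Rightarrow> complex) \<Rightarrow> bool"
  where "cont \<equiv> continuous_on UNIV"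

definition conv :: "('g \<Rightarrow> complex) \<Rightarrow> ('g \<Rightarrow> complex) \<Rightarrow> 'g \<Rightarrow> complex" (infixr "\<star>" 70)
  where "(u \<star> v) x = haar_integral (\<lambda>y. u y * v (- y + x))"

text \<open>The involution of the convolution algebra; it carries no modular factor because the
  group is unimodular.\<close>

definition adj :: "('g \<Rightarrow> complex) \<Rightarrow> 'g \<Rightarrow> complex"
  where "adj u x = cnj (u (- x))"

definition ip :: "('g \<Rightarrow> complex) \<Rightarrow> ('g \<Rightarrow> complex) \<Rightarrow> complex"
  where "ip u v = haar_integral (\<lambda>x. u x * cnj (v x))"

definition sqnorm :: "('g \<Rightarrow> complex) \<Rightarrow> real"
  where "sqnorm u = haar_integral (\<lambda>x. (cmod (u x))\<^sup>2)"

lemma haar_integral_cmult: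
  fixes u :: "'g \<Rightarrow> complex"
  shows "cont u \<Longrightarrow> haar_integral (\<lambda>x. c * u x) = c * haar_integral u"
  by (rule haar_integral_linear[OF bounded_linear_mult_right])

lemma haar_integral_multc:
  fixes u :: "'g \<Rightarrow> complex"
  shows "cont u \<Longrightarrow> haar_integral (\<lambda>x. u x * c) = haar_integral u * c"
  by (rule haar_integral_linear[OF bounded_linear_mult_left])

lemma haar_integral_cnj: "cont u \<Longrightarrow> haar_integral (\<lambda>x. cnj (u x)) = cnj (haar_integral u)"
  by (rule haar_integral_linear[OF bounded_linear_cnj])

lemma cont_comp:
  "cont u \<Longrightarrow> continuous_on UNIV f \<Longrightarrow> continuous_on UNIV (\<lambda>x. u (f x))"
  by (rule continuous_on_compose2) auto

lemma cont_conv_kernel: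
  assumes "cont u" "cont v"
  shows "continuous_on UNIV (\<lambda>(x, y). u y * v (- y + x))"
  unfolding case_prod_unfold
  by (intro continuous_intros cont_comp[OF assms(1)] cont_comp[OF assms(2)])

lemma cont_conv [continuous_intros]: "cont u \<Longrightarrow> cont v \<Longrightarrow> cont (u \<star> v)"
  using continuous_haar_integral[OF cont_conv_kernel] by (simp add: conv_def[abs_def])

lemma cont_adj [continuous_intros]: "cont u \<Longrightarrow> cont (adj u)"
  unfolding adj_def[abs_def] by (intro continuous_on_cnj continuous_translate(3))

lemma adj_adj [simp]: "adj (adj u) = u"
  by (rule ext) (simp add: adj_def)

lemma conv_assoc:
  assumes u: "cont u" and v: "cont v" and w: "cont w"
  shows "(u \<star> v) \<star> w = u \<star> (v \<star> w)"
proof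
  fix x
  have c1: "cont (\<lambda>y. u y * v (- y + z))" for z
    by (intro continuous_intros cont_comp[OF u] cont_comp[OF v])
  have c2: "cont (\<lambda>z. v (- y + z) * w (- z + x))" for y
    by (intro continuous_intros cont_comp[OF v] cont_comp[OF w])
  have k: "continuous_on UNIV (\<lambda>(z, y). u y * v (- y + z) * w (- z + x))"
    unfolding case_prod_unfold
    by (intro continuous_intros cont_comp[OF u] cont_comp[OF v] cont_comp[OF w])
  have inner: "haar_integral (\<lambda>z. v (- y + z) * w (- z + x)) = (v \<star> w) (- y + x)" for y
    using haar_integral_left[OF c2[of y], of y] by (simp add: conv_def minus_add add.assoc[symmetric])
  have "((u \<star> v) \<star> w) x = haar_integral (\<lambda>z. haar_integral (\<lambda>y. u y * v (- y + z) * w (- z + x)))"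
    by (simp add: conv_def haar_integral_multc c1)
  also have "\<dots> = haar_integral (\<lambda>y. haar_integral (\<lambda>z. u y * (v (- y + z) * w (- z + x))))"
    using haar_integral_fubini[OF k] by (simp add: mult.assoc)
  also have "\<dots> = haar_integral (\<lambda>y. u y * haar_integral (\<lambda>z. v (- y + z) * w (- z + x)))"
    by (simp add: haar_integral_cmult c2)
  finally show "((u \<star> v) \<star> w) x = (u \<star> (v \<star> w)) x"
    by (simp add: conv_def[of u] inner)
qed

lemma adj_conv:
  assumes u: "cont u" and v: "cont v"
  shows "adj (u \<star> v) = adj v \<star> adj u"
proof
  fix x
  have c: "cont (\<lambda>y. u y * v (- y + - x))"
    by (intro continuous_intros cont_comp[OF u] cont_comp[OF v])
  have c': "cont (\<lambda>y. adj v y * adj u (- y + x))"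
    by (intro continuous_intros cont_comp[OF cont_adj[OF v]] cont_comp[OF cont_adj[OF u]])
  have "adj (u \<star> v) x = haar_integral (\<lambda>y. cnj (u y * v (- y + - x)))"
    by (simp only: adj_def conv_def haar_integral_cnj[OF c])
  also have "\<dots> = haar_integral (\<lambda>y. adj v (x + y) * adj u (- (x + y) + x))"
    by (simp add: adj_def minus_add mult.commute add.assoc)
  also have "\<dots> = (adj v \<star> adj u) x"
    using haar_integral_left[OF c', of x] by (simp add: conv_def)
  finally show "adj (u \<star> v) x = (adj v \<star> adj u) x" .
qed

lemma conv_eq_ip: "(u \<star> v) x = ip u (\<lambda>y. cnj (v (- y + x)))"
  by (simp add: conv_def ip_def)

text \<open>Evaluation at the neutral element turns a product into a scalar product. For powers of a
  self-adjoint kernel this makes norms and scalar products visible as point values, as in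
  \<open>conv_pow_zero_ip\<close>.\<close>

lemma conv_zero: "(u \<star> v) 0 = ip u (adj v)"
  by (simp add: conv_def ip_def adj_def)

section \<open>The mean-square scalar product\<close>

lemma cont_ip: "cont u \<Longrightarrow> cont v \<Longrightarrow> cont (\<lambda>x. u x * cnj (v x))"
  by (intro continuous_intros)

lemma cont_sqnorm: "cont u \<Longrightarrow> continuous_on UNIV (\<lambda>x. (cmod (u x))\<^sup>2)"
  by (intro continuous_intros)

lemma ip_self: "cont u \<Longrightarrow> ip u u = complex_of_real (sqnorm u)"
  unfolding ip_def sqnorm_def
  by (subst haar_integral_linear[OF bounded_linear_of_real, symmetric])
    (auto simp flip: complex_norm_square intro!: continuous_intros)

lemma sqnorm_nonneg: "cont u \<Longrightarrow> 0 \<le> sqnorm u"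
  unfolding sqnorm_def by (rule haar_integral_nonneg) (auto intro!: continuous_intros)

lemma sqnorm_pos:
  assumes "cont u" "u a \<noteq> 0"
  shows "0 < sqnorm u"
  unfolding sqnorm_def by (rule haar_integral_pos[where a = a]) (use assms in \<open>auto intro!: continuous_intros\<close>)

lemma sqnorm_eq_0: "cont u \<Longrightarrow> sqnorm u = 0 \<Longrightarrow> u = (\<lambda>_. 0)"
  using sqnorm_pos by (metis less_irrefl)

lemma sqnorm_bound:
  assumes "cont u" "\<And>x. cmod (u x) \<le> C"
  shows "sqnorm u \<le> C\<^sup>2"
proof -
  have "sqnorm u \<le> haar_integral (\<lambda>x. C\<^sup>2)"
    unfolding sqnorm_def by (rule haar_integral_mono) (use assms in \<open>auto intro!: continuous_intros power_mono\<close>)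
  then show ?thesis by simp
qed

lemma ip_cnj:
  assumes "cont u" "cont v"
  shows "cnj (ip u v) = ip v u"
  unfolding ip_def haar_integral_cnj[OF cont_ip[OF assms], symmetric] by (simp add: mult.commute)

lemma ip_add: "cont u \<Longrightarrow> cont v \<Longrightarrow> cont w \<Longrightarrow> ip (\<lambda>x. u x + v x) w = ip u w + ip v w"
  unfolding ip_def by (subst haar_integral_add[symmetric]) (auto intro!: continuous_intros simp: algebra_simps)

lemma ip_scale: "cont u \<Longrightarrow> cont w \<Longrightarrow> ip (\<lambda>x. c * u x) w = c * ip u w"
  unfolding ip_def by (subst haar_integral_cmult[symmetric]) (auto intro!: continuous_intros simp: algebra_simps)

lemma ip_scale_right:
  assumes "cont u" "cont w"
  shows "ip w (\<lambda>x. c * u x) = cnj c * ip w u"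
  using ip_scale[OF assms, of c] ip_cnj[of "\<lambda>x. c * u x" w] ip_cnj[of u w] assms
  by (metis complex_cnj_mult continuous_on_mult_left)

lemma ip_sum:
  assumes "\<And>i. i \<in> I \<Longrightarrow> cont (u i)" "cont w"
  shows "ip (\<lambda>x. \<Sum>i\<in>I. u i x) w = (\<Sum>i\<in>I. ip (u i) w)"
  unfolding ip_def using assms
  by (subst haar_integral_sum[symmetric]) (auto intro!: continuous_intros simp: sum_distrib_right)

lemma ip_sum_right:
  assumes "\<And>i. i \<in> I \<Longrightarrow> cont (u i)" "cont w"
  shows "ip w (\<lambda>x. \<Sum>i\<in>I. u i x) = (\<Sum>i\<in>I. ip w (u i))"
proof -
  have "ip w (\<lambda>x. \<Sum>i\<in>I. u i x) = cnj (ip (\<lambda>x. \<Sum>i\<in>I. u i x) w)"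
    using assms by (intro ip_cnj[symmetric] continuous_intros) auto
  also have "\<dots> = (\<Sum>i\<in>I. ip w (u i))"
    using assms by (simp add: ip_sum ip_cnj)
  finally show ?thesis .
qed

lemma ip_diff: "cont u \<Longrightarrow> cont v \<Longrightarrow> cont w \<Longrightarrow> ip (\<lambda>x. u x - v x) w = ip u w - ip v w"
  unfolding ip_def by (subst haar_integral_diff[symmetric]) (auto intro!: continuous_intros simp: algebra_simps)

lemma sqnorm_diff:
  assumes "cont u" "cont v"
  shows "sqnorm (\<lambda>x. u x - v x) = sqnorm u + sqnorm v - 2 * Re (ip u v)"
proof -
  have c: "(cmod (u x - v x))\<^sup>2 = (cmod (u x))\<^sup>2 + (cmod (v x))\<^sup>2 - 2 * Re (u x * cnj (v x))" for x
    unfolding cmod_power2 by (simp add: power2_eq_square algebra_simps)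
  have "sqnorm (\<lambda>x. u x - v x)
      = haar_integral (\<lambda>x. (cmod (u x))\<^sup>2 + (cmod (v x))\<^sup>2) - haar_integral (\<lambda>x. 2 * Re (u x * cnj (v x)))"
    unfolding sqnorm_def c using assms by (intro haar_integral_diff) (auto intro!: continuous_intros)
  also have "haar_integral (\<lambda>x. (cmod (u x))\<^sup>2 + (cmod (v x))\<^sup>2) = sqnorm u + sqnorm v"
    unfolding sqnorm_def using assms by (intro haar_integral_add) (auto intro!: continuous_intros)
  also have "haar_integral (\<lambda>x. 2 * Re (u x * cnj (v x))) = 2 * Re (ip u v)"
    unfolding ip_def
    by (rule haar_integral_linear[where T = "\<lambda>z. 2 * Re z"])
      (use assms in \<open>auto intro!: cont_ip bounded_linear_intros bounded_linear_const_mult bounded_linear_Re\<close>)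
  finally show ?thesis .
qed

lemma sqnorm_scale: "cont u \<Longrightarrow> sqnorm (\<lambda>x. c * u x) = (cmod c)\<^sup>2 * sqnorm u"
  unfolding sqnorm_def norm_mult power_mult_distrib
  by (rule haar_integral_linear[OF bounded_linear_mult_right]) (intro continuous_intros)

section \<open>Orthonormal systems\<close>

definition orthonormal :: "nat \<Rightarrow> (nat \<Rightarrow> 'g \<Rightarrow> complex) \<Rightarrow> bool"
  where "orthonormal n e \<longleftrightarrow> (\<forall>i<n. cont (e i)) \<and> (\<forall>i<n. \<forall>j<n. ip (e i) (e j) = (if i = j then 1 else 0))"

lemma ip_comb:
  assumes "orthonormal n e" "j < n"
  shows "ip (\<lambda>x. \<Sum>i<n. c i * e i x) (e j) = c j"
proof -
  have "ip (\<lambda>x. \<Sum>i<n. c i * e i x) (e j) = (\<Sum>i<n. c i * ip (e i) (e j))"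
    using assms by (subst ip_sum) (auto simp: orthonormal_def ip_scale intro!: continuous_intros)
  also have "\<dots> = (\<Sum>i<n. if i = j then c i else 0)"
    using assms by (intro sum.cong) (auto simp: orthonormal_def)
  finally show ?thesis using assms(2) by simp
qed

lemma cont_comb: "orthonormal n e \<Longrightarrow> cont (\<lambda>x. \<Sum>i<n. c i * e i x)"
  by (auto simp: orthonormal_def intro!: continuous_intros)

lemma ip_comb_comb:
  assumes "orthonormal n e"
  shows "ip (\<lambda>x. \<Sum>i<n. c i * e i x) (\<lambda>x. \<Sum>i<n. d i * e i x) = (\<Sum>i<n. c i * cnj (d i))"
proof -
  have "ip (\<lambda>x. \<Sum>i<n. c i * e i x) (\<lambda>x. \<Sum>i<n. d i * e i x)
      = (\<Sum>i<n. ip (\<lambda>x. \<Sum>i<n. c i * e i x) (\<lambda>x. d i * e i x))"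
    using assms by (intro ip_sum_right cont_comb) (auto simp: orthonormal_def intro!: continuous_intros)
  also have "\<dots> = (\<Sum>i<n. c i * cnj (d i))"
    using assms by (intro sum.cong refl)
      (subst ip_scale_right, auto simp: orthonormal_def ip_comb[OF assms] intro!: cont_comb[OF assms])
  finally show ?thesis .
qed

lemma bessel:
  assumes e: "orthonormal n e" and h: "cont h"
  shows "(\<Sum>i<n. (cmod (ip h (e i)))\<^sup>2) \<le> sqnorm h"
proof -
  let ?c = "\<lambda>i. ip h (e i)"
  let ?s = "\<lambda>x. \<Sum>i<n. ?c i * e i x"
  have s: "cont ?s" by (rule cont_comb[OF e])
  have sq: "(\<Sum>i<n. ?c i * cnj (?c i)) = complex_of_real (\<Sum>i<n. (cmod (?c i))\<^sup>2)"
    by (simp flip: complex_norm_square)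
  have "ip h ?s = (\<Sum>i<n. ip h (\<lambda>x. ?c i * e i x))"
    using e h by (intro ip_sum_right) (auto simp: orthonormal_def intro!: continuous_intros)
  also have "\<dots> = (\<Sum>i<n. ?c i * cnj (?c i))"
    using e h by (intro sum.cong refl) (subst ip_scale_right, auto simp: orthonormal_def)
  finally have "Re (ip h ?s) = (\<Sum>i<n. (cmod (?c i))\<^sup>2)" using sq by simp
  moreover have "complex_of_real (sqnorm ?s) = complex_of_real (\<Sum>i<n. (cmod (?c i))\<^sup>2)"
    unfolding ip_self[OF s, symmetric] ip_comb_comb[OF e] by (rule sq)
  then have "sqnorm ?s = (\<Sum>i<n. (cmod (?c i))\<^sup>2)" by (simp only: of_real_eq_iff)
  moreover have "0 \<le> sqnorm (\<lambda>x. h x - ?s x)"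
    by (intro sqnorm_nonneg continuous_intros h s)
  ultimately show ?thesis by (simp add: sqnorm_diff[OF h s])
qed

lemma orthonormal_single:
  assumes "cont v" "sqnorm v > 0"
  shows "orthonormal (Suc 0) (\<lambda>_ x. complex_of_real (inverse (sqrt (sqnorm v))) * v x)"
proof -
  let ?c = "complex_of_real (inverse (sqrt (sqnorm v)))"
  have "ip (\<lambda>x. ?c * v x) (\<lambda>x. ?c * v x) = ?c * (cnj ?c * complex_of_real (sqnorm v))"
    using assms(1) by (subst ip_scale, intro assms, intro continuous_intros assms, subst ip_scale_right)
      (simp_all add: ip_self)
  also have "\<dots> = complex_of_real (inverse (sqrt (sqnorm v)) * inverse (sqrt (sqnorm v)) * sqnorm v)"
    by simp
  also have "inverse (sqrt (sqnorm v)) * inverse (sqrt (sqnorm v)) * sqnorm v = 1"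
    using assms(2) by (simp add: field_simps)
  finally show ?thesis
    using assms(1) by (simp add: orthonormal_def continuous_on_mult_left del: of_real_inverse)
qed

text \<open>This is \<open>bessel\<close> for the one-element system obtained by normalising
  \<open>v\<close>; in the degenerate case \<open>v\<close> is zero.\<close>

lemma cauchy_schwarz:
  assumes u: "cont u" and v: "cont v"
  shows "(cmod (ip u v))\<^sup>2 \<le> sqnorm u * sqnorm v"
proof (cases "sqnorm v > 0")
  case True
  have "ip u (\<lambda>x. complex_of_real (inverse (sqrt (sqnorm v))) * v x)
      = complex_of_real (inverse (sqrt (sqnorm v))) * ip u v"
    by (subst ip_scale_right[OF v u]) simp
  with bessel[OF orthonormal_single[OF v True] u]
  have "(cmod (ip u v))\<^sup>2 / sqnorm v \<le> sqnorm u"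
    using True by (simp add: norm_mult power_mult_distrib divide_inverse power_inverse norm_inverse mult.commute
        del: of_real_inverse)
  then show ?thesis using True by (simp add: field_simps)
next
  case False
  then have "v = (\<lambda>_. 0)" using sqnorm_nonneg[OF v] sqnorm_eq_0[OF v] by simp
  then show ?thesis using sqnorm_nonneg[OF u] by (simp add: ip_def sqnorm_def)
qed

section \<open>Norm estimates for convolutions\<close>

lemma sqnorm_reflect:
  assumes v: "cont v"
  shows "sqnorm (\<lambda>y. cnj (v (- y + x))) = sqnorm v"
proof -
  have c: "continuous_on UNIV (\<lambda>y. (cmod (v (y + x)))\<^sup>2)"
    by (intro continuous_intros cont_comp[OF v])
  show ?thesis
    unfolding sqnorm_def using haar_integral_uminus[OF c] haar_integral_right[OF cont_sqnorm[OF v], of x] by simp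
qed

text \<open>Each value of a convolution is a scalar product with a reflected translate, whose norm
  does not depend on the point by unimodularity. This is what upgrades mean-square convergence to
  uniform convergence.\<close>

lemma conv_bound:
  assumes u: "cont u" and v: "cont v"
  shows "(cmod ((u \<star> v) x))\<^sup>2 \<le> sqnorm u * sqnorm v"
proof -
  have "cont (\<lambda>y. cnj (v (- y + x)))" by (intro continuous_intros cont_comp[OF v])
  from cauchy_schwarz[OF u this] show ?thesis by (simp add: conv_eq_ip sqnorm_reflect v)
qed

lemma sqnorm_conv:
  assumes u: "cont u" and v: "cont v"
  shows "sqnorm (u \<star> v) \<le> sqnorm u * sqnorm v"
proof -
  have "cmod ((u \<star> v) x) \<le> sqrt (sqnorm u * sqnorm v)" for x
    using conv_bound[OF assms, of x] by (rule real_le_rsqrt)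
  from sqnorm_bound[OF cont_conv[OF u v] this] show ?thesis
    using sqnorm_nonneg[OF u] sqnorm_nonneg[OF v] by simp
qed

lemma conv_diff_left:
  assumes "cont u" "cont v" "cont w"
  shows "((\<lambda>x. u x - v x) \<star> w) x = (u \<star> w) x - (v \<star> w) x"
  unfolding conv_def
  by (subst haar_integral_diff[symmetric])
    (auto simp: algebra_simps intro!: continuous_intros assms cont_comp[OF assms(3)])

lemma conv_diff_right:
  assumes "cont u" "cont v" "cont w"
  shows "(w \<star> (\<lambda>x. u x - v x)) x = (w \<star> u) x - (w \<star> v) x"
  unfolding conv_def
  by (subst haar_integral_diff[symmetric])
    (auto simp: algebra_simps intro!: continuous_intros assms cont_comp[OF assms(1)] cont_comp[OF assms(2)])

lemma conv_scale_left:
  assumes "cont u" "cont v"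
  shows "(\<lambda>x. c * u x) \<star> v = (\<lambda>x. c * (u \<star> v) x)"
  unfolding conv_def
  by (rule ext, subst haar_integral_cmult[symmetric])
    (auto simp: mult.assoc intro!: continuous_intros assms cont_comp[OF assms(2)])

lemma conv_scale_right:
  assumes "cont u" "cont v"
  shows "u \<star> (\<lambda>x. c * v x) = (\<lambda>x. c * (u \<star> v) x)"
  unfolding conv_def
  by (rule ext, subst haar_integral_cmult[symmetric])
    (auto simp: algebra_simps intro!: continuous_intros assms cont_comp[OF assms(2)])

lemma conv_left_translate:
  assumes u: "cont u" and v: "cont v"
  shows "((\<lambda>x. u (a + x)) \<star> v) x = (u \<star> v) (a + x)"
proof -
  have c: "cont (\<lambda>y. u (a + y) * v (- y + x))"
    by (intro continuous_intros cont_comp[OF u] cont_comp[OF v])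
  show ?thesis unfolding conv_def
    using haar_integral_left[OF c, of "- a"] by (simp add: minus_add add.assoc[symmetric])
qed

lemma uniform_conv_tendsto:
  assumes u: "\<And>n. cont (u n)" and v: "\<And>n. cont (v n)" and p: "cont p" and q: "cont q"
    and up: "(\<lambda>n. sqnorm (\<lambda>x. u n x - p x)) \<longlonglongrightarrow> 0" and vq: "(\<lambda>n. sqnorm (\<lambda>x. v n x - q x)) \<longlonglongrightarrow> 0"
    and ub: "\<And>n. sqnorm (u n) \<le> B"
  shows "(\<lambda>n. (u n \<star> v n) x) \<longlonglongrightarrow> (p \<star> q) x"
proof -
  have est: "cmod ((u n \<star> v n) x - (p \<star> q) x)
      \<le> sqrt (B * sqnorm (\<lambda>x. v n x - q x)) + sqrt (sqnorm (\<lambda>x. u n x - p x) * sqnorm q)" for n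
  proof -
    have d: "cont (\<lambda>x. v n x - q x)" "cont (\<lambda>x. u n x - p x)"
      by (intro continuous_intros u v p q)+
    \<comment> \<open>Telescoping: one factor is changed at a time, so only the boundedness of
      \<open>u n\<close> and the two mean-square limits enter.\<close>
    have "(u n \<star> v n) x - (p \<star> q) x
        = (u n \<star> (\<lambda>x. v n x - q x)) x + ((\<lambda>x. u n x - p x) \<star> q) x"
      by (simp add: conv_diff_left conv_diff_right u v p q)
    moreover have "cmod ((u n \<star> (\<lambda>x. v n x - q x)) x) \<le> sqrt (B * sqnorm (\<lambda>x. v n x - q x))"
      by (rule real_le_rsqrt, rule order_trans[OF conv_bound[OF u d(1)]])
        (intro mult_right_mono ub sqnorm_nonneg d)
    moreover have "cmod (((\<lambda>x. u n x - p x) \<star> q) x) \<le> sqrt (sqnorm (\<lambda>x. u n x - p x) * sqnorm q)"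
      by (rule real_le_rsqrt, rule conv_bound[OF d(2) q])
    ultimately show ?thesis
      using norm_triangle_ineq[of "(u n \<star> (\<lambda>x. v n x - q x)) x" "((\<lambda>x. u n x - p x) \<star> q) x"] by simp
  qed
  have "(\<lambda>n. sqrt (B * sqnorm (\<lambda>x. v n x - q x)) + sqrt (sqnorm (\<lambda>x. u n x - p x) * sqnorm q)) \<longlonglongrightarrow>
      sqrt (B * 0) + sqrt (0 * sqnorm q)"
    by (intro tendsto_intros up vq)
  then have "(\<lambda>n. (u n \<star> v n) x - (p \<star> q) x) \<longlonglongrightarrow> 0"
    by (intro Lim_null_comparison[OF always_eventually[OF allI[OF est]]]) simp
  then show ?thesis by (simp add: LIM_zero_iff)
qed

section \<open>Operator-valued Fourier coefficients\<close>

definition coef :: "('g \<Rightarrow> complex) \<Rightarrow> ('g \<Rightarrow> complex mat) \<Rightarrow> nat \<Rightarrow> nat \<Rightarrow> complex"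
  where "coef u \<pi> i j = haar_integral (\<lambda>x. u x * \<pi> x $$ (i, j))"

text \<open>The orthogonal complement of the conjugated matrix entries. By
  \<open>coef_free_conv\<close> it is a two-sided ideal of the convolution algebra;
  \<open>coef_free_imp_zero\<close> will show that it is zero.\<close>

definition coef_free :: "('g \<Rightarrow> complex) \<Rightarrow> bool"
  where "coef_free u \<longleftrightarrow> (\<forall>n \<pi> i j. irreducible_unitary_rep n \<pi> \<longrightarrow> i < n \<longrightarrow> j < n \<longrightarrow> coef u \<pi> i j = 0)"

lemma rep_entry:
  assumes "unitary_rep n \<pi>" "i < n" "j < n"
  shows "\<pi> (g + h) $$ (i, j) = (\<Sum>k<n. \<pi> g $$ (i, k) * \<pi> h $$ (k, j))"
proof -
  have c: "\<pi> g \<in> carrier_mat n n" "\<pi> h \<in> carrier_mat n n" "\<pi> (g + h) = \<pi> g * \<pi> h"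
    using assms(1) by (auto simp: unitary_rep_def)
  then show ?thesis
    using assms(2,3) by (auto simp: scalar_prod_def atLeast0LessThan)
qed

lemma rep_cont: "unitary_rep n \<pi> \<Longrightarrow> i < n \<Longrightarrow> j < n \<Longrightarrow> cont (\<lambda>x. \<pi> x $$ (i, j))"
  by (simp add: unitary_rep_def)

text \<open>The matrix \<open>coef u \<pi>\<close> is the operator obtained by integrating
  \<open>\<pi> x\<close> with weight \<open>u x\<close>, and this passage is multiplicative:
  substitute y + x for x and split \<open>\<pi> (y + x)\<close>.\<close>

lemma coef_conv:
  assumes \<pi>: "unitary_rep n \<pi>" and ij: "i < n" "j < n" and u: "cont u" and v: "cont v"
  shows "coef (u \<star> v) \<pi> i j = (\<Sum>k<n. coef u \<pi> i k * coef v \<pi> k j)"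
proof -
  note pc = rep_cont[OF \<pi>]
  have k: "continuous_on UNIV (\<lambda>(x, y). u y * v (- y + x) * \<pi> x $$ (i, j))"
    unfolding case_prod_unfold
    by (intro continuous_intros cont_comp[OF u] cont_comp[OF v] cont_comp[OF pc[OF ij]])
  have c1: "cont (\<lambda>y. u y * v (- y + x))" for x
    by (intro continuous_intros cont_comp[OF u] cont_comp[OF v])
  have c2: "cont (\<lambda>x. v (- y + x) * \<pi> x $$ (i, j))" for y
    by (intro continuous_intros cont_comp[OF v] pc ij)
  have inner: "haar_integral (\<lambda>x. v (- y + x) * \<pi> x $$ (i, j)) = (\<Sum>k<n. \<pi> y $$ (i, k) * coef v \<pi> k j)" for y
  proof -
    have "haar_integral (\<lambda>x. v (- y + x) * \<pi> x $$ (i, j)) = haar_integral (\<lambda>x. v x * \<pi> (y + x) $$ (i, j))"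
      using haar_integral_left[OF c2[of y], of y] by (simp add: add.assoc[symmetric])
    also have "\<dots> = haar_integral (\<lambda>x. \<Sum>k<n. \<pi> y $$ (i, k) * (v x * \<pi> x $$ (k, j)))"
      by (simp add: rep_entry[OF \<pi> ij] sum_distrib_left algebra_simps)
    also have "\<dots> = (\<Sum>k<n. haar_integral (\<lambda>x. \<pi> y $$ (i, k) * (v x * \<pi> x $$ (k, j))))"
      by (rule haar_integral_sum) (auto intro!: continuous_intros v pc ij)
    also have "\<dots> = (\<Sum>k<n. \<pi> y $$ (i, k) * coef v \<pi> k j)"
      unfolding coef_def by (intro sum.cong refl haar_integral_cmult) (auto intro!: continuous_intros v pc ij)
    finally show ?thesis .
  qed
  have "coef (u \<star> v) \<pi> i j = haar_integral (\<lambda>x. haar_integral (\<lambda>y. u y * v (- y + x) * \<pi> x $$ (i, j)))"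
    unfolding coef_def conv_def by (simp add: haar_integral_multc c1)
  also have "\<dots> = haar_integral (\<lambda>y. haar_integral (\<lambda>x. u y * (v (- y + x) * \<pi> x $$ (i, j))))"
    using haar_integral_fubini[OF k] by (simp add: mult.assoc)
  also have "\<dots> = haar_integral (\<lambda>y. u y * (\<Sum>k<n. \<pi> y $$ (i, k) * coef v \<pi> k j))"
    by (simp add: haar_integral_cmult c2 inner)
  also have "\<dots> = haar_integral (\<lambda>y. \<Sum>k<n. u y * \<pi> y $$ (i, k) * coef v \<pi> k j)"
    by (simp add: sum_distrib_left algebra_simps)
  also have "\<dots> = (\<Sum>k<n. haar_integral (\<lambda>y. u y * \<pi> y $$ (i, k) * coef v \<pi> k j))"
    by (rule haar_integral_sum) (auto intro!: continuous_intros u pc ij)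
  also have "\<dots> = (\<Sum>k<n. coef u \<pi> i k * coef v \<pi> k j)"
    unfolding coef_def[of u] by (intro sum.cong refl haar_integral_multc) (auto intro!: continuous_intros u pc ij)
  finally show ?thesis .
qed

lemma coef_freeD:
  "coef_free u \<Longrightarrow> irreducible_unitary_rep n \<pi> \<Longrightarrow> i < n \<Longrightarrow> j < n \<Longrightarrow> coef u \<pi> i j = 0"
  unfolding coef_free_def by blast

lemma coef_free_conv:
  assumes "coef_free u \<or> coef_free v" "cont u" "cont v"
  shows "coef_free (u \<star> v)"
  unfolding coef_free_def
proof (intro allI impI)
  fix n i j and \<pi> :: "'g \<Rightarrow> complex mat"
  assume irr: "irreducible_unitary_rep n \<pi>" and ij: "i < n" "j < n"
  then have "unitary_rep n \<pi>" by (simp add: irreducible_unitary_rep_def)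
  moreover have "coef u \<pi> i k * coef v \<pi> k j = 0" if "k < n" for k
    using assms(1) coef_freeD[OF _ irr] ij that by auto
  ultimately show "coef (u \<star> v) \<pi> i j = 0"
    using ij assms by (subst coef_conv) (auto intro!: sum.neutral)
qed

lemma coef_eq_ip: "coef u \<pi> i j = ip u (\<lambda>x. cnj (\<pi> x $$ (i, j)))"
  by (simp add: coef_def ip_def)

lemma sqnorm_limit_coef_free:
  assumes u: "\<And>n. cont (u n)" and p: "cont p"
    and up: "(\<lambda>n. sqnorm (\<lambda>x. u n x - p x)) \<longlonglongrightarrow> 0" and M: "\<And>n. coef_free (u n)"
  shows "coef_free p"
  unfolding coef_free_def
proof (intro allI impI)
  fix n i j and \<pi> :: "'g \<Rightarrow> complex mat" assume irr: "irreducible_unitary_rep n \<pi>" and ij: "i < n" "j < n"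
  let ?w = "\<lambda>x. cnj (\<pi> x $$ (i, j))"
  have w: "cont ?w"
    using irr ij by (intro continuous_intros rep_cont) (auto simp: irreducible_unitary_rep_def)
  have "(cmod (coef p \<pi> i j))\<^sup>2 \<le> sqnorm (\<lambda>x. u k x - p x) * sqnorm ?w" for k
  proof -
    have "coef (u k) \<pi> i j = 0" using M irr ij by (simp add: coef_free_def)
    then have "ip (\<lambda>x. u k x - p x) ?w = - coef p \<pi> i j"
      by (simp add: coef_eq_ip ip_diff u p w)
    then show ?thesis
      using cauchy_schwarz[of "\<lambda>x. u k x - p x" ?w] u p w by (simp add: continuous_on_diff)
  qed
  moreover have "(\<lambda>k. sqnorm (\<lambda>x. u k x - p x) * sqnorm ?w) \<longlonglongrightarrow> 0 * sqnorm ?w"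
    by (intro tendsto_intros up)
  ultimately have "(cmod (coef p \<pi> i j))\<^sup>2 \<le> 0"
    by (intro LIMSEQ_le_const[of _ 0]) auto
  then show "coef p \<pi> i j = 0" by simp
qed

end

section \<open>Projections in the convolution algebra\<close>

context compact_haar
begin

lemma uniform_limit_imp_sqnorm:
  assumes u: "\<And>n. cont (u n)" and p: "cont p" and lim: "uniform_limit UNIV u p sequentially"
  shows "(\<lambda>n. sqnorm (\<lambda>x. u n x - p x)) \<longlonglongrightarrow> 0"
proof (rule LIMSEQ_I)
  fix e :: real assume e: "0 < e"
  then have "sqrt (e/2) > 0" by simp
  then obtain N where N: "\<And>n x. n \<ge> N \<Longrightarrow> cmod (u n x - p x) < sqrt (e/2)"
    using lim unfolding uniform_limit_iff eventually_sequentially dist_norm by (metis UNIV_I)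
  have "norm (sqnorm (\<lambda>x. u n x - p x) - 0) < e" if "n \<ge> N" for n
  proof -
    have c: "cont (\<lambda>x. u n x - p x)" by (intro continuous_intros u p)
    have "sqnorm (\<lambda>x. u n x - p x) \<le> (sqrt (e/2))\<^sup>2"
      by (rule sqnorm_bound[OF c]) (use N[OF that] in \<open>auto intro: less_imp_le\<close>)
    then show ?thesis using sqnorm_nonneg[OF c] e by simp
  qed
  then show "\<exists>N. \<forall>n\<ge>N. norm (sqnorm (\<lambda>x. u n x - p x) - 0) < e" by blast
qed

text \<open>A mean-square limit of \<open>u n\<close> need not be a continuous function, but by
  \<open>conv_bound\<close> convolution with a fixed \<open>w\<close> makes the sequence uniformly
  Cauchy. This stands in for completeness of the square-integrable functions.\<close>

lemma conv_Cauchy_limit: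
  assumes w: "cont w" and u: "\<And>n. cont (u n)"
    and C: "\<And>e. e > 0 \<Longrightarrow> \<exists>N. \<forall>m\<ge>N. \<forall>n\<ge>N. sqnorm (\<lambda>x. u m x - u n x) < e"
  shows "\<exists>p. cont p \<and> uniform_limit UNIV (\<lambda>n. w \<star> u n) p sequentially"
proof -
  have "uniformly_Cauchy_on UNIV (\<lambda>n. w \<star> u n)"
    unfolding uniformly_Cauchy_on_def
  proof (intro allI impI)
    fix e :: real assume e: "e > 0"
    \<comment> \<open>Adding 1 keeps the divisor below positive even if \<open>w\<close> is
      zero.\<close>
    have W: "sqnorm w + 1 > 0" using sqnorm_nonneg[OF w] by simp
    obtain N where N: "\<And>m n. m \<ge> N \<Longrightarrow> n \<ge> N \<Longrightarrow> sqnorm (\<lambda>x. u m x - u n x) < e\<^sup>2 / (sqnorm w + 1)"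
      using C[of "e\<^sup>2 / (sqnorm w + 1)"] e W by auto
    have "dist ((w \<star> u m) x) ((w \<star> u n) x) < e" if "m \<ge> N" "n \<ge> N" for x m n
    proof -
      have c: "cont (\<lambda>x. u m x - u n x)" by (intro continuous_intros u)
      have "(cmod ((w \<star> u m) x - (w \<star> u n) x))\<^sup>2 \<le> sqnorm w * sqnorm (\<lambda>x. u m x - u n x)"
        using conv_bound[OF w c, of x] by (simp add: conv_diff_right u w)
      also have "\<dots> \<le> (sqnorm w + 1) * sqnorm (\<lambda>x. u m x - u n x)"
        using sqnorm_nonneg[OF c] by (intro mult_right_mono) auto
      also have "\<dots> < e\<^sup>2"
        using N[OF that] W by (simp add: field_simps)
      finally show ?thesis
        using e by (simp add: dist_norm power_less_imp_less_base)
    qed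
    then show "\<exists>M. \<forall>x\<in>UNIV. \<forall>m\<ge>M. \<forall>n\<ge>M. dist ((w \<star> u m) x) ((w \<star> u n) x) < e" by blast
  qed
  then obtain p where p: "uniform_limit UNIV (\<lambda>n. w \<star> u n) p sequentially"
    using Cauchy_uniformly_convergent uniformly_convergent_on_def by blast
  have "cont p"
    by (rule uniform_limit_theorem[OF _ p]) (auto intro!: always_eventually continuous_intros w u)
  with p show ?thesis by blast
qed

lemma uniform_limitD: "uniform_limit UNIV u p sequentially \<Longrightarrow> (\<lambda>n. u n x) \<longlonglongrightarrow> p x"
  by (rule tendsto_uniform_limitI) auto

text \<open>Convolution of continuous functions has in general no unit, so counting starts at the
  first power: \<open>conv_pow k n\<close> is the power with exponent n + 1.\<close>

fun conv_pow :: "('g \<Rightarrow> complex) \<Rightarrow> nat \<Rightarrow> 'g \<Rightarrow> complex" where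
  "conv_pow k 0 = k"
| "conv_pow k (Suc n) = k \<star> conv_pow k n"

lemma cont_conv_pow: "cont k \<Longrightarrow> cont (conv_pow k n)"
  by (induction n) (auto intro: cont_conv)

lemma conv_pow_conv: "cont k \<Longrightarrow> conv_pow k m \<star> conv_pow k n = conv_pow k (Suc (m + n))"
  by (induction m) (auto simp: conv_assoc cont_conv_pow)

lemma adj_conv_pow:
  assumes "cont k" "adj k = k"
  shows "adj (conv_pow k n) = conv_pow k n"
proof (induction n)
  case (Suc n)
  have "adj (conv_pow k (Suc n)) = conv_pow k n \<star> conv_pow k 0"
    using assms Suc by (simp add: adj_conv cont_conv_pow)
  then show ?case using conv_pow_conv[OF assms(1), of n 0] by simp
qed (simp add: assms)

lemma conv_pow_scale:
  assumes "cont k"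
  shows "conv_pow (\<lambda>x. c * k x) n = (\<lambda>x. c ^ Suc n * conv_pow k n x)"
proof (induction n)
  case (Suc n)
  have "cont (\<lambda>x. c ^ Suc n * conv_pow k n x)" by (intro continuous_intros cont_conv_pow assms)
  then have "conv_pow (\<lambda>x. c * k x) (Suc n) = (\<lambda>x. c * (c ^ Suc n * (k \<star> conv_pow k n) x))"
    using Suc by (simp add: conv_scale_left conv_scale_right assms cont_conv_pow del: power_Suc)
  then show ?case by (simp add: mult.assoc)
qed simp

text \<open>Self-adjointness lets powers move across the scalar product, so that it depends on the
  sum of the exponents only; squared norms and mixed products belong to one sequence of
  moments.\<close>

lemma conv_pow_zero_ip:
  assumes "cont k" "adj k = k"
  shows "conv_pow k (Suc (m + n)) 0 = ip (conv_pow k m) (conv_pow k n)"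
  using assms by (simp add: conv_pow_conv[symmetric] conv_zero adj_conv_pow del: conv_pow.simps)

lemma conv_pow_zero_sqnorm:
  assumes "cont k" "adj k = k"
  shows "conv_pow k (Suc (n + n)) 0 = complex_of_real (sqnorm (conv_pow k n))"
  using assms by (simp add: conv_pow_zero_ip ip_self cont_conv_pow del: conv_pow.simps)

text \<open>If a power is nonzero then so is its square, whose value at 0 is a squared norm. Powers
  between the two cannot vanish, because a vanishing power annihilates all later ones.\<close>

lemma conv_pow_nonzero:
  assumes k: "cont k" "adj k = k" and "k a \<noteq> 0"
  shows "sqnorm (conv_pow k n) > 0"
proof -
  have down: "\<exists>x. conv_pow k m x \<noteq> 0" if "conv_pow k (m + j) x \<noteq> 0" for m j x
    using that
  proof (induction j arbitrary: x)
    case (Suc j)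
    have "conv_pow k (m + j) \<noteq> (\<lambda>_. 0)"
      using Suc.prems by (auto simp: conv_def)
    then show ?case using Suc.IH by auto
  qed auto
  have "\<exists>x. conv_pow k n x \<noteq> 0"
  proof (induction n)
    case 0
    then show ?case using assms by auto
  next
    case (Suc n)
    then have "sqnorm (conv_pow k n) > 0" using sqnorm_pos cont_conv_pow k by blast
    then have "conv_pow k (Suc n + n) 0 \<noteq> 0" using conv_pow_zero_sqnorm[OF k, of n] by simp
    then show ?case by (rule down)
  qed
  then show ?thesis using sqnorm_pos cont_conv_pow k by blast
qed

text \<open>The condition \<open>ratio\<close> says in effect that the largest absolute value of an
  eigenvalue is 1. Since 1 and -1 may both occur, only even exponents are used, and the limit
  projects onto both eigenspaces together.\<close>

lemma projection_normalised:
  assumes k: "cont k" "adj k = k" and M: "coef_free k"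
    and pos: "\<And>n. sqnorm (conv_pow k n) > 0" and dec: "\<And>n. sqnorm (conv_pow k (Suc n)) \<le> sqnorm (conv_pow k n)"
    and ratio: "(\<lambda>n. sqnorm (conv_pow k (Suc n)) / sqnorm (conv_pow k n)) \<longlonglongrightarrow> 1"
  shows "\<exists>p. cont p \<and> adj p = p \<and> p \<star> p = p \<and> coef_free p \<and> p 0 \<noteq> 0"
proof -
  define t where "t n = sqnorm (conv_pow k n)" for n
  note c = cont_conv_pow[OF k(1)]
  have ratios: "(\<lambda>n. t (n + j) / t n) \<longlonglongrightarrow> 1" for j
  proof (induction j)
    case 0
    have "t n \<noteq> 0" for n using pos[of n] by (simp add: t_def)
    then show ?case by simp
  next
    case (Suc j)
    have "(\<lambda>n. t (Suc (n + j)) / t (n + j)) \<longlonglongrightarrow> 1"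
      using LIMSEQ_ignore_initial_segment[OF ratio, of j] by (simp add: t_def)
    from tendsto_mult[OF this Suc]
    have "(\<lambda>n. t (Suc (n + j)) / t (n + j) * (t (n + j) / t n)) \<longlonglongrightarrow> 1" by simp
    moreover have "t (n + j) \<noteq> 0" for n using pos[of "n + j"] by (simp add: t_def)
    ultimately show ?case by simp
  qed
  \<comment> \<open>By submultiplicativity \<open>t (m + Suc n)\<close> is at most
    \<open>t m * t n\<close>; dividing by \<open>t m\<close> and letting m grow gives the bound. It
    keeps the limit \<open>\<tau>\<close>, which becomes the value \<open>p 0\<close>, away from
    zero.\<close>
  have t1: "1 \<le> t n" for n
  proof (rule LIMSEQ_le_const2[OF ratios[of "Suc n"]], intro exI allI impI)
    fix m
    have "t (m + Suc n) \<le> t m * t n"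
      using sqnorm_conv[OF c c, of m n] by (simp add: t_def conv_pow_conv k del: conv_pow.simps)
    then show "t (m + Suc n) / t m \<le> t n"
      using pos[of m] by (simp add: t_def pos_divide_le_eq mult.commute)
  qed
  have "decseq t" using dec by (intro decseq_SucI) (simp add: t_def)
  then obtain \<tau> where \<tau>: "t \<longlonglongrightarrow> \<tau>"
    using decseq_convergent[of t 0] pos by (metis t_def less_imp_le)
  have \<tau>1: "1 \<le> \<tau>" by (rule LIMSEQ_le_const[OF \<tau>]) (use t1 in auto)
  let ?u = "\<lambda>n. conv_pow k (Suc (2 * n))"
  \<comment> \<open>The mixed scalar product is the value at 0 of the power with exponent 2 m + 2 n
    + 4, which is twice m + n + 2, hence again a squared norm. So convergence of \<open>t\<close>
    alone makes the even powers Cauchy.\<close>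
  have cross: "sqnorm (\<lambda>x. ?u m x - ?u n x) = t (Suc (2*m)) + t (Suc (2*n)) - 2 * t (Suc (m + n))" for m n
  proof -
    have "ip (?u m) (?u n) = conv_pow k (Suc (Suc (2*m) + Suc (2*n))) 0"
      by (rule conv_pow_zero_ip[OF k, symmetric])
    also have "Suc (Suc (2*m) + Suc (2*n)) = Suc (Suc (m + n) + Suc (m + n))" by simp
    also have "conv_pow k \<dots> 0 = complex_of_real (t (Suc (m + n)))"
      unfolding t_def by (rule conv_pow_zero_sqnorm[OF k])
    finally have "ip (?u m) (?u n) = complex_of_real (t (Suc (m + n)))" .
    then show ?thesis by (simp only: sqnorm_diff[OF c c] t_def Re_complex_of_real)
  qed
  have "\<exists>N. \<forall>m\<ge>N. \<forall>n\<ge>N. sqnorm (\<lambda>x. ?u m x - ?u n x) < e" if "e > 0" for e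
  proof -
    obtain N where N: "\<And>n. n \<ge> N \<Longrightarrow> \<bar>t n - \<tau>\<bar> < e/4"
      using LIMSEQ_D[OF \<tau>, of "e/4"] \<open>e > 0\<close> unfolding real_norm_def
      by (metis divide_pos_pos zero_less_numeral)
    have "sqnorm (\<lambda>x. ?u m x - ?u n x) < e" if "m \<ge> N" "n \<ge> N" for m n
    proof -
      have "\<bar>t (Suc (2*m)) - \<tau>\<bar> < e/4" "\<bar>t (Suc (2*n)) - \<tau>\<bar> < e/4" "\<bar>t (Suc (m + n)) - \<tau>\<bar> < e/4"
        by (rule N, use that in simp)+
      then show ?thesis unfolding cross by linarith
    qed
    then show ?thesis by blast
  qed
  \<comment> \<open>One more convolution, with the even power \<open>conv_pow k 1\<close>, makes the
    convergence uniform and keeps the exponents even.\<close>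
  from conv_Cauchy_limit[OF c[of 1] c this]
  obtain p where p: "cont p" and lim': "uniform_limit UNIV (\<lambda>n. conv_pow k 1 \<star> ?u n) p sequentially"
    by blast
  define V where "V n = conv_pow k (2 * n + 3)" for n
  have "(\<lambda>n. conv_pow k 1 \<star> ?u n) = V"
    unfolding V_def by (rule ext, subst conv_pow_conv[OF k(1)]) (simp add: eval_nat_numeral)
  with lim' have lim: "uniform_limit UNIV V p sequentially" by simp
  have cV: "cont (V n)" for n unfolding V_def by (rule c)
  have Vp: "(\<lambda>n. sqnorm (\<lambda>x. V n x - p x)) \<longlonglongrightarrow> 0" by (rule uniform_limit_imp_sqnorm[OF cV p lim])
  note pt = uniform_limitD[OF lim]
  have "adj p = p"
  proof
    fix x
    have "adj (V n) x = V n x" for n unfolding V_def by (simp only: adj_conv_pow[OF k])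
    then have "(\<lambda>n. V n x) = (\<lambda>n. cnj (V n (- x)))" by (simp add: adj_def)
    then show "adj p x = p x"
      using pt[of x] tendsto_cnj[OF pt[of "- x"]] LIMSEQ_unique by (metis adj_def)
  qed
  moreover have "p \<star> p = p"
  proof
    fix x
    have "sqnorm (V n) \<le> t 0" for n
      using decseqD[OF \<open>decseq t\<close>, of 0 "2 * n + 3"] by (simp add: V_def t_def)
    from uniform_conv_tendsto[OF cV cV p p Vp Vp this]
    have "(\<lambda>n. (V n \<star> V n) x) \<longlonglongrightarrow> (p \<star> p) x" .
    \<comment> \<open>Squares stay within the sequence: in \<open>conv_pow\<close> indices, (2 n +
      3) + (2 n + 3) + 1 = 2 (2 n + 2) + 3.\<close>
    moreover have "(V n \<star> V n) x = V (2 * n + 2) x" for n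
      unfolding V_def by (subst conv_pow_conv[OF k(1)]) (simp add: eval_nat_numeral)
    moreover have "(\<lambda>n. V (2 * n + 2) x) \<longlonglongrightarrow> p x"
      by (rule LIMSEQ_subseq_LIMSEQ[OF pt[of x], of "\<lambda>n. 2 * n + 2", unfolded comp_def])
        (simp add: strict_mono_def)
    ultimately show "(p \<star> p) x = p x" using LIMSEQ_unique by auto
  qed
  moreover have "coef_free p"
  proof (rule sqnorm_limit_coef_free[OF cV p Vp])
    have "coef_free (conv_pow k n)" for n
      by (cases n) (use M k in \<open>auto intro!: coef_free_conv cont_conv_pow\<close>)
    then show "coef_free (V n)" for n by (simp add: V_def)
  qed
  moreover have "p 0 \<noteq> 0"
  proof -
    have "V n 0 = complex_of_real (t (n + 1))" for n
    proof -
      have "2 * n + 3 = Suc ((n + 1) + (n + 1))" by simp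
      then show ?thesis unfolding V_def t_def using conv_pow_zero_sqnorm[OF k] by metis
    qed
    moreover have "(\<lambda>n. complex_of_real (t (n + 1))) \<longlonglongrightarrow> complex_of_real \<tau>"
      by (rule tendsto_of_real, rule LIMSEQ_ignore_initial_segment[OF \<tau>])
    ultimately have "p 0 = complex_of_real \<tau>" using pt[of 0] LIMSEQ_unique by auto
    then show ?thesis using \<tau>1 by auto
  qed
  ultimately show ?thesis using p by blast
qed

text \<open>The squared norms of the convolution powers are log-convex, so their ratios increase to the
  largest eigenvalue; after rescaling, the even powers converge to the eigenprojection.\<close>

lemma projection_exists:
  assumes k: "cont k" "adj k = k" and M: "coef_free k" and "k a \<noteq> 0"
  shows "\<exists>p. cont p \<and> adj p = p \<and> p \<star> p = p \<and> coef_free p \<and> p 0 \<noteq> 0"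
proof -
  define t where "t n = sqnorm (conv_pow k n)" for n
  note c = cont_conv_pow[OF k(1)]
  have pos: "t n > 0" for n unfolding t_def by (rule conv_pow_nonzero[OF k \<open>k a \<noteq> 0\<close>])
  define r where "r n = t (Suc n) / t n" for n
  have r_pos: "r n > 0" for n unfolding r_def using pos by simp
  \<comment> \<open>The scalar product of the powers indexed by n and n + 2 equals the squared norm
    of the power between them, so log-convexity is Cauchy--Schwarz.\<close>
  have "r n \<le> r (Suc n)" for n
  proof -
    have "conv_pow k (Suc (n + Suc (Suc n))) 0 = complex_of_real (t (Suc n))"
      using conv_pow_zero_sqnorm[OF k, of "Suc n"] by (simp add: t_def del: conv_pow.simps)
    then have "ip (conv_pow k n) (conv_pow k (Suc (Suc n))) = complex_of_real (t (Suc n))"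
      using conv_pow_zero_ip[OF k, of n "Suc (Suc n)"] by simp
    then have "(t (Suc n))\<^sup>2 \<le> t n * t (Suc (Suc n))"
      using cauchy_schwarz[OF c[of n] c[of "Suc (Suc n)"]] by (simp add: t_def del: conv_pow.simps)
    then show ?thesis
      unfolding r_def using pos[of n] pos[of "Suc n"] by (simp add: field_simps power2_eq_square)
  qed
  then have inc: "incseq r" by (rule incseq_SucI)
  have bound: "r n \<le> sqnorm k" for n
    using sqnorm_conv[OF k(1) c, of n] pos[of n] by (simp add: r_def t_def field_simps)
  obtain \<rho> where \<rho>: "r \<longlonglongrightarrow> \<rho>" "\<And>n. r n \<le> \<rho>"
    using incseq_convergent[OF inc, of "sqnorm k"] bound by blast
  have "\<rho> > 0" using \<rho>(2)[of 0] r_pos[of 0] by simp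
  \<comment> \<open>\<open>\<rho>\<close> is the limiting growth of the squared norms per power, so
    the kernel itself is divided by the square root.\<close>
  define c where "c = complex_of_real (1 / sqrt \<rho>)"
  have c2: "(cmod c)\<^sup>2 = 1 / \<rho>" using \<open>\<rho> > 0\<close> by (simp add: c_def norm_divide power_divide)
  let ?K = "\<lambda>x. c * k x"
  have tK: "sqnorm (conv_pow ?K n) = (1 / \<rho>) ^ Suc n * t n" for n
    unfolding conv_pow_scale[OF k(1)] sqnorm_scale[OF \<open>\<And>n. cont (conv_pow k n)\<close>] t_def
    by (simp add: norm_power norm_mult power_mult_distrib power_mult[symmetric] mult.commute c2[symmetric] del: power_Suc)
  have ratio: "sqnorm (conv_pow ?K (Suc n)) / sqnorm (conv_pow ?K n) = r n / \<rho>" for n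
    unfolding tK r_def using pos[of n] \<open>\<rho> > 0\<close> by (simp add: field_simps)
  have posK: "sqnorm (conv_pow ?K n) > 0" for n unfolding tK using pos \<open>\<rho> > 0\<close> by simp
  show ?thesis
  proof (rule projection_normalised[of ?K])
    show "cont ?K" by (intro continuous_intros k)
    show "adj ?K = ?K"
      using fun_cong[OF k(2)] by (intro ext) (simp add: adj_def c_def)
    show "coef_free ?K"
      unfolding coef_free_def
    proof (intro allI impI)
      fix n i j and \<pi> :: "'g \<Rightarrow> complex mat"
      assume irr: "irreducible_unitary_rep n \<pi>" and ij: "i < n" "j < n"
      then have "cont (\<lambda>x. k x * \<pi> x $$ (i, j))"
        by (intro continuous_intros k rep_cont) (auto simp: irreducible_unitary_rep_def)
      from haar_integral_cmult[OF this, of c] show "coef ?K \<pi> i j = 0"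
        using coef_freeD[OF M irr ij] by (simp add: coef_def mult.assoc)
    qed
    show "sqnorm (conv_pow ?K n) > 0" for n by (rule posK)
    show "sqnorm (conv_pow ?K (Suc n)) \<le> sqnorm (conv_pow ?K n)" for n
    proof -
      have "sqnorm (conv_pow ?K (Suc n)) / sqnorm (conv_pow ?K n) \<le> 1"
        unfolding ratio using \<rho>(2)[of n] \<open>\<rho> > 0\<close> by simp
      then show ?thesis using posK[of n] by (simp only: pos_divide_le_eq mult_1_left)
    qed
    show "(\<lambda>n. sqnorm (conv_pow ?K (Suc n)) / sqnorm (conv_pow ?K n)) \<longlonglongrightarrow> 1"
      unfolding ratio using tendsto_divide[OF \<rho>(1) tendsto_const, of \<rho>] \<open>\<rho> > 0\<close> by simp
  qed
qed

end

section \<open>Finite-dimensional invariant subspaces\<close>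

lemma mat_adjoint_carrier: "A \<in> carrier_mat n m \<Longrightarrow> mat_adjoint A \<in> carrier_mat m n"
  unfolding mat_adjoint_def by (rule carrier_matI) simp_all

lemma mat_adjoint_entry:
  assumes "A \<in> carrier_mat n n" "i < n" "j < n"
  shows "mat_adjoint A $$ (i, j) = conjugate (A $$ (j, i))"
  using assms by (simp add: mat_adjoint_def mat_of_rows_index)

context compact_haar
begin

definition func_subspace :: "('g \<Rightarrow> complex) set \<Rightarrow> bool"
  where "func_subspace S \<longleftrightarrow> (\<lambda>_. 0) \<in> S \<and> (\<forall>u\<in>S. \<forall>v\<in>S. (\<lambda>x. u x + v x) \<in> S) \<and> (\<forall>c. \<forall>u\<in>S. (\<lambda>x. c * u x) \<in> S)"

definition left_invariant :: "('g \<Rightarrow> complex) set \<Rightarrow> bool"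
  where "left_invariant S \<longleftrightarrow> (\<forall>a. \<forall>u\<in>S. (\<lambda>x. u (a + x)) \<in> S)"

lemma func_subspace_add: "func_subspace S \<Longrightarrow> u \<in> S \<Longrightarrow> v \<in> S \<Longrightarrow> (\<lambda>x. u x + v x) \<in> S"
  by (simp add: func_subspace_def)

lemma func_subspace_scale: "func_subspace S \<Longrightarrow> u \<in> S \<Longrightarrow> (\<lambda>x. c * u x) \<in> S"
  by (simp add: func_subspace_def)

lemma func_subspace_sum:
  assumes "func_subspace S" "\<And>i. i \<in> I \<Longrightarrow> u i \<in> S"
  shows "(\<lambda>x. \<Sum>i\<in>I. c i * u i x) \<in> S"
  using assms(2)
proof (induction I rule: infinite_finite_induct)
  case (insert i I)
  then have "(\<lambda>x. c i * u i x) \<in> S" "(\<lambda>x. \<Sum>i\<in>I. c i * u i x) \<in> S"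
    using assms(1) by (auto simp: func_subspace_def)
  then have "(\<lambda>x. c i * u i x + (\<Sum>i\<in>I. c i * u i x)) \<in> S"
    using assms(1) by (auto simp: func_subspace_def)
  then show ?case using insert by simp
qed (use assms(1) in \<open>auto simp: func_subspace_def\<close>)

section \<open>Dimension and orthonormal systems\<close>

definition orthonormal_in :: "('g \<Rightarrow> complex) set \<Rightarrow> nat \<Rightarrow> (nat \<Rightarrow> 'g \<Rightarrow> complex) \<Rightarrow> bool"
  where "orthonormal_in S n e \<longleftrightarrow> orthonormal n e \<and> (\<forall>i<n. e i \<in> S)"

text \<open>The maximum runs over orthonormal systems, so that a system in a subspace compares
  directly with one in the whole space. It exists for subsets of \<open>fixed_by p\<close>, where
  \<open>orthonormal_bound\<close> limits the length.\<close>

definition func_dim :: "('g \<Rightarrow> complex) set \<Rightarrow> nat"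
  where "func_dim S = (GREATEST n. \<exists>e. orthonormal_in S n e)"

definition fixed_by :: "('g \<Rightarrow> complex) \<Rightarrow> ('g \<Rightarrow> complex) set"
  where "fixed_by p = {h. cont h \<and> h \<star> p = h}"

text \<open>Since \<open>e i = e i \<star> p\<close>, the value \<open>e i x\<close> is up to
  conjugation the coefficient along \<open>e i\<close> of one function, a reflected translate of
  \<open>p\<close>. Bessel bounds the sum of squares at each point by \<open>sqnorm p\<close>, and
  integrating over x counts the system.\<close>

lemma orthonormal_bound:
  assumes p: "cont p" and e: "orthonormal n e" and E: "\<And>i. i < n \<Longrightarrow> e i \<in> fixed_by p"
  shows "real n \<le> sqnorm p"
proof -
  have ce: "cont (e i)" if "i < n" for i using E[OF that] by (simp add: fixed_by_def)
  have "(\<Sum>i<n. (cmod (e i x))\<^sup>2) \<le> sqnorm p" for x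
  proof -
    let ?q = "\<lambda>y. cnj (p (- y + x))"
    have q: "cont ?q" by (intro continuous_intros cont_comp[OF p])
    have "cmod (e i x) = cmod (ip ?q (e i))" if "i < n" for i
    proof -
      have "e i x = (e i \<star> p) x" using E[OF that] by (simp add: fixed_by_def)
      also have "\<dots> = cnj (ip ?q (e i))"
        by (simp only: conv_eq_ip ip_cnj[OF q ce[OF that]])
      finally show ?thesis by simp
    qed
    then have "(\<Sum>i<n. (cmod (e i x))\<^sup>2) = (\<Sum>i<n. (cmod (ip ?q (e i)))\<^sup>2)" by simp
    also have "\<dots> \<le> sqnorm ?q" by (rule bessel[OF e q])
    finally show ?thesis by (simp add: sqnorm_reflect[OF p])
  qed
  then have "haar_integral (\<lambda>x. \<Sum>i<n. (cmod (e i x))\<^sup>2) \<le> haar_integral (\<lambda>x. sqnorm p)"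
    by (intro haar_integral_mono) (auto intro!: continuous_intros ce)
  moreover have "haar_integral (\<lambda>x. \<Sum>i<n. (cmod (e i x))\<^sup>2) = (\<Sum>i<n. sqnorm (e i))"
    unfolding sqnorm_def by (rule haar_integral_sum) (auto intro!: continuous_intros ce)
  moreover have "sqnorm (e i) = 1" if "i < n" for i
    using ip_self[OF ce[OF that]] e that by (simp add: orthonormal_def)
  ultimately show ?thesis by simp
qed

lemma func_dim:
  assumes p: "cont p" and S: "S \<subseteq> fixed_by p"
  shows "\<exists>e. orthonormal_in S (func_dim S) e" and "orthonormal_in S n e \<Longrightarrow> n \<le> func_dim S"
proof -
  obtain b where b: "sqnorm p \<le> real b" using real_arch_simple by blast
  have bd: "\<And>y. \<exists>e. orthonormal_in S y e \<Longrightarrow> y \<le> b"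
    using orthonormal_bound[OF p] S b by (fastforce simp: orthonormal_in_def)
  have ex: "\<exists>e. orthonormal_in S 0 e" by (simp add: orthonormal_in_def orthonormal_def)
  show "\<exists>e. orthonormal_in S (func_dim S) e"
    unfolding func_dim_def by (rule GreatestI_nat[where P = "\<lambda>n. \<exists>e. orthonormal_in S n e", OF ex bd])
  show "n \<le> func_dim S" if "orthonormal_in S n e"
    unfolding func_dim_def by (rule Greatest_le_nat[where P = "\<lambda>n. \<exists>e. orthonormal_in S n e"]) (use that bd in auto)
qed

text \<open>A longest orthonormal system is complete: a nonzero remainder lies in \<open>S\<close>,
  is orthogonal to the system, and could be normalised and appended.\<close>

lemma orthonormal_in_expand:
  assumes p: "cont p" and S: "S \<subseteq> fixed_by p" "func_subspace S" and e: "orthonormal_in S (func_dim S) e" and h: "h \<in> S"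
  shows "h = (\<lambda>x. \<Sum>i<func_dim S. ip h (e i) * e i x)"
proof (rule ccontr)
  let ?n = "func_dim S"
  let ?s = "\<lambda>x. \<Sum>i<?n. ip h (e i) * e i x"
  let ?g = "\<lambda>x. h x - ?s x"
  assume "h \<noteq> ?s"
  then obtain a where a: "?g a \<noteq> 0" by (auto simp: fun_eq_iff)
  have on: "orthonormal ?n e" using e by (simp add: orthonormal_in_def)
  have cs: "cont ?s" by (rule cont_comb[OF on])
  have ch: "cont h" using h S by (auto simp: fixed_by_def)
  have cg: "cont ?g" by (intro continuous_intros ch cs)
  have sS: "?s \<in> S" by (rule func_subspace_sum[OF S(2)]) (use e in \<open>auto simp: orthonormal_in_def\<close>)
  have "(\<lambda>x. h x + (-1) * ?s x) \<in> S" by (rule func_subspace_add[OF S(2) h func_subspace_scale[OF S(2) sS]])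
  then have g: "?g \<in> S" by simp
  have ce: "cont (e i)" if "i < ?n" for i using on that by (simp add: orthonormal_def)
  have ge: "ip ?g (e i) = 0" if "i < ?n" for i
    using that by (simp add: ip_diff[OF ch cs ce] ip_comb[OF on])
  have eg: "ip (e i) ?g = 0" if "i < ?n" for i
    using ge[OF that] ip_cnj[OF cg ce[OF that]] by simp
  define N where "N = sqnorm ?g"
  have N: "N > 0" unfolding N_def by (rule sqnorm_pos[OF cg a])
  let ?c = "complex_of_real (inverse (sqrt N))"
  let ?f = "\<lambda>x. ?c * ?g x"
  have f: "?f \<in> S" by (rule func_subspace_scale[OF S(2) g])
  have cf: "cont ?f" by (intro continuous_intros cg)
  have "orthonormal (Suc 0) (\<lambda>_. ?f)" unfolding N_def by (rule orthonormal_single[OF cg]) (use N N_def in simp)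
  then have ff: "ip ?f ?f = 1" by (simp add: orthonormal_def)
  have fe: "ip ?f (e i) = 0" if "i < ?n" for i
    using ge[OF that] by (simp only: ip_scale[OF cg ce[OF that]] mult_zero_right)
  have ef: "ip (e i) ?f = 0" if "i < ?n" for i
    using eg[OF that] by (simp only: ip_scale_right[OF cg ce[OF that]] mult_zero_right)
  define e' where "e' = (\<lambda>i. if i = ?n then ?f else e i)"
  have "orthonormal_in S (Suc ?n) e'"
    unfolding orthonormal_in_def orthonormal_def
  proof (intro conjI allI impI)
    fix i assume "i < Suc ?n"
    then show "cont (e' i)" "e' i \<in> S"
      unfolding e'_def using cf ce f e by (cases "i = ?n"; simp add: orthonormal_in_def)+
  next
    fix i j assume "i < Suc ?n" "j < Suc ?n"
    then consider "i = ?n" "j = ?n" | "i = ?n" "j < ?n" | "i < ?n" "j = ?n" | "i < ?n" "j < ?n" by linarith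
    then show "ip (e' i) (e' j) = (if i = j then 1 else 0)"
    proof cases
      case 1
      then show ?thesis unfolding e'_def by (simp only: ff if_True refl)
    next
      case 2
      then show ?thesis unfolding e'_def using fe[of j] by (simp del: of_real_inverse)
    next
      case 3
      then show ?thesis unfolding e'_def using ef[of i] by (simp del: of_real_inverse)
    next
      case 4
      then show ?thesis unfolding e'_def using on by (simp add: orthonormal_def)
    qed
  qed
  from func_dim(2)[OF p S(1) this] show False by simp
qed

section \<open>Left translation as a unitary representation\<close>

lemma translate_unitary:
  assumes u: "cont u" and v: "cont v"
  shows "ip (\<lambda>x. u (a + x)) (\<lambda>x. v (a + x)) = ip u v"
  unfolding ip_def using haar_integral_left[OF cont_ip[OF u v], of a] by simp

lemma comb_unique:
  assumes on: "orthonormal n e" and eq: "\<And>x. (\<Sum>i<n. c i * e i x) = (\<Sum>i<n. d i * e i x)" and "i < n"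
  shows "c i = d i"
  using ip_comb[OF on \<open>i < n\<close>, of c] ip_comb[OF on \<open>i < n\<close>, of d] eq by simp

text \<open>The matrix in the basis \<open>e\<close> of left translation by \<open>g\<close>, which
  sends u to the function u (- g + x); the inverse makes the representation multiplicative rather
  than order-reversing.\<close>

definition rep_of :: "nat \<Rightarrow> (nat \<Rightarrow> 'g \<Rightarrow> complex) \<Rightarrow> 'g \<Rightarrow> complex mat"
  where "rep_of n e g = Matrix.mat n n (\<lambda>(i, j). ip (\<lambda>x. e j (- g + x)) (e i))"

lemma rep_of_expand:
  assumes p: "cont p" and S: "S \<subseteq> fixed_by p" "func_subspace S" "left_invariant S" and e: "orthonormal_in S (func_dim S) e" and j: "j < func_dim S"
  shows "e j (- g + x) = (\<Sum>i<func_dim S. rep_of (func_dim S) e g $$ (i, j) * e i x)"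
proof -
  have "(\<lambda>x. e j (- g + x)) \<in> S" using S(3) e j by (simp add: left_invariant_def orthonormal_in_def)
  from fun_cong[OF orthonormal_in_expand[OF p S(1,2) e this], of x] show ?thesis
    using j by (simp add: rep_of_def)
qed

lemma rep_of_inverse:
  assumes on: "orthonormal n e" and ij: "i < n" "j < n"
  shows "rep_of n e (- g) $$ (i, j) = cnj (rep_of n e g $$ (j, i))"
proof -
  have ce: "cont (e i)" "cont (e j)" using on ij by (auto simp: orthonormal_def)
  have c: "cont (\<lambda>x. e i (- g + x))" by (rule continuous_translate[OF ce(1)])
  have "ip (\<lambda>x. e j (g + x)) (e i) = ip (\<lambda>x. e j (g + x)) (\<lambda>x. e i (- g + (g + x)))"
    by (simp add: add.assoc[symmetric])
  also have "\<dots> = ip (e j) (\<lambda>x. e i (- g + x))"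
    by (rule translate_unitary[OF ce(2) c])
  also have "\<dots> = cnj (ip (\<lambda>x. e i (- g + x)) (e j))"
    by (rule ip_cnj[OF c ce(2), symmetric])
  finally show ?thesis using ij by (simp add: rep_of_def)
qed

lemma rep_of_unitary:
  assumes p: "cont p" and S: "S \<subseteq> fixed_by p" "func_subspace S" "left_invariant S" and e: "orthonormal_in S (func_dim S) e"
  shows "unitary_rep (func_dim S) (rep_of (func_dim S) e)"
proof -
  let ?n = "func_dim S"
  let ?\<pi> = "rep_of ?n e"
  have on: "orthonormal ?n e" using e by (simp add: orthonormal_in_def)
  have ce: "cont (e i)" if "i < ?n" for i using on that by (simp add: orthonormal_def)
  have car: "?\<pi> g \<in> carrier_mat ?n ?n" for g by (simp add: rep_of_def)
  note ex = rep_of_expand[OF p S e]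
  have "mat_adjoint (?\<pi> g) * ?\<pi> g = 1\<^sub>m ?n" for g
  proof (rule eq_matI)
    fix i j assume ij: "i < dim_row (1\<^sub>m ?n)" "j < dim_col (1\<^sub>m ?n)"
    then have ij: "i < ?n" "j < ?n" by auto
    have ac: "mat_adjoint (?\<pi> g) \<in> carrier_mat ?n ?n" by (rule mat_adjoint_carrier[OF car])
    have "(mat_adjoint (?\<pi> g) * ?\<pi> g) $$ (i, j)
        = (\<Sum>k<?n. mat_adjoint (?\<pi> g) $$ (i, k) * ?\<pi> g $$ (k, j))"
      using ij ac car[of g] by (auto simp: scalar_prod_def atLeast0LessThan)
    also have "\<dots> = (\<Sum>k<?n. ?\<pi> g $$ (k, j) * cnj (?\<pi> g $$ (k, i)))"
      by (intro sum.cong refl) (simp add: mat_adjoint_entry[OF car ij(1)] mult.commute)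
    \<comment> \<open>The columns of the matrix are the coordinate vectors of the translated basis
      functions, whose scalar products are preserved by translation.\<close>
    also have "\<dots> = ip (\<lambda>x. e j (- g + x)) (\<lambda>x. e i (- g + x))"
      unfolding ex[OF ij(1)] ex[OF ij(2)] by (rule ip_comb_comb[OF on, symmetric])
    also have "\<dots> = ip (e j) (e i)" by (rule translate_unitary[OF ce ce]) (use ij in auto)
    also have "\<dots> = 1\<^sub>m ?n $$ (i, j)" using on ij by (simp add: orthonormal_def)
    finally show "(mat_adjoint (?\<pi> g) * ?\<pi> g) $$ (i, j) = 1\<^sub>m ?n $$ (i, j)" .
  qed (use car in \<open>auto simp: mat_adjoint_def rep_of_def\<close>)
  moreover have "?\<pi> (g + h) = ?\<pi> g * ?\<pi> h" for g h
  proof (rule eq_matI)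
    fix i j assume "i < dim_row (?\<pi> g * ?\<pi> h)" "j < dim_col (?\<pi> g * ?\<pi> h)"
    then have ij: "i < ?n" "j < ?n" using car[of g] car[of h] by auto
    have eq: "e j (- (g + h) + x) = (\<Sum>i<?n. (\<Sum>k<?n. ?\<pi> g $$ (i, k) * ?\<pi> h $$ (k, j)) * e i x)" for x
    proof -
      have "e j (- (g + h) + x) = e j (- h + (- g + x))" by (simp only: minus_add add.assoc)
      also have "\<dots> = (\<Sum>k<?n. ?\<pi> h $$ (k, j) * e k (- g + x))" by (rule ex[OF ij(2)])
      also have "\<dots> = (\<Sum>k<?n. ?\<pi> h $$ (k, j) * (\<Sum>i<?n. ?\<pi> g $$ (i, k) * e i x))"
        by (intro sum.cong refl arg_cong2[of _ _ _ _ "(*)"] ex) simp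
      also have "\<dots> = (\<Sum>k<?n. \<Sum>i<?n. ?\<pi> g $$ (i, k) * ?\<pi> h $$ (k, j) * e i x)"
        by (simp add: sum_distrib_left algebra_simps)
      also have "\<dots> = (\<Sum>i<?n. (\<Sum>k<?n. ?\<pi> g $$ (i, k) * ?\<pi> h $$ (k, j)) * e i x)"
        by (subst sum.swap) (simp add: sum_distrib_right)
      finally show ?thesis .
    qed
    have "?\<pi> (g + h) $$ (i, j) = (\<Sum>k<?n. ?\<pi> g $$ (i, k) * ?\<pi> h $$ (k, j))"
      by (rule comb_unique[OF on trans[OF ex[OF ij(2), symmetric] eq] ij(1)])
    then show "?\<pi> (g + h) $$ (i, j) = (?\<pi> g * ?\<pi> h) $$ (i, j)"
      using ij car[of g] car[of h] by (auto simp: scalar_prod_def atLeast0LessThan)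
  qed (auto simp: rep_of_def)
  moreover have "cont (\<lambda>g. ?\<pi> g $$ (i, j))" if "i < ?n" "j < ?n" for i j
  proof -
    have "continuous_on UNIV (\<lambda>(g, x). e j (- g + x) * cnj (e i x))"
      unfolding case_prod_unfold
      by (intro continuous_intros cont_comp[OF ce[OF that(1)]] cont_comp[OF ce[OF that(2)]])
    from continuous_haar_integral[OF this] show ?thesis using that by (simp add: rep_of_def ip_def)
  qed
  ultimately show ?thesis using car by (auto simp: unitary_rep_def)
qed

text \<open>A \<open>W\<close> invariant under the matrices corresponds to a left-invariant space
  \<open>?S\<close> of functions inside \<open>S\<close>. If \<open>W\<close> is nonzero, minimality
  forces equal dimensions, so a longest system of \<open>?S\<close> is one of \<open>S\<close> too,
  and expanding in it gives \<open>?S = S\<close>.\<close>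

lemma rep_of_irreducible:
  assumes p: "cont p" and S: "S \<subseteq> fixed_by p" "func_subspace S" "left_invariant S" and e: "orthonormal_in S (func_dim S) e"
    and pos: "0 < func_dim S"
    and min: "\<And>S'. S' \<subseteq> S \<Longrightarrow> func_subspace S' \<Longrightarrow> left_invariant S' \<Longrightarrow> \<exists>u\<in>S'. u \<noteq> (\<lambda>_. 0) \<Longrightarrow> func_dim S \<le> func_dim S'"
  shows "irreducible_unitary_rep (func_dim S) (rep_of (func_dim S) e)"
  unfolding irreducible_unitary_rep_def
proof (intro conjI allI impI pos)
  let ?n = "func_dim S"
  let ?\<pi> = "rep_of ?n e"
  show "unitary_rep ?n ?\<pi>" by (rule rep_of_unitary[OF p S e])
  have on: "orthonormal ?n e" using e by (simp add: orthonormal_in_def)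
  have car: "?\<pi> g \<in> carrier_mat ?n ?n" for g by (simp add: rep_of_def)
  fix W assume W: "vec_subspace ?n W \<and> (\<forall>g. \<forall>w\<in>W. ?\<pi> g *\<^sub>v w \<in> W)"
  then have Wc: "w \<in> carrier_vec ?n" if "w \<in> W" for w using that by (auto simp: vec_subspace_def)
  let ?F = "\<lambda>w x. \<Sum>i<?n. w $ i * e i x"
  let ?S = "?F ` W"
  have FS: "?F w \<in> S" for w by (rule func_subspace_sum[OF S(2)]) (use e in \<open>auto simp: orthonormal_in_def\<close>)
  have sub: "?S \<subseteq> S" using FS by blast
  have Finj: "v = w" if "v \<in> carrier_vec ?n" "w \<in> carrier_vec ?n" "?F v = ?F w" for v w
  proof (rule eq_vecI)
    fix i assume "i < dim_vec w"
    then have "i < ?n" using that by simp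
    then show "v $ i = w $ i" by (rule comb_unique[OF on fun_cong[OF that(3)]])
  qed (use that in simp)
  have fs: "func_subspace ?S"
    unfolding func_subspace_def
  proof (intro conjI ballI allI)
    have "?F (0\<^sub>v ?n) = (\<lambda>_. 0)" by (rule ext) simp
    from this[symmetric] show "(\<lambda>_. 0) \<in> ?S" by (rule image_eqI) (use W in \<open>simp add: vec_subspace_def\<close>)
  next
    fix u v assume "u \<in> ?S" "v \<in> ?S"
    then obtain a b where ab: "a \<in> W" "b \<in> W" "u = ?F a" "v = ?F b" by blast
    have "?F (a + b) = (\<lambda>x. u x + v x)"
    proof
      fix x
      have "?F (a + b) x = (\<Sum>i<?n. a $ i * e i x + b $ i * e i x)"
        using Wc[OF ab(1)] Wc[OF ab(2)] by (intro sum.cong refl) (simp add: distrib_right)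
      then show "?F (a + b) x = u x + v x" by (simp only: ab sum.distrib)
    qed
    from this[symmetric] show "(\<lambda>x. u x + v x) \<in> ?S"
      by (rule image_eqI) (use W ab in \<open>simp add: vec_subspace_def\<close>)
  next
    fix c u assume "u \<in> ?S"
    then obtain a where a: "a \<in> W" "u = ?F a" by blast
    have "?F (c \<cdot>\<^sub>v a) = (\<lambda>x. c * u x)"
    proof
      fix x
      have "?F (c \<cdot>\<^sub>v a) x = (\<Sum>i<?n. c * (a $ i * e i x))"
        using Wc[OF a(1)] by (intro sum.cong refl) simp
      then show "?F (c \<cdot>\<^sub>v a) x = c * u x" by (simp only: a sum_distrib_left)
    qed
    from this[symmetric] show "(\<lambda>x. c * u x) \<in> ?S"
      by (rule image_eqI) (use W a in \<open>simp add: vec_subspace_def\<close>)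
  qed
  have li: "left_invariant ?S"
    unfolding left_invariant_def
  proof (intro allI ballI)
    fix a u assume "u \<in> ?S"
    then obtain w where w: "w \<in> W" "u = ?F w" by blast
    have "u (a + x) = ?F (?\<pi> (- a) *\<^sub>v w) x" for x
    proof -
      have "u (a + x) = (\<Sum>j<?n. w $ j * e j (- (- a) + x))" by (simp add: w)
      also have "\<dots> = (\<Sum>j<?n. w $ j * (\<Sum>i<?n. ?\<pi> (- a) $$ (i, j) * e i x))"
        by (intro sum.cong refl arg_cong2[of _ _ _ _ "(*)"] rep_of_expand[OF p S e]) simp
      also have "\<dots> = (\<Sum>j<?n. \<Sum>i<?n. ?\<pi> (- a) $$ (i, j) * w $ j * e i x)"
        by (simp add: sum_distrib_left algebra_simps)
      also have "\<dots> = (\<Sum>i<?n. (\<Sum>j<?n. ?\<pi> (- a) $$ (i, j) * w $ j) * e i x)"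
        by (subst sum.swap) (simp add: sum_distrib_right)
      also have "\<dots> = ?F (?\<pi> (- a) *\<^sub>v w) x"
        using car[of "- a"] Wc[OF w(1)]
        by (intro sum.cong refl) (auto simp: scalar_prod_def atLeast0LessThan)
      finally show ?thesis .
    qed
    then have "(\<lambda>x. u (a + x)) = ?F (?\<pi> (- a) *\<^sub>v w)" by (rule ext)
    then show "(\<lambda>x. u (a + x)) \<in> ?S" by (rule image_eqI) (use W w(1) in simp)
  qed
  show "W = {0\<^sub>v ?n} \<or> W = carrier_vec ?n"
  proof (cases "\<exists>w\<in>W. w \<noteq> 0\<^sub>v ?n")
    case False
    then show ?thesis using W by (auto simp: vec_subspace_def)
  next
    case True
    then obtain w where w: "w \<in> W" "w \<noteq> 0\<^sub>v ?n" by blast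
    have "?F w \<noteq> ?F (0\<^sub>v ?n)" using Finj[OF Wc[OF w(1)] zero_carrier_vec] w(2) by blast
    moreover have "?F (0\<^sub>v ?n) = (\<lambda>_. 0)" by (rule ext) simp
    ultimately have "?F w \<noteq> (\<lambda>_. 0)" by simp
    then have "func_dim S \<le> func_dim ?S" using w(1) by (intro min[OF sub fs li]) blast
    moreover obtain e' where e': "orthonormal_in ?S (func_dim ?S) e'"
      using func_dim(1)[OF p, of ?S] sub S(1) by blast
    then have e'S: "orthonormal_in S (func_dim ?S) e'" using sub by (auto simp: orthonormal_in_def)
    ultimately have eq: "func_dim ?S = ?n" using func_dim(2)[OF p S(1) e'S] by simp
    have "S \<subseteq> ?S"
    proof
      fix h assume h: "h \<in> S"
      have "h = (\<lambda>x. \<Sum>i<?n. ip h (e' i) * e' i x)"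
        using orthonormal_in_expand[OF p S(1,2) _ h, of e'] e'S eq by simp
      moreover have "(\<lambda>x. \<Sum>i<?n. ip h (e' i) * e' i x) \<in> ?S"
        by (rule func_subspace_sum[OF fs]) (use e' eq in \<open>auto simp: orthonormal_in_def\<close>)
      ultimately show "h \<in> ?S" by metis
    qed
    then have "v \<in> W" if "v \<in> carrier_vec ?n" for v
      using FS[of v] Finj[OF that Wc] by blast
    then show ?thesis using Wc by blast
  qed
qed

lemma coef_free_imp_zero:
  assumes f: "cont f" and M: "coef_free f"
  shows "f a = 0"
proof (rule ccontr)
  assume a: "f a \<noteq> 0"
  \<comment> \<open>This product is self-adjoint and still has vanishing coefficients; its value at
    0 is the squared norm of \<open>adj f\<close>, so it is not zero.\<close>
  let ?k = "adj f \<star> f"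
  have k: "cont ?k" "adj ?k = ?k" "coef_free ?k"
    using f M by (auto simp: adj_conv cont_adj cont_conv intro!: coef_free_conv)
  have "adj f (- a) \<noteq> 0" using a by (simp add: adj_def)
  then have "sqnorm (adj f) > 0" using sqnorm_pos[OF cont_adj[OF f]] by blast
  then have "?k 0 \<noteq> 0" by (simp add: conv_zero ip_self cont_adj f)
  from projection_exists[OF k this]
  obtain p where p: "cont p" "adj p = p" "p \<star> p = p" "coef_free p" "p 0 \<noteq> 0" by blast
  let ?E = "fixed_by p"
  define good where "good S \<longleftrightarrow> S \<subseteq> ?E \<and> func_subspace S \<and> left_invariant S \<and> (\<exists>u\<in>S. u \<noteq> (\<lambda>_. 0))" for S
  have "func_subspace ?E"
    unfolding func_subspace_def fixed_by_def
  proof (intro conjI ballI allI CollectI)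
    fix u v assume "u \<in> {h. cont h \<and> h \<star> p = h}" "v \<in> {h. cont h \<and> h \<star> p = h}"
    then have uv: "cont u" "cont v" "u \<star> p = u" "v \<star> p = v" by auto
    show "cont (\<lambda>x. u x + v x)" by (intro continuous_intros uv)
    have "cont (\<lambda>x. - v x)" "(\<lambda>x. - v x) \<star> p = (\<lambda>x. - v x)"
      using conv_scale_left[OF uv(2) p(1), of "-1"] uv by (auto intro!: continuous_intros)
    then show "(\<lambda>x. u x + v x) \<star> p = (\<lambda>x. u x + v x)"
      using conv_diff_left[OF uv(1) _ p(1), of "\<lambda>x. - v x"] uv by (intro ext) simp
  qed (auto intro!: continuous_intros simp: conv_scale_left p conv_def[of "\<lambda>_. 0"])
  moreover have "left_invariant ?E"
    unfolding left_invariant_def fixed_by_def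
    by (auto intro!: continuous_translate ext simp: conv_left_translate p)
  ultimately have "good ?E" unfolding good_def using p by (auto simp: fixed_by_def intro!: bexI[of _ p])
  then obtain S where S: "good S" and min: "\<And>S'. good S' \<Longrightarrow> func_dim S \<le> func_dim S'"
    using ex_has_least_nat[of good ?E func_dim] by blast
  then have S': "S \<subseteq> ?E" "func_subspace S" "left_invariant S" "\<exists>u\<in>S. u \<noteq> (\<lambda>_. 0)" by (auto simp: good_def)
  let ?n = "func_dim S"
  obtain e where e: "orthonormal_in S ?n e" using func_dim(1)[OF p(1) S'(1)] by blast
  have on: "orthonormal ?n e" using e by (simp add: orthonormal_in_def)
  have pos: "0 < ?n"
  proof (rule ccontr)
    assume "\<not> 0 < ?n"
    then have "u = (\<lambda>_. 0)" if "u \<in> S" for u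
      using orthonormal_in_expand[OF p(1) S'(1,2) e that] by simp
    then show False using S'(4) by blast
  qed
  have irr: "irreducible_unitary_rep ?n (rep_of ?n e)"
    by (rule rep_of_irreducible[OF p(1) S'(1,2,3) e pos], rule min)
      (use S' in \<open>auto simp: good_def\<close>)
  let ?\<pi> = "rep_of ?n e"
  have e0: "cont (e 0)" "e 0 \<star> p = e 0"
    using e pos S'(1) by (auto simp: orthonormal_in_def fixed_by_def)
  \<comment> \<open>\<open>e 0 = e 0 \<star> p\<close> lies in the ideal generated by
    \<open>p\<close>, so its coefficients vanish along with those of \<open>p\<close>.\<close>
  have free: "coef_free (e 0)"
    using coef_free_conv[of "e 0" p] e0 p by simp
  have cpi: "cont (\<lambda>g. ?\<pi> g $$ (i, j))" if "i < ?n" "j < ?n" for i j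
    using irr that by (intro rep_cont) (auto simp: irreducible_unitary_rep_def)
  \<comment> \<open>Evaluating at the neutral element turns the expansion of a translate into a
    formula for the function itself: \<open>e 0\<close> is a combination of conjugated matrix
    entries with the constants \<open>e i 0\<close>. It is therefore orthogonal to itself.\<close>
  have "e 0 g = (\<Sum>i<?n. e i 0 * cnj (?\<pi> g $$ (0, i)))" for g
  proof -
    have "e 0 g = e 0 (- (- g) + 0)" by simp
    also have "\<dots> = (\<Sum>i<?n. ?\<pi> (- g) $$ (i, 0) * e i 0)"
      by (rule rep_of_expand[OF p(1) S'(1,2,3) e pos])
    also have "\<dots> = (\<Sum>i<?n. e i 0 * cnj (?\<pi> g $$ (0, i)))"
      by (intro sum.cong refl) (simp add: rep_of_inverse[OF on _ pos])
    finally show ?thesis .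
  qed
  then have "ip (e 0) (e 0) = ip (e 0) (\<lambda>g. \<Sum>i<?n. e i 0 * cnj (?\<pi> g $$ (0, i)))"
    by (metis (no_types, lifting) ext)
  also have "\<dots> = (\<Sum>i<?n. ip (e 0) (\<lambda>g. e i 0 * cnj (?\<pi> g $$ (0, i))))"
    by (rule ip_sum_right) (auto intro!: continuous_intros e0 cpi pos)
  also have "\<dots> = (\<Sum>i<?n. cnj (e i 0) * coef (e 0) ?\<pi> 0 i)"
    unfolding coef_eq_ip
    by (intro sum.cong refl ip_scale_right) (auto intro!: continuous_intros e0 cpi pos)
  also have "\<dots> = 0"
    using coef_freeD[OF free irr pos] by (intro sum.neutral) auto
  finally show False using on pos by (simp add: orthonormal_def)
qed

end

section \<open>The Peter--Weyl theorem\<close>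

context compact_haar
begin

lemma sqnorm_parallelogram:
  assumes a: "cont a" and b: "cont b"
  shows "sqnorm (\<lambda>x. a x - b x) + sqnorm (\<lambda>x. a x + b x) = 2 * sqnorm a + 2 * sqnorm b"
proof -
  have id: "(cmod (a x - b x))\<^sup>2 + (cmod (a x + b x))\<^sup>2 = 2 * (cmod (a x))\<^sup>2 + 2 * (cmod (b x))\<^sup>2" for x
    unfolding cmod_power2 by (simp add: power2_eq_square algebra_simps)
  have "sqnorm (\<lambda>x. a x - b x) + sqnorm (\<lambda>x. a x + b x)
      = haar_integral (\<lambda>x. (cmod (a x - b x))\<^sup>2 + (cmod (a x + b x))\<^sup>2)"
    unfolding sqnorm_def by (rule haar_integral_add[symmetric]) (intro continuous_intros a b)+
  also have "\<dots> = haar_integral (\<lambda>x. 2 * (cmod (a x))\<^sup>2) + haar_integral (\<lambda>x. 2 * (cmod (b x))\<^sup>2)"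
    unfolding id by (rule haar_integral_add) (intro continuous_intros a b)+
  also have "haar_integral (\<lambda>x. 2 * (cmod (a x))\<^sup>2) = 2 * sqnorm a"
    unfolding sqnorm_def by (rule haar_integral_linear[OF bounded_linear_mult_right cont_sqnorm[OF a]])
  also have "haar_integral (\<lambda>x. 2 * (cmod (b x))\<^sup>2) = 2 * sqnorm b"
    unfolding sqnorm_def by (rule haar_integral_linear[OF bounded_linear_mult_right cont_sqnorm[OF b]])
  finally show ?thesis .
qed

text \<open>The span of the conjugated matrix entries, built one term at a time because the terms
  belong to representations of different dimensions. Conjugation matches the kernels of the Fourier
  components, whose vanishing extends to the span by induction.\<close>

inductive_set matrix_matrix_coefs :: "('g \<Rightarrow> complex) set" where
  matrix_matrix_coefs_zero: "(\<lambda>_. 0) \<in> matrix_matrix_coefs"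
| matrix_matrix_coefs_add: "c \<in> matrix_matrix_coefs \<Longrightarrow> irreducible_unitary_rep n \<pi> \<Longrightarrow> i < n \<Longrightarrow> j < n
    \<Longrightarrow> (\<lambda>x. c x + a * cnj (\<pi> x $$ (i, j))) \<in> matrix_matrix_coefs"

lemma cont_entry:
  "irreducible_unitary_rep n \<pi> \<Longrightarrow> i < n \<Longrightarrow> j < n \<Longrightarrow> cont (\<lambda>x. cnj (\<pi> x $$ (i, j)))"
  by (intro continuous_on_cnj rep_cont) (auto simp: irreducible_unitary_rep_def)

lemma matrix_matrix_coefs_cont: "c \<in> matrix_matrix_coefs \<Longrightarrow> cont c"
  by (induction rule: matrix_matrix_coefs.induct) (auto intro!: continuous_on_add continuous_on_mult_left cont_entry)

lemma matrix_matrix_coefs_plus: "v \<in> matrix_matrix_coefs \<Longrightarrow> u \<in> matrix_matrix_coefs \<Longrightarrow> (\<lambda>x. u x + v x) \<in> matrix_matrix_coefs"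
proof (induction rule: matrix_matrix_coefs.induct)
  case (matrix_matrix_coefs_add c n \<pi> i j a)
  then have "(\<lambda>x. (u x + c x) + a * cnj (\<pi> x $$ (i, j))) \<in> matrix_matrix_coefs"
    by (intro matrix_matrix_coefs.matrix_matrix_coefs_add) auto
  then show ?case by (simp add: add.assoc)
qed simp

lemma matrix_matrix_coefs_scale: "u \<in> matrix_matrix_coefs \<Longrightarrow> (\<lambda>x. b * u x) \<in> matrix_matrix_coefs"
proof (induction rule: matrix_matrix_coefs.induct)
  case (matrix_matrix_coefs_add c n \<pi> i j a)
  then have "(\<lambda>x. b * c x + (b * a) * cnj (\<pi> x $$ (i, j))) \<in> matrix_matrix_coefs"
    by (intro matrix_matrix_coefs.matrix_matrix_coefs_add) auto
  then show ?case by (simp add: distrib_left mult.assoc)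
qed (simp add: matrix_matrix_coefs_zero)

lemma matrix_matrix_coefs_entry:
  "irreducible_unitary_rep n \<pi> \<Longrightarrow> i < n \<Longrightarrow> j < n \<Longrightarrow> (\<lambda>x. cnj (\<pi> x $$ (i, j))) \<in> matrix_matrix_coefs"
  using matrix_matrix_coefs_add[OF matrix_matrix_coefs_zero, of n \<pi> i j 1] by simp

lemma func_subspace_matrix_coefs: "func_subspace matrix_matrix_coefs"
  by (simp add: func_subspace_def matrix_matrix_coefs_zero matrix_matrix_coefs_plus matrix_matrix_coefs_scale)

text \<open>Splitting \<open>\<pi> (- y + x)\<close> shows that convolution from the left maps an
  entry into the span of its own column; hence the span of all entries is a left ideal.\<close>

lemma conv_entry:
  assumes v: "cont v" and \<pi>: "irreducible_unitary_rep n \<pi>" and ij: "i < n" "j < n"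
  shows "v \<star> (\<lambda>x. cnj (\<pi> x $$ (i, j)))
    = (\<lambda>x. \<Sum>k<n. haar_integral (\<lambda>y. v y * cnj (\<pi> (- y) $$ (i, k))) * cnj (\<pi> x $$ (k, j)))"
proof
  fix x
  have u: "unitary_rep n \<pi>" using \<pi> by (simp add: irreducible_unitary_rep_def)
  have c: "cont (\<lambda>y. v y * cnj (\<pi> (- y) $$ (i, k)))" if "k < n" for k
    by (intro continuous_intros v cont_comp[OF rep_cont[OF u ij(1) that]])
  have "(v \<star> (\<lambda>x. cnj (\<pi> x $$ (i, j)))) x
      = haar_integral (\<lambda>y. \<Sum>k<n. v y * cnj (\<pi> (- y) $$ (i, k)) * cnj (\<pi> x $$ (k, j)))"
    unfolding conv_def by (simp add: rep_entry[OF u ij] sum_distrib_left mult.assoc)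
  also have "\<dots> = (\<Sum>k<n. haar_integral (\<lambda>y. v y * cnj (\<pi> (- y) $$ (i, k)) * cnj (\<pi> x $$ (k, j))))"
    by (rule haar_integral_sum) (auto intro!: continuous_on_mult_right c)
  also have "\<dots> = (\<Sum>k<n. haar_integral (\<lambda>y. v y * cnj (\<pi> (- y) $$ (i, k))) * cnj (\<pi> x $$ (k, j)))"
    by (intro sum.cong refl haar_integral_multc c) simp
  finally show "(v \<star> (\<lambda>x. cnj (\<pi> x $$ (i, j)))) x
      = (\<Sum>k<n. haar_integral (\<lambda>y. v y * cnj (\<pi> (- y) $$ (i, k))) * cnj (\<pi> x $$ (k, j)))" .
qed

lemma conv_matrix_coefs:
  assumes v: "cont v"
  shows "c \<in> matrix_matrix_coefs \<Longrightarrow> v \<star> c \<in> matrix_matrix_coefs"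
proof (induction rule: matrix_matrix_coefs.induct)
  case matrix_matrix_coefs_zero
  then show ?case by (simp add: conv_def[abs_def] matrix_matrix_coefs.matrix_matrix_coefs_zero)
next
  case (matrix_matrix_coefs_add c n \<pi> i j a)
  let ?w = "\<lambda>x. cnj (\<pi> x $$ (i, j))"
  have c: "cont c" and w: "cont ?w" using matrix_matrix_coefs_add by (auto intro: matrix_matrix_coefs_cont cont_entry)
  have "v \<star> ?w \<in> matrix_matrix_coefs"
    unfolding conv_entry[OF v matrix_matrix_coefs_add(2,3,4)]
    by (rule func_subspace_sum[OF func_subspace_matrix_coefs]) (use matrix_matrix_coefs_add in \<open>auto intro: matrix_matrix_coefs_entry\<close>)
  then have "(\<lambda>x. (v \<star> c) x + a * (v \<star> ?w) x) \<in> matrix_matrix_coefs"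
    using matrix_matrix_coefs_add by (intro matrix_matrix_coefs_plus matrix_matrix_coefs_scale)
  moreover have "(v \<star> (\<lambda>x. c x + a * ?w x)) x = (v \<star> c) x + a * (v \<star> ?w) x" for x
    using conv_diff_right[of c "\<lambda>x. (- a) * ?w x" v x] c w v
    by (simp only: conv_scale_right continuous_on_mult_left) simp
  ultimately show ?case by (metis (no_types, lifting) ext)
qed

section \<open>Approximation by matrix coefficients\<close>

lemma coef_tendsto_0:
  assumes f: "\<And>k. cont (f k)" and lim: "(\<lambda>k. sqnorm (f k)) \<longlonglongrightarrow> 0"
    and \<pi>: "irreducible_unitary_rep n \<pi>" and ij: "i < n" "j < n"
  shows "(\<lambda>k. coef (f k) \<pi> i j) \<longlonglongrightarrow> 0"
proof (rule Lim_null_comparison[OF always_eventually[OF allI]])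
  let ?w = "\<lambda>x. cnj (\<pi> x $$ (i, j))"
  show "cmod (coef (f k) \<pi> i j) \<le> sqrt (sqnorm (f k) * sqnorm ?w)" for k
    unfolding coef_eq_ip by (rule real_le_rsqrt, rule cauchy_schwarz[OF f cont_entry[OF \<pi> ij]])
  have "(\<lambda>k. sqrt (sqnorm (f k) * sqnorm ?w)) \<longlonglongrightarrow> sqrt (0 * sqnorm ?w)" by (intro tendsto_intros lim)
  then show "(\<lambda>k. sqrt (sqnorm (f k) * sqnorm ?w)) \<longlonglongrightarrow> 0" by simp
qed

text \<open>The best multiple of \<open>w\<close>, with factor \<open>ip a w / sqnorm w\<close>,
  lowers the squared norm of \<open>a\<close> by |\<open>ip a w\<close>|^2 /
  \<open>sqnorm w\<close>, and the result cannot fall below \<open>d\<close>. So nearly minimal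
  remainders are nearly orthogonal to the span.\<close>

lemma ip_near_minimal:
  assumes a: "cont a" and w: "cont w" and d: "\<And>t. d \<le> sqnorm (\<lambda>x. a x - t * w x)"
  shows "(cmod (ip a w))\<^sup>2 \<le> (sqnorm a - d) * sqnorm w"
proof (cases "sqnorm w > 0")
  case False
  then have "sqnorm w = 0" using sqnorm_nonneg[OF w] by simp
  then show ?thesis using cauchy_schwarz[OF a w] by simp
next
  case True
  define t where "t = ip a w / complex_of_real (sqnorm w)"
  have tw: "cont (\<lambda>x. t * w x)" by (intro continuous_intros w)
  have "cnj t * ip a w = complex_of_real ((cmod (ip a w))\<^sup>2 / sqnorm w)"
    by (simp add: t_def mult.commute flip: complex_norm_square)
  then have "Re (ip a (\<lambda>x. t * w x)) = (cmod (ip a w))\<^sup>2 / sqnorm w"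
    by (simp only: ip_scale_right[OF w a] Re_complex_of_real)
  moreover have "sqnorm (\<lambda>x. t * w x) = (cmod (ip a w))\<^sup>2 / sqnorm w"
    unfolding sqnorm_scale[OF w] t_def using True by (simp add: norm_divide power_divide power2_eq_square)
  ultimately have "d \<le> sqnorm a - (cmod (ip a w))\<^sup>2 / sqnorm w"
    using d[of t] by (simp add: sqnorm_diff[OF a tw])
  then have "(cmod (ip a w))\<^sup>2 / sqnorm w \<le> sqnorm a - d" by simp
  then show ?thesis using True by (simp add: pos_divide_le_eq)
qed

text \<open>Since the square-integrable functions are not available as a Hilbert space, the projection of
  \<open>u\<close> onto the closed span of the matrix coefficients is replaced by a minimising sequence, which
  convolution with \<open>v\<close> turns into a uniformly convergent one.\<close>

theorem peter_weyl:
  assumes v: "cont v" and u: "cont u"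
  shows "\<exists>c. (\<forall>n. c n \<in> matrix_matrix_coefs) \<and> uniform_limit UNIV c (v \<star> u) sequentially"
proof -
  define d where "d = Inf ((\<lambda>c. sqnorm (\<lambda>x. u x - c x)) ` matrix_matrix_coefs)"
  have bdd: "bdd_below ((\<lambda>c. sqnorm (\<lambda>x. u x - c x)) ` matrix_matrix_coefs)"
    by (rule bdd_belowI[of _ 0]) (auto intro!: sqnorm_nonneg continuous_on_diff u intro: matrix_matrix_coefs_cont)
  have d: "d \<le> sqnorm (\<lambda>x. u x - c x)" if "c \<in> matrix_matrix_coefs" for c
    unfolding d_def by (rule cInf_lower[OF _ bdd]) (use that in blast)
  have "\<exists>c\<in>matrix_matrix_coefs. sqnorm (\<lambda>x. u x - c x) < d + inverse (real (Suc n))" for n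
  proof -
    have "Inf ((\<lambda>c. sqnorm (\<lambda>x. u x - c x)) ` matrix_matrix_coefs) < d + inverse (real (Suc n))"
      unfolding d_def by simp
    then show ?thesis
      using cInf_lessD[of "(\<lambda>c. sqnorm (\<lambda>x. u x - c x)) ` matrix_matrix_coefs"] matrix_matrix_coefs_zero by blast
  qed
  then obtain c where c: "\<And>n. c n \<in> matrix_matrix_coefs"
      "\<And>n. sqnorm (\<lambda>x. u x - c n x) < d + inverse (real (Suc n))"
    by metis
  have cc: "cont (c n)" for n using c(1) by (rule matrix_matrix_coefs_cont)
  have cd: "cont (\<lambda>x. u x - c n x)" for n by (intro continuous_intros u cc)
  have close: "sqnorm (\<lambda>x. c m x - c n x) < 2 * inverse (real (Suc m)) + 2 * inverse (real (Suc n))" for m n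
  proof -
    \<comment> \<open>Twice the remainder at the midpoint of \<open>c m\<close> and
      \<open>c n\<close>, which is again in the span. Its squared norm is thus at least 4 d, and the
      parallelogram identity bounds the distance of \<open>c m\<close> and
      \<open>c n\<close>.\<close>
    let ?s = "\<lambda>x. (u x - c n x) + (u x - c m x)"
    have cs: "cont ?s" by (intro continuous_intros cd)
    have "(\<lambda>x. (1/2) * (c n x + c m x)) \<in> matrix_matrix_coefs" by (intro matrix_matrix_coefs_scale matrix_matrix_coefs_plus c)
    from d[OF this] have "d \<le> sqnorm (\<lambda>x. u x - (1/2) * (c n x + c m x))" .
    also have "(\<lambda>x. u x - (1/2) * (c n x + c m x)) = (\<lambda>x. (1/2) * ?s x)"
      by (rule ext) (simp add: field_simps)
    also have "sqnorm \<dots> = (cmod (1/2))\<^sup>2 * sqnorm ?s" by (rule sqnorm_scale[OF cs])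
    finally have "4 * d \<le> sqnorm ?s" by (simp add: power2_eq_square)
    moreover have "(\<lambda>x. (u x - c n x) - (u x - c m x)) = (\<lambda>x. c m x - c n x)" by (rule ext) simp
    ultimately show ?thesis
      using sqnorm_parallelogram[OF cd cd, of n m] c(2)[of m] c(2)[of n] by simp
  qed
  have "\<exists>N. \<forall>m\<ge>N. \<forall>n\<ge>N. sqnorm (\<lambda>x. c m x - c n x) < e" if "e > 0" for e
  proof -
    obtain N where N: "inverse (real (Suc N)) < e / 4" using reals_Archimedean[of "e/4"] \<open>e > 0\<close> by auto
    have "sqnorm (\<lambda>x. c m x - c n x) < e" if "m \<ge> N" "n \<ge> N" for m n
    proof -
      have "inverse (real (Suc m)) \<le> inverse (real (Suc N))" "inverse (real (Suc n)) \<le> inverse (real (Suc N))"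
        using that by (auto intro!: le_imp_inverse_le)
      then show ?thesis using close[of m n] N by linarith
    qed
    then show ?thesis by blast
  qed
  from conv_Cauchy_limit[OF v cc this]
  obtain q where q: "cont q" and lim: "uniform_limit UNIV (\<lambda>n. v \<star> c n) q sequentially" by blast
  let ?r = "\<lambda>x. (v \<star> u) x - q x"
  have cr: "cont ?r" by (intro continuous_intros u v q)
  \<comment> \<open>For every m, \<open>?r\<close> is the sum of \<open>v \<star> (u - c m)\<close>
    and \<open>v \<star> c m - q\<close>. The coefficients of the first tend to zero by
    near-minimality, those of the second by uniform convergence, while the sum does not depend on
    m.\<close>
  have "coef_free ?r"
    unfolding coef_free_def
  proof (intro allI impI)
    fix n i j and \<pi> :: "'g \<Rightarrow> complex mat"
    assume irr: "irreducible_unitary_rep n \<pi>" and ij: "i < n" "j < n"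
    then have un: "unitary_rep n \<pi>" by (simp add: irreducible_unitary_rep_def)
    have null: "(\<lambda>m. coef (\<lambda>x. u x - c m x) \<pi> k j) \<longlonglongrightarrow> 0" if k: "k < n" for k
    proof -
      let ?w = "\<lambda>x. cnj (\<pi> x $$ (k, j))"
      have w: "cont ?w" by (rule cont_entry[OF irr k ij(2)])
      have est: "cmod (coef (\<lambda>x. u x - c m x) \<pi> k j) \<le> sqrt (inverse (real (Suc m)) * sqnorm ?w)" for m
        unfolding coef_eq_ip
      proof (rule real_le_rsqrt, rule order_trans[OF ip_near_minimal[OF cd w, of d]])
        show "d \<le> sqnorm (\<lambda>x. u x - c m x - t * ?w x)" for t
          using d[OF matrix_matrix_coefs_add[OF c(1) irr k ij(2), of m t]] by (simp add: algebra_simps)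
        show "(sqnorm (\<lambda>x. u x - c m x) - d) * sqnorm ?w \<le> inverse (real (Suc m)) * sqnorm ?w"
          using c(2)[of m] sqnorm_nonneg[OF w] by (intro mult_right_mono) auto
      qed
      have "(\<lambda>m. sqrt (inverse (real (Suc m)) * sqnorm ?w)) \<longlonglongrightarrow> sqrt (0 * sqnorm ?w)"
        by (intro tendsto_intros LIMSEQ_inverse_real_of_nat)
      then show ?thesis
        by (intro Lim_null_comparison[OF always_eventually[OF allI[OF est]]]) simp
    qed
    have "(\<lambda>m. coef (v \<star> (\<lambda>x. u x - c m x)) \<pi> i j) \<longlonglongrightarrow> (\<Sum>k<n. coef v \<pi> i k * 0)"
      unfolding coef_conv[OF un ij v cd] by (intro tendsto_sum tendsto_mult tendsto_const null) simp
    moreover have "(\<lambda>m. coef (\<lambda>x. (v \<star> c m) x - q x) \<pi> i j) \<longlonglongrightarrow> 0"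
      by (rule coef_tendsto_0[OF _ uniform_limit_imp_sqnorm[OF _ q lim] irr ij])
        (intro continuous_intros v cc q)+
    ultimately have "(\<lambda>m. coef (v \<star> (\<lambda>x. u x - c m x)) \<pi> i j + coef (\<lambda>x. (v \<star> c m) x - q x) \<pi> i j) \<longlonglongrightarrow> 0"
      using tendsto_add by fastforce
    moreover have "coef (v \<star> (\<lambda>x. u x - c m x)) \<pi> i j + coef (\<lambda>x. (v \<star> c m) x - q x) \<pi> i j = coef ?r \<pi> i j" for m
    proof -
      have eq: "?r = (\<lambda>x. (v \<star> (\<lambda>x. u x - c m x)) x + ((v \<star> c m) x - q x))"
        by (rule ext) (simp add: conv_diff_right u v cc)
      show ?thesis
        unfolding coef_eq_ip eq
        by (rule ip_add[symmetric]) (intro continuous_on_diff cont_conv v u cc q cont_entry[OF irr ij])+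
    qed
    ultimately show "coef ?r \<pi> i j = 0" by (simp add: LIMSEQ_const_iff)
  qed
  then have "q = v \<star> u" using coef_free_imp_zero[OF cr] by (auto simp: fun_eq_iff)
  with lim show ?thesis using conv_matrix_coefs[OF v c(1)] by (intro exI[of _ "\<lambda>n. v \<star> c n"]) simp
qed

end

section \<open>Automorphisms of C*-algebras\<close>

lemma norm_star: "norm (star x) = norm (x :: 'a::cstar_algebra)"
proof -
  have le: "norm y \<le> norm (star y)" for y :: 'a
  proof (cases "y = 0")
    case False
    have "norm y * norm y \<le> norm (star y) * norm y"
      using cstar_identity[of y] norm_mult_ineq[of "star y" y] by (simp add: power2_eq_square)
    then show ?thesis using False by simp
  qed simp
  show ?thesis using le[of x] le[of "star x"] by (simp add: star_star)
qed

lemma star_one: "star (1 :: 'a::cstar_algebra) = 1"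
  using star_mult[of "star (1::'a)" 1] by (simp add: star_star)

lemma bounded_linear_star: "bounded_linear (star :: 'a::cstar_algebra \<Rightarrow> 'a)"
  by (rule bounded_linear_intro[where K = 1])
    (simp_all add: star_add scaleR_scaleC star_scaleC norm_star)

lemma bounded_bilinear_scaleC: "bounded_bilinear (scaleC :: complex \<Rightarrow> 'a::cstar_algebra \<Rightarrow> 'a)"
proof
  show "\<exists>K. \<forall>(a::complex) (b::'a). norm (a *\<^sub>C b) \<le> norm a * norm b * K"
    by (rule exI[of _ 1]) (simp add: norm_scaleC)
qed (simp_all add: scaleC_add_left scaleC_add_right scaleR_scaleC scaleC_scaleC scaleR_conv_of_real mult.commute)

lemmas bounded_linear_scaleC = bounded_bilinear.bounded_linear_right[OF bounded_bilinear_scaleC]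
lemmas continuous_on_scaleC [continuous_intros] =
  bounded_bilinear.continuous_on[OF bounded_bilinear_scaleC]

lemma star_sum: "star (\<Sum>i\<in>I. f i) = (\<Sum>i\<in>I. star (f i :: 'a::cstar_algebra))"
  using linear_sum[OF bounded_linear.linear[OF bounded_linear_star]] by blast

text \<open>The factor |1/2 - n| / (n + 1) in the recursion is at most 1. This crude bound is enough
  to dominate the binomial series by a geometric one.\<close>

lemma abs_gbinomial_half: "\<bar>(1/2 :: real) gchoose n\<bar> \<le> 1"
proof (induction n)
  case (Suc n)
  have "real (Suc n) * (1/2 gchoose Suc n) = (1/2 - real n) * (1/2 gchoose n)"
    using gbinomial_mult_1[of "1/2 :: real" n] by (simp add: algebra_simps)
  then have "real (Suc n) * \<bar>1/2 gchoose Suc n\<bar> = \<bar>1/2 - real n\<bar> * \<bar>1/2 gchoose n\<bar>"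
    by (metis abs_mult abs_of_nat)
  also have "\<dots> \<le> real (Suc n) * 1"
    using Suc by (intro mult_mono) auto
  finally show ?case by (simp del: of_nat_Suc)
qed simp

text \<open>\<open>suminf f\<close> is the binomial series for the square root of
  \<open>1 - b\<close>. In its Cauchy product, Vandermonde adds the exponents 1/2 and 1/2 to 1,
  whose binomial coefficients vanish beyond the linear term.\<close>

lemma sqrt_one_minus:
  fixes b :: "'a::{real_normed_algebra_1, banach}"
  assumes b: "norm b < 1"
  defines "f \<equiv> \<lambda>n. ((1/2 gchoose n) * (-1) ^ n) *\<^sub>R b ^ n"
  shows "summable f" and "suminf f * suminf f = 1 - b"
proof -
  have sn: "summable (\<lambda>n. norm (f n))"
  proof (rule summable_comparison_test'[of "\<lambda>n. norm b ^ n" 0])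
    show "summable (\<lambda>n. norm b ^ n)" using b by (simp add: summable_geometric)
    show "norm (norm (f n)) \<le> norm b ^ n" for n
    proof -
      have "norm (f n) = \<bar>1/2 gchoose n\<bar> * norm (b ^ n)" by (simp add: f_def abs_mult power_abs)
      also have "\<dots> \<le> 1 * norm b ^ n"
        by (intro mult_mono abs_gbinomial_half norm_power_ineq) auto
      finally show ?thesis by simp
    qed
  qed
  then show "summable f" by (rule summable_norm_cancel)
  have cauchy: "(\<Sum>i\<le>n. f i * f (n - i)) = ((1 gchoose n) * (-1) ^ n) *\<^sub>R b ^ n" for n
  proof -
    have "f i * f (n - i) = ((1/2 gchoose i) * (1/2 gchoose (n - i)) * (-1) ^ n) *\<^sub>R b ^ n" if "i \<le> n" for i
    proof -
      have "(-1 :: real) ^ (n - i) * (-1) ^ i = (-1) ^ n" "b ^ i * b ^ (n - i) = b ^ n"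
        using that by (simp_all add: power_add[symmetric])
      then show ?thesis by (simp add: f_def mult.assoc mult.left_commute)
    qed
    then have "(\<Sum>i\<le>n. f i * f (n - i))
        = ((\<Sum>i\<in>{0..n}. (1/2 gchoose i) * (1/2 gchoose (n - i))) * (-1) ^ n) *\<^sub>R b ^ n"
      by (simp add: scaleR_sum_left sum_distrib_right atLeast0AtMost)
    then show ?thesis using gbinomial_Vandermonde[of "1/2 :: real" "1/2" n] by simp
  qed
  have g: "(1 :: real) gchoose n = of_nat (1 choose n)" for n
    using binomial_gbinomial[of 1 n, where 'a = real] by simp
  have "suminf f * suminf f = (\<Sum>n. ((1 gchoose n) * (-1) ^ n) *\<^sub>R b ^ n)"
    using Cauchy_product[OF sn sn] by (simp only: cauchy)
  also have "\<dots> = (\<Sum>n\<in>{0, 1}. ((1 gchoose n) * (-1) ^ n) *\<^sub>R b ^ n)"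
    by (rule suminf_finite) (auto simp: g binomial_eq_0_iff)
  also have "\<dots> = 1 - b" by (simp add: g)
  finally show "suminf f * suminf f = 1 - b" .
qed

text \<open>A real power series in the square of \<open>a\<close> is self-adjoint and commutes with
  \<open>a\<close>. The resulting c makes a + \<i> c unitary in
  \<open>star_automorphism_contractive\<close>.\<close>

lemma selfadjoint_complement_sqrt:
  fixes a :: "'a::cstar_algebra"
  assumes a: "star a = a" "norm a < 1"
  shows "\<exists>c. star c = c \<and> a * c = c * a \<and> c * c = 1 - a * a"
proof -
  let ?f = "\<lambda>n. ((1/2 gchoose n) * (-1) ^ n) *\<^sub>R (a * a) ^ n"
  have "norm (a * a) \<le> norm a * norm a" by (rule norm_mult_ineq)
  also have "\<dots> < 1" using a(2) mult_strict_mono[of "norm a" 1 "norm a" 1] by simp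
  finally have b: "norm (a * a) < 1" .
  note sq = sqrt_one_minus[OF b]
  have conv_pow: "star ((a * a) ^ n) = (a * a) ^ n" for n
    by (induction n) (simp_all add: star_one star_mult a power_commutes)
  have "star (suminf ?f) = (\<Sum>n. star (?f n))"
    by (rule bounded_linear.suminf[OF bounded_linear_star sq(1)])
  then have "star (suminf ?f) = suminf ?f" by (simp add: scaleR_scaleC star_scaleC conv_pow)
  moreover have "a * suminf ?f = suminf ?f * a"
  proof -
    have "a * (a * a) ^ n = (a * a) ^ n * a" for n
      by (induction n) (simp_all add: mult.assoc, metis mult.assoc)
    then have "(\<Sum>n. a * ?f n) = (\<Sum>n. ?f n * a)" by simp
    then show ?thesis
      by (simp only: bounded_linear.suminf[OF bounded_linear_mult_right sq(1)]
          bounded_linear.suminf[OF bounded_linear_mult_left sq(1)])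
  qed
  ultimately show ?thesis using sq(2) by blast
qed

lemma unitary_norm: "star u * u = 1 \<Longrightarrow> norm (u :: 'a::cstar_algebra) = 1"
  using cstar_identity[of u] norm_ge_zero[of u] by (simp add: power2_eq_1_iff)

text \<open>A self-adjoint contraction is the real part of a unitary.\<close>

lemma star_automorphism_contractive:
  fixes \<phi> :: "'a::cstar_algebra \<Rightarrow> 'a"
  assumes "star_automorphism \<phi>"
  shows "norm (\<phi> x) \<le> norm x"
proof -
  have \<phi>: "surj \<phi>" "\<And>x y. \<phi> (x + y) = \<phi> x + \<phi> y" "\<And>c x. \<phi> (c *\<^sub>C x) = c *\<^sub>C \<phi> x"
      "\<And>x y. \<phi> (x * y) = \<phi> x * \<phi> y" "\<And>x. \<phi> (star x) = star (\<phi> x)"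
    using assms by (auto simp: star_automorphism_def bij_def)
  \<comment> \<open>Multiplicativity alone makes \<open>\<phi> 1\<close> an idempotent; surjectivity
    makes it the unit.\<close>
  obtain y where "\<phi> y = 1" using \<phi>(1) by (metis surjD)
  then have one: "\<phi> 1 = 1" using \<phi>(4)[of y 1] by simp
  have unit: "norm (\<phi> a) \<le> 1" if a: "star a = a" "norm a < 1" for a
  proof -
    obtain c where c: "star c = c" "a * c = c * a" "c * c = 1 - a * a"
      using selfadjoint_complement_sqrt[OF a] by blast
    define u where "u = a + \<i> *\<^sub>C c"
    have su: "star u = a + (- \<i>) *\<^sub>C c" by (simp add: u_def star_add star_scaleC a c)
    have "star u * u = a * a + \<i> *\<^sub>C (a * c) + ((- \<i>) *\<^sub>C (c * a) + c * c)"
      unfolding su unfolding u_def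
      by (simp add: distrib_left distrib_right mult_scaleC_left mult_scaleC_right scaleC_scaleC algebra_simps)
    also have "\<dots> = 1" by (simp add: c algebra_simps)
    finally have "norm (\<phi> u) = 1" by (intro unitary_norm) (simp add: \<phi>(4,5)[symmetric] one)
    moreover have "norm (\<phi> (star u)) = norm (\<phi> u)" by (simp add: \<phi>(5) norm_star)
    moreover have "2 *\<^sub>C a = u + star u"
      using scaleC_add_left[of 1 1 a] unfolding su by (simp add: u_def)
    then have "2 *\<^sub>C \<phi> a = \<phi> u + \<phi> (star u)" by (metis \<phi>(2,3))
    then have "2 * norm (\<phi> a) = norm (\<phi> u + \<phi> (star u))" by (metis norm_numeral norm_scaleC)
    ultimately show ?thesis using norm_triangle_ineq[of "\<phi> u" "\<phi> (star u)"] by simp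
  qed
  have sa: "norm (\<phi> a) \<le> norm a" if a: "star a = a" for a
  proof (rule field_le_epsilon)
    fix e :: real assume e: "0 < e"
    \<comment> \<open>The excess over the norm puts the rescaled element strictly inside the unit
      ball, where the binomial series converges.\<close>
    let ?r = "norm a + e"
    have r: "?r > 0" using e by (simp add: add_nonneg_pos)
    have "norm (\<phi> (complex_of_real (1 / ?r) *\<^sub>C a)) \<le> 1"
    proof (rule unit)
      show "star (complex_of_real (1 / ?r) *\<^sub>C a) = complex_of_real (1 / ?r) *\<^sub>C a"
        by (simp only: star_scaleC a complex_cnj_complex_of_real)
      show "norm (complex_of_real (1 / ?r) *\<^sub>C a) < 1"
        using r e by (simp only: norm_scaleC norm_of_real) simp
    qed
    then have "norm (\<phi> a) / ?r \<le> 1"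
      using r by (simp only: \<phi>(3) norm_scaleC norm_of_real) simp
    then show "norm (\<phi> a) \<le> norm a + e" using r by (simp add: pos_divide_le_eq)
  qed
  \<comment> \<open>The C*-identity reduces the general case to the self-adjoint element
    \<open>star x * x\<close>.\<close>
  have "(norm (\<phi> x))\<^sup>2 = norm (\<phi> (star x * x))" by (simp add: cstar_identity \<phi>)
  also have "\<dots> \<le> norm (star x * x)" by (rule sa) (simp add: star_mult star_star)
  also have "\<dots> = (norm x)\<^sup>2" by (rule cstar_identity)
  finally show ?thesis by (rule power2_le_imp_le) simp
qed

lemma star_automorphism_bounded_linear:
  assumes "star_automorphism \<phi>"
  shows "bounded_linear \<phi>"
  using assms star_automorphism_contractive[OF assms]
  by (intro bounded_linear_intro[where K = 1]) (simp_all add: star_automorphism_def scaleR_scaleC)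

section \<open>Bases of algebraic Hilbert spaces\<close>

lemma scaleC_one_inject: "c *\<^sub>C (1::'a::cstar_algebra) = d *\<^sub>C 1 \<longleftrightarrow> c = d"
proof
  assume "c *\<^sub>C (1::'a) = d *\<^sub>C 1"
  then have "(c - d) *\<^sub>C (1::'a) = 0" by (simp add: cstar.scale_left_diff_distrib)
  then have "norm ((c - d) *\<^sub>C (1::'a)) = 0" by simp
  then show "c = d" by (simp add: norm_scaleC)
qed simp

lemma alg_inner_eq:
  assumes "algebraic_hilbert_space H" "A \<in> H" "B \<in> H"
  shows "star A * B = alg_inner A B *\<^sub>C 1"
proof -
  obtain c where "star A * B = c *\<^sub>C 1" using assms unfolding algebraic_hilbert_space_def by blast
  then show ?thesis unfolding alg_inner_def by (simp add: scaleC_one_inject)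
qed

lemma orthonormal_basis_star_mult:
  assumes "algebraic_hilbert_space H" "orthonormal_basis H n \<Phi>" "i < n" "j < n"
  shows "star (\<Phi> i) * \<Phi> j = (if i = j then 1 else 0)"
proof -
  have "\<Phi> i \<in> H" "\<Phi> j \<in> H"
    using assms by (auto simp: orthonormal_basis_def intro: cstar.span_base)
  from alg_inner_eq[OF assms(1) this] show ?thesis
    using assms by (simp add: orthonormal_basis_def)
qed

lemma canonical_endo_fixed_commute:
  assumes H: "algebraic_hilbert_space H" and ex: "orthonormal_basis H n \<Phi>"
    and z: "canonical_endo H z = z" and h: "h \<in> H"
  shows "z * h = h * z"
proof -
  obtain m \<Psi> where sel: "(SOME (n, \<Phi>). orthonormal_basis H n \<Phi>) = (m, \<Psi>)" by (metis surj_pair)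
  \<comment> \<open>\<open>canonical_endo\<close> works with a basis of its own choice; the given
    \<open>\<Phi>\<close> shows that this choice succeeds, and the computation is done in
    \<open>\<Psi>\<close>.\<close>
  have "case (SOME (n, \<Phi>). orthonormal_basis H n \<Phi>) of (n, \<Phi>) \<Rightarrow> orthonormal_basis H n \<Phi>"
    by (rule someI[of _ "(n, \<Phi>)"]) (use ex in simp)
  then have \<Psi>: "orthonormal_basis H m \<Psi>" unfolding sel by simp
  have zs: "z = (\<Sum>j<m. \<Psi> j * z * star (\<Psi> j))"
    using z unfolding canonical_endo_def sel by simp
  have basis: "z * \<Psi> k = \<Psi> k * z" if "k < m" for k
  proof -
    have "z * \<Psi> k = (\<Sum>j<m. \<Psi> j * z * star (\<Psi> j)) * \<Psi> k" using zs by simp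
    also have "\<dots> = (\<Sum>j<m. \<Psi> j * z * (star (\<Psi> j) * \<Psi> k))"
      by (simp add: sum_distrib_right mult.assoc)
    also have "\<dots> = (\<Sum>j<m. if j = k then \<Psi> j * z else 0)"
      using that by (intro sum.cong refl) (simp add: orthonormal_basis_star_mult[OF H \<Psi>])
    also have "\<dots> = \<Psi> k * z" using that by simp
    finally show ?thesis .
  qed
  have "h \<in> cstar.span (\<Psi> ` {..<m})" using h \<Psi> by (simp add: orthonormal_basis_def)
  then show ?thesis
  proof (induction rule: cstar.span_induct_alt)
    case (step c x y)
    then have "z * x = x * z" using basis by auto
    then show ?case
      using step by (simp add: distrib_left distrib_right mult_scaleC_left mult_scaleC_right)
  qed simp
qed

section \<open>Fourier components of a compact action\<close>

context compact_haar
begin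

section \<open>Entries of unitary representations\<close>

lemma rep_zero:
  assumes "unitary_rep n \<pi>"
  shows "\<pi> 0 = 1\<^sub>m n"
proof -
  have c: "\<pi> 0 \<in> carrier_mat n n" "mat_adjoint (\<pi> 0) * \<pi> 0 = 1\<^sub>m n" "\<pi> (0 + 0) = \<pi> 0 * \<pi> 0"
    using assms unfolding unitary_rep_def by blast+
  note a = mat_adjoint_carrier[OF c(1)]
  have "\<pi> 0 = (mat_adjoint (\<pi> 0) * \<pi> 0) * \<pi> 0" using c by simp
  also have "\<dots> = mat_adjoint (\<pi> 0) * \<pi> 0" using c(3) assoc_mult_mat[OF a c(1) c(1)] by simp
  finally show ?thesis using c(2) by simp
qed

text \<open>\<open>\<pi> (- g)\<close> is a right inverse of \<open>\<pi> g\<close> and so agrees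
  with the left inverse \<open>mat_adjoint (\<pi> g)\<close>.\<close>

lemma rep_uminus_entry:
  assumes \<pi>: "unitary_rep n \<pi>" and ij: "i < n" "j < n"
  shows "cnj (\<pi> (- g) $$ (i, j)) = \<pi> g $$ (j, i)"
proof -
  have c: "\<pi> g \<in> carrier_mat n n" "\<pi> (- g) \<in> carrier_mat n n" "mat_adjoint (\<pi> g) * \<pi> g = 1\<^sub>m n"
      "\<pi> (g + - g) = \<pi> g * \<pi> (- g)"
    using \<pi> unfolding unitary_rep_def by blast+
  note a = mat_adjoint_carrier[OF c(1)]
  have "\<pi> (- g) = (mat_adjoint (\<pi> g) * \<pi> g) * \<pi> (- g)" using c by simp
  also have "\<dots> = mat_adjoint (\<pi> g) * \<pi> (g + - g)" using c(4) assoc_mult_mat[OF a c(1,2)] by simp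
  also have "\<dots> = mat_adjoint (\<pi> g)" using a by (simp add: rep_zero[OF \<pi>])
  finally show ?thesis using mat_adjoint_entry[OF c(1) ij] by simp
qed

text \<open>Unitarity as defined gives orthonormal columns; orthonormal rows come from the product
  in the order \<open>\<pi> g * \<pi> (- g)\<close>.\<close>

lemma rep_row_orthogonal:
  assumes \<pi>: "unitary_rep n \<pi>" and lm: "l < n" "m < n"
  shows "(\<Sum>j<n. \<pi> g $$ (l, j) * cnj (\<pi> g $$ (m, j))) = (if l = m then 1 else 0)"
proof -
  have "(\<Sum>j<n. \<pi> g $$ (l, j) * cnj (\<pi> g $$ (m, j))) = (\<Sum>j<n. \<pi> g $$ (l, j) * \<pi> (- g) $$ (j, m))"
    by (intro sum.cong refl) (simp add: rep_uminus_entry[OF \<pi> _ lm(2), symmetric])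
  also have "\<dots> = \<pi> (g + - g) $$ (l, m)" by (rule rep_entry[OF \<pi> lm, symmetric])
  finally show ?thesis using lm by (simp add: rep_zero[OF \<pi>])
qed

end

locale compact_action = compact_haar \<mu> for \<mu> :: "'g::{topological_group_add, t2_space} measure" +
  fixes \<alpha> :: "'g \<Rightarrow> 'f::cstar_algebra \<Rightarrow> 'f"
  assumes action: "group_action \<alpha>"
begin

section \<open>Elementary properties of the action\<close>

lemma star_aut: "star_automorphism (\<alpha> g)"
  using action by (simp add: group_action_def)

lemma action_add: "\<alpha> (g + h) F = \<alpha> g (\<alpha> h F)"
  using action by (simp add: group_action_def)

lemma action_cont: "continuous_on UNIV (\<lambda>g. \<alpha> g F)"
  using action by (simp add: group_action_def)

lemma action_hom: "\<alpha> g (x * y) = \<alpha> g x * \<alpha> g y" "\<alpha> g (star x) = star (\<alpha> g x)" "\<alpha> g (c *\<^sub>C x) = c *\<^sub>C \<alpha> g x"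
  using star_aut[of g] by (simp_all add: star_automorphism_def)

lemma action_linear: "bounded_linear (\<alpha> g)"
  by (rule star_automorphism_bounded_linear[OF star_aut])

lemma action_contractive: "norm (\<alpha> g x) \<le> norm x"
  by (rule star_automorphism_contractive[OF star_aut])

lemma action_sum: "\<alpha> g (\<Sum>i\<in>I. f i) = (\<Sum>i\<in>I. \<alpha> g (f i))"
  using linear_sum[OF bounded_linear.linear[OF action_linear]] by blast

lemma action_zero: "\<alpha> 0 x = x"
proof -
  have "\<alpha> 0 (\<alpha> 0 x) = \<alpha> 0 x" using action_add[of 0 0 x] by simp
  moreover have "inj (\<alpha> 0)" using star_aut[of 0] by (simp add: star_automorphism_def bij_def)
  ultimately show ?thesis by (simp add: inj_eq)
qed

lemma cont_smear: "cont u \<Longrightarrow> continuous_on UNIV (\<lambda>g. u g *\<^sub>C \<alpha> g X)"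
  by (intro continuous_intros action_cont)

text \<open>The functions \<open>u \<star> u\<close> with \<open>u\<close> supported where \<open>\<alpha> g X\<close> is close to \<open>X\<close> form an approximate
  identity at \<open>X\<close>.\<close>

lemma smear_zero_imp_zero:
  assumes orth: "\<And>c. c \<in> matrix_matrix_coefs \<Longrightarrow> haar_integral (\<lambda>g. c g *\<^sub>C \<alpha> g X) = 0"
  shows "X = 0"
proof (rule ccontr)
  assume "X \<noteq> 0"
  \<comment> \<open>The averaging argument bounds the norm of \<open>X\<close> by
    \<open>2 * \<epsilon>\<close>; the divisor 4 makes this half of the norm.\<close>
  define \<epsilon> where "\<epsilon> = norm X / 4"
  have \<epsilon>: "\<epsilon> > 0" using \<open>X \<noteq> 0\<close> by (simp add: \<epsilon>_def)
  \<comment> \<open>A bump function cut from the orbit of \<open>X\<close> itself: continuous,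
    positive at 0, and zero wherever \<open>\<alpha> g\<close> moves \<open>X\<close> by
    \<open>\<epsilon>\<close> or more.\<close>
  define r where "r g = max 0 (\<epsilon> - norm (\<alpha> g X - X))" for g
  have r0: "r g \<ge> 0" for g by (simp add: r_def)
  have rc: "continuous_on UNIV r" unfolding r_def[abs_def] by (intro continuous_intros action_cont)
  define u where "u g = complex_of_real (r g)" for g
  have u: "cont u" unfolding u_def[abs_def] by (intro continuous_intros rc)
  define W where "W g = haar_integral (\<lambda>y. r y * r (- y + g))" for g
  have ck: "continuous_on UNIV (\<lambda>y. r y * r (- y + g))" for g
    by (intro continuous_intros rc continuous_on_compose2[OF rc]) auto
  have uW: "(u \<star> u) g = complex_of_real (W g)" for g
    unfolding conv_def W_def u_def using haar_integral_linear[OF bounded_linear_of_real[where 'a = complex] ck] by simp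
  have W0: "W g \<ge> 0" for g unfolding W_def by (rule haar_integral_nonneg[OF ck]) (simp add: r0)
  have "W = (\<lambda>g. Re ((u \<star> u) g))" by (simp add: uW)
  then have Wc: "continuous_on UNIV W" by (simp add: continuous_on_Re cont_conv u)
  have "r 0 > 0" using \<epsilon> by (simp add: r_def action_zero)
  then have "W 0 > 0" unfolding W_def
    by (intro haar_integral_pos[where a = 0, OF ck]) (simp_all add: r0)
  then have HW: "haar_integral W > 0" by (intro haar_integral_pos[where a = 0, OF Wc W0])
  \<comment> \<open>Where \<open>W g\<close> is nonzero, g is a sum of some y and - y + g that each
    move \<open>X\<close> by less than \<open>\<epsilon>\<close>; contractivity of
    \<open>\<alpha> y\<close> lets the two displacements be added.\<close>
  have supp: "W g * norm (X - \<alpha> g X) \<le> 2 * \<epsilon> * W g" for g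
  proof (cases "norm (X - \<alpha> g X) \<le> 2 * \<epsilon>")
    case True
    then show ?thesis using mult_left_mono[OF True W0[of g]] by (simp add: mult_ac)
  next
    case False
    have "r y * r (- y + g) = 0" for y
    proof (rule ccontr)
      assume "r y * r (- y + g) \<noteq> 0"
      then have *: "norm (\<alpha> y X - X) < \<epsilon>" "norm (\<alpha> (- y + g) X - X) < \<epsilon>"
        by (auto simp: r_def max_def split: if_splits)
      have "\<alpha> g X - X = \<alpha> y (\<alpha> (- y + g) X - X) + (\<alpha> y X - X)"
        by (simp add: linear_diff[OF bounded_linear.linear[OF action_linear]] action_add[symmetric] add.assoc[symmetric])
      then have "norm (\<alpha> g X - X) \<le> norm (\<alpha> y (\<alpha> (- y + g) X - X)) + norm (\<alpha> y X - X)"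
        by (metis norm_triangle_ineq)
      also have "\<dots> < 2 * \<epsilon>" using * action_contractive[of y "\<alpha> (- y + g) X - X"] by linarith
      finally show False using False by (simp add: norm_minus_commute)
    qed
    then have "W g = haar_integral (\<lambda>_. 0)" by (simp only: W_def)
    then have "W g = 0" by simp
    then show ?thesis by simp
  qed
  \<comment> \<open>The hypothesis passes from matrix coefficients to their uniform limit
    \<open>u \<star> u\<close>, since \<open>norm (\<alpha> g X)\<close> is at most
    \<open>norm X\<close>.\<close>
  have zero: "haar_integral (\<lambda>g. (u \<star> u) g *\<^sub>C \<alpha> g X) = 0"
  proof -
    obtain c where c: "\<And>n. c n \<in> matrix_matrix_coefs" "uniform_limit UNIV c (u \<star> u) sequentially"
      using peter_weyl[OF u u] by blast
    have "norm (haar_integral (\<lambda>g. (u \<star> u) g *\<^sub>C \<alpha> g X)) \<le> 0"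
    proof (rule field_le_epsilon)
      fix e :: real assume e: "0 < e"
      then have "e / norm X > 0" using \<open>X \<noteq> 0\<close> by simp
      then obtain n where n: "\<And>g. cmod (c n g - (u \<star> u) g) < e / norm X"
        using c(2) unfolding uniform_limit_iff eventually_sequentially dist_norm by (metis UNIV_I order_refl)
      have cn: "cont (c n)" by (rule matrix_matrix_coefs_cont[OF c(1)])
      have "norm (haar_integral (\<lambda>g. ((u \<star> u) g - c n g) *\<^sub>C \<alpha> g X)) \<le> e"
      proof (rule haar_integral_norm_bound)
        show "continuous_on UNIV (\<lambda>g. ((u \<star> u) g - c n g) *\<^sub>C \<alpha> g X)"
          by (intro cont_smear continuous_intros u cn)
        fix g
        have "norm (((u \<star> u) g - c n g) *\<^sub>C \<alpha> g X) \<le> (e / norm X) * norm X"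
          unfolding norm_scaleC using n[of g] e
          by (intro mult_mono action_contractive) (auto simp: norm_minus_commute less_imp_le)
        then show "norm (((u \<star> u) g - c n g) *\<^sub>C \<alpha> g X) \<le> e" using \<open>X \<noteq> 0\<close> by simp
      qed
      moreover have "haar_integral (\<lambda>g. ((u \<star> u) g - c n g) *\<^sub>C \<alpha> g X)
          = haar_integral (\<lambda>g. (u \<star> u) g *\<^sub>C \<alpha> g X) - haar_integral (\<lambda>g. c n g *\<^sub>C \<alpha> g X)"
        unfolding cstar.scale_left_diff_distrib
        by (rule haar_integral_diff) (intro cont_smear continuous_intros u cn)+
      ultimately show "norm (haar_integral (\<lambda>g. (u \<star> u) g *\<^sub>C \<alpha> g X)) \<le> 0 + e"
        using orth[OF c(1)] by simp
    qed
    then show ?thesis by simp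
  qed
  have c1: "continuous_on UNIV (\<lambda>g. W g *\<^sub>R X)" "continuous_on UNIV (\<lambda>g. W g *\<^sub>R \<alpha> g X)"
    by (intro continuous_intros Wc action_cont)+
  \<comment> \<open>Averaged against \<open>W\<close>, the term with \<open>\<alpha> g X\<close>
    drops out, so the norm of \<open>X\<close> times the mass of \<open>W\<close> is bounded by the
    displacement of \<open>X\<close> on the support of \<open>W\<close>.\<close>
  have "haar_integral (\<lambda>g. W g *\<^sub>R (X - \<alpha> g X)) = haar_integral (\<lambda>g. W g *\<^sub>R X) - haar_integral (\<lambda>g. W g *\<^sub>R \<alpha> g X)"
    unfolding scaleR_diff_right by (rule haar_integral_diff[OF c1])
  also have "haar_integral (\<lambda>g. W g *\<^sub>R \<alpha> g X) = 0" using zero by (simp add: uW scaleR_scaleC)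
  also have "haar_integral (\<lambda>g. W g *\<^sub>R X) = haar_integral W *\<^sub>R X"
    by (rule haar_integral_linear[OF bounded_linear_scaleR_left Wc])
  finally have "haar_integral W * norm X = norm (haar_integral (\<lambda>g. W g *\<^sub>R (X - \<alpha> g X)))" using HW by simp
  also have "\<dots> \<le> haar_integral (\<lambda>g. norm (W g *\<^sub>R (X - \<alpha> g X)))"
    by (rule haar_integral_norm_le) (intro continuous_intros Wc action_cont)
  also have "\<dots> \<le> haar_integral (\<lambda>g. 2 * \<epsilon> * W g)"
    by (rule haar_integral_mono) (auto intro!: continuous_intros Wc action_cont simp: supp W0)
  also have "\<dots> = 2 * \<epsilon> * haar_integral W" by (rule haar_integral_linear[OF bounded_linear_mult_right Wc])
  finally have "norm X \<le> 2 * \<epsilon>" using HW by (simp add: mult.commute)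
  then show False using \<epsilon> by (simp add: \<epsilon>_def)
qed

text \<open>A refinement of \<open>spectral_projection\<close>: for \<open>\<pi>\<close> of
  dimension n, n times the sum of the diagonal components is the integral that defines it.\<close>

definition fourier :: "('g \<Rightarrow> complex mat) \<Rightarrow> nat \<Rightarrow> nat \<Rightarrow> 'f \<Rightarrow> 'f"
  where "fourier \<pi> j k F = haar_integral (\<lambda>g. cnj (\<pi> g $$ (j, k)) *\<^sub>C \<alpha> g F)"

text \<open>Left invariance moves h from the action into the kernel. For fixed \<open>k\<close> the
  components transform by \<open>\<pi>\<close> in the index \<open>j\<close>, exactly like the basis
  of an algebraic Hilbert space that carries \<open>\<pi>\<close>.\<close>

lemma fourier_action:
  assumes \<pi>: "unitary_rep n \<pi>" and jk: "j < n" "k < n"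
  shows "\<alpha> h (fourier \<pi> j k F) = (\<Sum>l<n. \<pi> h $$ (l, j) *\<^sub>C fourier \<pi> l k F)"
proof -
  have c: "cont (\<lambda>g. cnj (\<pi> g $$ (i, k)))" if "i < n" for i
    by (intro continuous_on_cnj rep_cont[OF \<pi> that jk(2)])
  have c': "cont (\<lambda>g. cnj (\<pi> (- h + g) $$ (j, k)))"
    by (rule continuous_translate[OF c[OF jk(1)]])
  have "\<alpha> h (fourier \<pi> j k F) = haar_integral (\<lambda>g. \<alpha> h (cnj (\<pi> g $$ (j, k)) *\<^sub>C \<alpha> g F))"
    unfolding fourier_def by (rule haar_integral_linear[OF action_linear cont_smear[OF c[OF jk(1)]], symmetric])
  also have "\<dots> = haar_integral (\<lambda>g. cnj (\<pi> (- h + (h + g)) $$ (j, k)) *\<^sub>C \<alpha> (h + g) F)"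
    by (simp add: action_hom action_add add.assoc[symmetric])
  also have "\<dots> = haar_integral (\<lambda>g. cnj (\<pi> (- h + g) $$ (j, k)) *\<^sub>C \<alpha> g F)"
    by (rule haar_integral_left[OF cont_smear[OF c']])
  also have "\<dots> = haar_integral (\<lambda>g. \<Sum>l<n. \<pi> h $$ (l, j) *\<^sub>C (cnj (\<pi> g $$ (l, k)) *\<^sub>C \<alpha> g F))"
  proof (intro arg_cong[of _ _ haar_integral] ext)
    fix g
    have "cnj (\<pi> (- h + g) $$ (j, k)) = (\<Sum>l<n. cnj (\<pi> (- h) $$ (j, l)) * cnj (\<pi> g $$ (l, k)))"
      by (simp add: rep_entry[OF \<pi> jk])
    also have "\<dots> = (\<Sum>l<n. \<pi> h $$ (l, j) * cnj (\<pi> g $$ (l, k)))"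
      by (intro sum.cong refl) (simp add: rep_uminus_entry[OF \<pi> jk(1)])
    finally show "cnj (\<pi> (- h + g) $$ (j, k)) *\<^sub>C \<alpha> g F
        = (\<Sum>l<n. \<pi> h $$ (l, j) *\<^sub>C (cnj (\<pi> g $$ (l, k)) *\<^sub>C \<alpha> g F))"
      by (simp only: cstar.scale_sum_left scaleC_scaleC)
  qed
  also have "\<dots> = (\<Sum>l<n. haar_integral (\<lambda>g. \<pi> h $$ (l, j) *\<^sub>C (cnj (\<pi> g $$ (l, k)) *\<^sub>C \<alpha> g F)))"
    by (rule haar_integral_sum) (intro continuous_on_scaleC continuous_on_const action_cont c, simp)
  also have "\<dots> = (\<Sum>l<n. \<pi> h $$ (l, j) *\<^sub>C fourier \<pi> l k F)"
    unfolding fourier_def by (intro sum.cong refl haar_integral_linear bounded_linear_scaleC cont_smear c) simp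
  finally show ?thesis .
qed

text \<open>Contracting the Fourier components with a basis of the algebraic Hilbert space gives fixed
  points, so the components lie in the fixed point algebra times that Hilbert space.\<close>

lemma fourier_factorisation:
  assumes \<pi>: "unitary_rep n \<pi>" and jk: "j < n" "k < n"
    and \<Phi>: "\<And>i j. i < n \<Longrightarrow> j < n \<Longrightarrow> star (\<Phi> i) * \<Phi> j = (if i = j then 1 else 0)"
    and \<alpha>\<Phi>: "\<And>g j. j < n \<Longrightarrow> \<alpha> g (\<Phi> j) = (\<Sum>i<n. \<pi> g $$ (i, j) *\<^sub>C \<Phi> i)"
  shows "\<exists>A\<in>fixed_point_algebra \<alpha>. fourier \<pi> j k F = A * \<Phi> j"
proof
  let ?E = "\<lambda>l. fourier \<pi> l k F"
  let ?A = "\<Sum>j<n. ?E j * star (\<Phi> j)"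
  show "?A \<in> fixed_point_algebra \<alpha>"
    unfolding fixed_point_algebra_def
  proof (intro CollectI allI)
    fix h
    have "\<alpha> h ?A = (\<Sum>j<n. \<alpha> h (?E j) * star (\<alpha> h (\<Phi> j)))"
      by (simp only: action_sum action_hom)
    also have "\<dots> = (\<Sum>j<n. (\<Sum>l<n. \<pi> h $$ (l, j) *\<^sub>C ?E l) * (\<Sum>m<n. cnj (\<pi> h $$ (m, j)) *\<^sub>C star (\<Phi> m)))"
      by (intro sum.cong refl) (simp add: fourier_action[OF \<pi> _ jk(2)] \<alpha>\<Phi> star_sum star_scaleC)
    also have "\<dots> = (\<Sum>j<n. \<Sum>l<n. \<Sum>m<n. (\<pi> h $$ (l, j) * cnj (\<pi> h $$ (m, j))) *\<^sub>C (?E l * star (\<Phi> m)))"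
      by (simp add: sum_product mult_scaleC_left mult_scaleC_right scaleC_scaleC mult.commute)
    \<comment> \<open>The components contribute entries of \<open>\<pi> h\<close>, the adjoints of
      the basis contribute conjugated ones. Summing over j first brings in row
      orthogonality.\<close>
    also have "\<dots> = (\<Sum>l<n. \<Sum>j<n. \<Sum>m<n. (\<pi> h $$ (l, j) * cnj (\<pi> h $$ (m, j))) *\<^sub>C (?E l * star (\<Phi> m)))"
      by (rule sum.swap)
    also have "\<dots> = (\<Sum>l<n. \<Sum>m<n. \<Sum>j<n. (\<pi> h $$ (l, j) * cnj (\<pi> h $$ (m, j))) *\<^sub>C (?E l * star (\<Phi> m)))"
      by (intro sum.cong refl sum.swap)
    also have "\<dots> = (\<Sum>l<n. \<Sum>m<n. (if l = m then 1 else 0) *\<^sub>C (?E l * star (\<Phi> m)))"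
      by (intro sum.cong refl) (simp add: cstar.scale_sum_left[symmetric] rep_row_orthogonal[OF \<pi>])
    also have "\<dots> = (\<Sum>l<n. \<Sum>m<n. if l = m then ?E l * star (\<Phi> m) else 0)"
      by (intro sum.cong refl) simp
    also have "\<dots> = ?A" by simp
    finally show "\<alpha> h ?A = ?A" .
  qed
  have "?A * \<Phi> j = (\<Sum>i<n. ?E i * (star (\<Phi> i) * \<Phi> j))" by (simp add: sum_distrib_right mult.assoc)
  also have "\<dots> = (\<Sum>i<n. if i = j then ?E i else 0)"
    using jk by (intro sum.cong refl) (simp add: \<Phi>)
  finally show "?E j = ?A * \<Phi> j" using jk by simp
qed

text \<open>An element need not be the norm limit of the partial sums of its Fourier components, so
  commutation is not carried over term by term: the commutator itself is shown to have vanishing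
  components.\<close>

lemma central_if_commutes:
  assumes fixp: "z \<in> fixed_point_center \<alpha>"
    and ex: "\<And>n \<pi>. irreducible_unitary_rep n \<pi> \<Longrightarrow>
      \<exists>H. algebraic_hilbert_space H \<and> carries_rep \<alpha> H n \<pi> \<and> (\<forall>h\<in>H. z * h = h * z)"
  shows "z * F = F * z"
proof -
  let ?X = "z * F - F * z"
  have \<alpha>z: "\<alpha> g z = z" for g using fixp by (simp add: fixed_point_center_def fixed_point_algebra_def)
  have zA: "z * A = A * z" if "A \<in> fixed_point_algebra \<alpha>" for A
    using fixp that by (simp add: fixed_point_center_def commutant_def)
  have \<alpha>X: "\<alpha> g ?X = z * \<alpha> g F - \<alpha> g F * z" for g
    by (simp add: linear_diff[OF bounded_linear.linear[OF action_linear]] action_hom \<alpha>z)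
  have coef: "haar_integral (\<lambda>g. cnj (\<pi> g $$ (j, k)) *\<^sub>C \<alpha> g ?X) = 0"
    if irr: "irreducible_unitary_rep n \<pi>" and jk: "j < n" "k < n" for n \<pi> j k
  proof -
    obtain H \<Phi> where H: "algebraic_hilbert_space H" "\<And>h. h \<in> H \<Longrightarrow> z * h = h * z"
      and \<Phi>: "orthonormal_basis H n \<Phi>" "\<And>g j. j < n \<Longrightarrow> \<alpha> g (\<Phi> j) = (\<Sum>i<n. \<pi> g $$ (i, j) *\<^sub>C \<Phi> i)"
      using ex[OF irr] unfolding carries_rep_def by blast
    have u: "unitary_rep n \<pi>" using irr by (simp add: irreducible_unitary_rep_def)
    obtain A where A: "A \<in> fixed_point_algebra \<alpha>" "fourier \<pi> j k F = A * \<Phi> j"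
      using fourier_factorisation[OF u jk orthonormal_basis_star_mult[OF H(1) \<Phi>(1)] \<Phi>(2)] by blast
    have "\<Phi> j \<in> H" using \<Phi>(1) jk by (auto simp: orthonormal_basis_def intro: cstar.span_base)
    then have comm: "z * fourier \<pi> j k F = fourier \<pi> j k F * z"
      unfolding A(2) using zA[OF A(1)] H(2) by (metis mult.assoc)
    have c: "continuous_on UNIV (\<lambda>g. cnj (\<pi> g $$ (j, k)) *\<^sub>C \<alpha> g F)"
      by (rule cont_smear[OF cont_entry[OF irr jk]])
    have "haar_integral (\<lambda>g. cnj (\<pi> g $$ (j, k)) *\<^sub>C \<alpha> g ?X)
        = haar_integral (\<lambda>g. z * (cnj (\<pi> g $$ (j, k)) *\<^sub>C \<alpha> g F) - (cnj (\<pi> g $$ (j, k)) *\<^sub>C \<alpha> g F) * z)"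
      unfolding \<alpha>X by (simp add: cstar.scale_right_diff_distrib mult_scaleC_left mult_scaleC_right)
    also have "\<dots> = haar_integral (\<lambda>g. z * (cnj (\<pi> g $$ (j, k)) *\<^sub>C \<alpha> g F)) - haar_integral (\<lambda>g. (cnj (\<pi> g $$ (j, k)) *\<^sub>C \<alpha> g F) * z)"
      by (rule haar_integral_diff) (intro continuous_on_mult continuous_on_const c)+
    also have "\<dots> = z * fourier \<pi> j k F - fourier \<pi> j k F * z"
      unfolding fourier_def
      by (simp only: haar_integral_linear[OF bounded_linear_mult_right c] haar_integral_linear[OF bounded_linear_mult_left c])
    finally show ?thesis using comm by simp
  qed
  have "haar_integral (\<lambda>g. c g *\<^sub>C \<alpha> g ?X) = 0" if "c \<in> matrix_matrix_coefs" for c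
    using that
  proof (induction rule: matrix_matrix_coefs.induct)
    case matrix_matrix_coefs_zero
    then show ?case by simp
  next
    case (matrix_matrix_coefs_add c n \<pi> i j a)
    let ?w = "\<lambda>g. cnj (\<pi> g $$ (i, j))"
    have c: "cont c" "cont ?w" using matrix_matrix_coefs_add by (auto intro: matrix_matrix_coefs_cont cont_entry)
    have "haar_integral (\<lambda>g. (c g + a * ?w g) *\<^sub>C \<alpha> g ?X) = haar_integral (\<lambda>g. c g *\<^sub>C \<alpha> g ?X + a *\<^sub>C (?w g *\<^sub>C \<alpha> g ?X))"
      by (simp only: scaleC_add_left scaleC_scaleC)
    also have "\<dots> = haar_integral (\<lambda>g. c g *\<^sub>C \<alpha> g ?X) + haar_integral (\<lambda>g. a *\<^sub>C (?w g *\<^sub>C \<alpha> g ?X))"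
      by (rule haar_integral_add) (intro continuous_on_scaleC continuous_on_const cont_smear c)+
    also have "haar_integral (\<lambda>g. a *\<^sub>C (?w g *\<^sub>C \<alpha> g ?X)) = a *\<^sub>C haar_integral (\<lambda>g. ?w g *\<^sub>C \<alpha> g ?X)"
      by (rule haar_integral_linear[OF bounded_linear_scaleC cont_smear[OF c(2)]])
    finally show ?case using matrix_matrix_coefs_add coef by simp
  qed
  then have "?X = 0" by (rule smear_zero_imp_zero)
  then show ?thesis by simp
qed

end

theorem proposition7p1:
  fixes \<mu> :: "'g::{topological_group_add, t2_space} measure"
    and \<alpha> :: "'g \<Rightarrow> 'f::cstar_algebra \<Rightarrow> 'f"
  assumes "hilbert_cstar_system \<mu> \<alpha>"
    and "minimal_system \<alpha>"
    and "property_B (fixed_point_algebra \<alpha>)"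
    and "\<And>H Z. algebraic_hilbert_space H \<Longrightarrow> invariant_space \<alpha> H \<Longrightarrow>
           Z \<in> fixed_point_center \<alpha> \<Longrightarrow> canonical_endo H Z = Z"
  shows "UNIV \<inter> commutant UNIV = fixed_point_center \<alpha>"
proof (rule equalityI)
  have "commutant UNIV \<subseteq> commutant (fixed_point_algebra \<alpha>)" by (auto simp: commutant_def)
  then show "UNIV \<inter> commutant UNIV \<subseteq> fixed_point_center \<alpha>"
    using assms(2) by (simp add: minimal_system_def)
  interpret compact_action \<mu> \<alpha>
    by unfold_locales (use assms(1) in \<open>auto simp: hilbert_cstar_system_def\<close>)
  show "fixed_point_center \<alpha> \<subseteq> UNIV \<inter> commutant UNIV"
  proof
    fix z assume z: "z \<in> fixed_point_center \<alpha>"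
    have "\<exists>H. algebraic_hilbert_space H \<and> carries_rep \<alpha> H n \<pi> \<and> (\<forall>h\<in>H. z * h = h * z)"
      if irr: "irreducible_unitary_rep n \<pi>" for n and \<pi> :: "'g \<Rightarrow> complex mat"
    proof -
      obtain H where H: "algebraic_hilbert_space H" "invariant_space \<alpha> H" "carries_rep \<alpha> H n \<pi>"
        using assms(1) irr unfolding hilbert_cstar_system_def by blast
      obtain \<Phi> where \<Phi>: "orthonormal_basis H n \<Phi>" using H(3) by (auto simp: carries_rep_def)
      have "z * h = h * z" if "h \<in> H" for h
        by (rule canonical_endo_fixed_commute[OF H(1) \<Phi> assms(4)[OF H(1,2) z] that])
      then show ?thesis using H by blast
    qed
    from central_if_commutes[OF z this] show "z \<in> UNIV \<inter> commutant UNIV"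
      by (simp add: commutant_def)
  qed
qed

end
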